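(* Let $\mathfrak U$ be a monster model of $\mathsf{DMT}$. Then the domination monoid satisfies $$\widetilde{\mathrm{Inv}}(\mathfrak U)\cong\mathscr P_{\mathrm{fin}}(X)\oplus\bigoplus_{g\in\mathfrak U}\mathbb N$$ for a set $X$. Generators of the copies of $\mathbb N$ correspond to types of elements in a new open cone above a point $g\in\mathfrak U$ (types of kind (II)), while each point of $X$ corresponds to one of: (1) a linearly ordered subset of $\mathfrak U$ with small coinitiality, modulo mutual coinitiality (corresponding to types of kind (Ia)/(IIIa)); (2) a cut with no maximum but with small cofinality (corresponding to some types of kind (Ib)/(IIIb)); (3) an existing open cone above an existing point (corresponding to the remaining types of kind (Ib)/(IIIb)).
   Context: $\mathsf{DMT}$ is the theory of dense meet-trees in the language $\{<,\sqcap\}$: $<$ is a partial order in which each set of predecessors is a dense linear order without endpoints, any two elements have a meet $\sqcap$, and above each point $a$ there are infinitely many open cones (classes of $x\sqcap y>a$ on $\{x:x>a\}$). $\mathfrak U$ is $\kappa$-saturated, $\kappa$-strongly homogeneous for large $\kappa$; small means size $<\kappa$. Invariant global types, the tensor product $\otimes$ (for invariant $p$: $\varphi(x,y)\in p\otimes q$ iff $\varphi(x,b)\in p\mid\mathfrak U b$, $b\models q$, where $p\mid\mathfrak U b$ is the unique invariant extension over the same base), and domination ($p\ge_D q$ iff for some small $A$ and $r\in S_{xy}(A)$ extending $(p\restriction A)\cup(q\restriction A)$, $p\cup r\vdash q$; $\sim_D$ the induced equivalence) are as usual. $\widetilde{\mathrm{Inv}}(\mathfrak U)$ is the quotient of the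 set of global invariant types by $\sim_D$, with operation induced by $\otimes$ (well defined in $\mathsf{DMT}$), neutral element the class of realised types, and order induced by $\ge_D$. $\mathscr P_{\mathrm{fin}}(X)$ is the monoid (upper semilattice) of finite subsets of $X$ under union; $\bigoplus$ denotes direct sum (finitely supported elements). Kinds of $p\in S_1(\mathfrak U)$: (Ia) for a small linearly ordered $A$, $p\vdash\{x<a:a\in A\}\cup\{x>b:b\in\mathfrak U, b<A\}$; (Ib) for a small linearly ordered $A$ without maximum, $p\vdash\{x>a:a\in A\}\cup\{x<b:b\in\mathfrak U,b>A\}$, or for $a,c\in\mathfrak U$, $p\vdash\{a<x<c\}\cup\{x<b:b\in\mathfrak U,a<b<c\}$; (II) for some $g$, $p\vdash\{x>g\}\cup\{x\sqcap b=g: b\in\mathfrak U,b>g\}$; (IIIa)/(IIIb): $p\vdash\{x\not\le b:b\in\mathfrak U\}$ and for some $c\in\mathfrak U$, $\operatorname{tp}(x\sqcap c/\mathfrak U)$ is of kind (Ia)/(Ib). The cut of $p$ is $\{c\in\mathfrak U:p\vdash x\ge c\}$. *)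

theory Defs
  imports "HOL-Algebra.Group" "HOL-Library.Poly_Mapping"
begin

unbundle cardinal_syntax

definition (in semilattice_inf) open_cones :: "'a \<Rightarrow> 'a set set" where
  "open_cones g = {x. g < x} // {(x, y). g < x \<and> g < y \<and> g < inf x y}"

text \<open>Density of the whole order says at once that each set of predecessors is dense and has no
  maximum; \<^class>\<open>no_bot\<close> says at once that it is nonempty and has no minimum.\<close>

class dense_meet_tree = semilattice_inf + dense_order + no_bot +
  assumes predecessors_linear: "x < a \<Longrightarrow> y < a \<Longrightarrow> x \<le> y \<or> y \<le> x"
    and infinite_open_cones: "infinite (open_cones a)"

text \<open>Free variables are de Bruijn indices: under \<open>Ex\<close> the bound variable is 0, and the free
  variable \<open>i\<close> is called \<open>Suc i\<close>. A tuple of variables \<open>x\<close> of length \<open>n\<close> is 0, ..., \<open>n - 1\<close>.\<close>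

datatype (tparams: 'a) trm = Var nat | Par 'a | Meet "'a trm" "'a trm"

datatype (params: 'a) fm =
    Eq "'a trm" "'a trm"
  | Less "'a trm" "'a trm"
  | Neg "'a fm"
  | Conj "'a fm" "'a fm"
  | Ex "'a fm"
  for map: map_fm

definition Le :: "'a trm \<Rightarrow> 'a trm \<Rightarrow> 'a fm" where
  "Le s t = Neg (Conj (Neg (Less s t)) (Neg (Eq s t)))"

fun tval :: "(nat \<Rightarrow> 'a::inf) \<Rightarrow> 'a trm \<Rightarrow> 'a" where
  "tval e (Var i) = e i"
| "tval e (Par a) = a"
| "tval e (Meet s t) = inf (tval e s) (tval e t)"

fun sat :: "(nat \<Rightarrow> 'a::{ord,inf}) \<Rightarrow> 'a fm \<Rightarrow> bool" where
  "sat e (Eq s t) \<longleftrightarrow> tval e s = tval e t"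
| "sat e (Less s t) \<longleftrightarrow> tval e s < tval e t"
| "sat e (Neg \<phi>) \<longleftrightarrow> \<not> sat e \<phi>"
| "sat e (Conj \<phi> \<psi>) \<longleftrightarrow> sat e \<phi> \<and> sat e \<psi>"
| "sat e (Ex \<phi>) \<longleftrightarrow> (\<exists>a. sat (case_nat a e) \<phi>)"

fun tvars :: "'a trm \<Rightarrow> nat set" where
  "tvars (Var i) = {i}"
| "tvars (Par a) = {}"
| "tvars (Meet s t) = tvars s \<union> tvars t"

fun fvars :: "'a fm \<Rightarrow> nat set" where
  "fvars (Eq s t) = tvars s \<union> tvars t"
| "fvars (Less s t) = tvars s \<union> tvars t"
| "fvars (Neg \<phi>) = fvars \<phi>"
| "fvars (Conj \<phi> \<psi>) = fvars \<phi> \<union> fvars \<psi>"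
| "fvars (Ex \<phi>) = {i. Suc i \<in> fvars \<phi>}"

fun tsubst :: "(nat \<Rightarrow> 'a trm) \<Rightarrow> 'a trm \<Rightarrow> 'a trm" where
  "tsubst \<sigma> (Var i) = \<sigma> i"
| "tsubst \<sigma> (Par a) = Par a"
| "tsubst \<sigma> (Meet s t) = Meet (tsubst \<sigma> s) (tsubst \<sigma> t)"

fun fsubst :: "(nat \<Rightarrow> 'a trm) \<Rightarrow> 'a fm \<Rightarrow> 'a fm" where
  "fsubst \<sigma> (Eq s t) = Eq (tsubst \<sigma> s) (tsubst \<sigma> t)"
| "fsubst \<sigma> (Less s t) = Less (tsubst \<sigma> s) (tsubst \<sigma> t)"
| "fsubst \<sigma> (Neg \<phi>) = Neg (fsubst \<sigma> \<phi>)"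
| "fsubst \<sigma> (Conj \<phi> \<psi>) = Conj (fsubst \<sigma> \<phi>) (fsubst \<sigma> \<psi>)"
| "fsubst \<sigma> (Ex \<phi>) = Ex (fsubst (case_nat (Var 0) (\<lambda>i. tsubst (\<lambda>j. Var (Suc j)) (\<sigma> i))) \<phi>)"

definition shift :: "nat \<Rightarrow> 'a fm \<Rightarrow> 'a fm" where
  "shift n \<phi> = fsubst (\<lambda>i. Var (n + i)) \<phi>"

definition formulas :: "nat \<Rightarrow> 'a set \<Rightarrow> 'a fm set" where
  "formulas n B = {\<phi>. fvars \<phi> \<subseteq> {..<n} \<and> params \<phi> \<subseteq> B}"

definition types :: "nat \<Rightarrow> 'a::{ord,inf} set \<Rightarrow> 'a fm set set" where
  "types n B = {p. p \<subseteq> formulas n B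
      \<and> (\<forall>F. finite F \<and> F \<subseteq> p \<longrightarrow> (\<exists>e. \<forall>\<phi>\<in>F. sat e \<phi>))
      \<and> (\<forall>\<phi>\<in>formulas n B. \<phi> \<in> p \<or> Neg \<phi> \<in> p)}"

definition restrict_type :: "'a fm set \<Rightarrow> 'a set \<Rightarrow> 'a fm set" where
  "restrict_type p A = {\<phi>\<in>p. params \<phi> \<subseteq> A}"

text \<open>Entailment modulo the elementary diagram of the ambient model.\<close>

definition entails :: "'a::{ord,inf} fm set \<Rightarrow> 'a fm \<Rightarrow> bool" where
  "entails \<Gamma> \<phi> \<longleftrightarrow>
     (\<exists>F. finite F \<and> F \<subseteq> \<Gamma> \<and> (\<forall>e. (\<forall>\<psi>\<in>F. sat e \<psi>) \<longrightarrow> sat e \<phi>))"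

definition small :: "'k rel \<Rightarrow> 'a set \<Rightarrow> bool" where
  "small \<kappa> A \<longleftrightarrow> |A| <o \<kappa>"

definition automorphisms :: "'a::{ord,inf} set \<Rightarrow> ('a \<Rightarrow> 'a) set" where
  "automorphisms A = {\<sigma>. bij \<sigma> \<and> (\<forall>x y. \<sigma> x < \<sigma> y \<longleftrightarrow> x < y)
      \<and> (\<forall>x y. \<sigma> (inf x y) = inf (\<sigma> x) (\<sigma> y)) \<and> (\<forall>a\<in>A. \<sigma> a = a)}"

definition saturated :: "'k rel \<Rightarrow> 'a::{ord,inf} itself \<Rightarrow> bool" where
  "saturated \<kappa> T \<longleftrightarrow>
     (\<forall>A::'a set. small \<kappa> A \<longrightarrow> (\<forall>p\<in>types 1 A. \<exists>a. \<forall>\<phi>\<in>p. sat (\<lambda>_. a) \<phi>))"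

definition partial_elementary :: "'a::{ord,inf} set \<Rightarrow> ('a \<Rightarrow> 'a) \<Rightarrow> bool" where
  "partial_elementary A f \<longleftrightarrow>
     (\<forall>\<phi>\<in>formulas 0 A. \<forall>e. sat e \<phi> \<longleftrightarrow> sat e (map_fm f \<phi>))"

definition strongly_homogeneous :: "'k rel \<Rightarrow> 'a::{ord,inf} itself \<Rightarrow> bool" where
  "strongly_homogeneous \<kappa> T \<longleftrightarrow>
     (\<forall>(A::'a set) f. small \<kappa> A \<and> partial_elementary A f \<longrightarrow>
        (\<exists>\<sigma>\<in>automorphisms {}. \<forall>a\<in>A. \<sigma> a = f a))"

text \<open>``Large'' is read as: bigger than the (countable) language.\<close>

definition monster_model :: "'k rel \<Rightarrow> 'a::{ord,inf} itself \<Rightarrow> bool" where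
  "monster_model \<kappa> T \<longleftrightarrow>
     Card_order \<kappa> \<and> natLeq <o \<kappa> \<and> saturated \<kappa> T \<and> strongly_homogeneous \<kappa> T"

text \<open>A global type in finitely many variables, with its number of variables.\<close>

type_synonym 'a gtype = "nat \<times> 'a fm set"

definition invariant :: "'a::{ord,inf} set \<Rightarrow> 'a fm set \<Rightarrow> bool" where
  "invariant A p \<longleftrightarrow> (\<forall>\<sigma>\<in>automorphisms A. \<forall>\<phi>. \<phi> \<in> p \<longleftrightarrow> map_fm \<sigma> \<phi> \<in> p)"

definition inv_types :: "'k rel \<Rightarrow> 'a::{ord,inf} gtype set" where
  "inv_types \<kappa> = {(n, p). p \<in> types n UNIV \<and> (\<exists>A. small \<kappa> A \<and> invariant A p)}"

definition realised_types :: "'a::{ord,inf} gtype set" where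
  "realised_types = {(n, p). \<exists>e. p = {\<phi>\<in>formulas n UNIV. sat e \<phi>}}"

text \<open>In \<open>\<phi>(x,y) \<in> p \<otimes> q \<longleftrightarrow> \<phi>(x,b) \<in> p | Ub\<close> with \<open>b \<Turnstile> q\<close>, the realisation \<open>b\<close> lives in an
  elementary extension of the monster model \<open>U\<close>. If \<open>p\<close> is \<open>A\<close>-invariant and \<open>A\<close> contains the
  parameters of \<open>\<phi>\<close>, then by definition of \<open>p | Ub\<close> one has \<open>\<phi>(x,b) \<in> p | Ub\<close> iff
  \<open>\<phi>(x,b') \<in> p\<close> for a tuple \<open>b'\<close> of \<open>U\<close> with the same type over \<open>A\<close> as \<open>b\<close>, i.e. realising
  the restriction of \<open>q\<close> to \<open>A\<close>. Neither \<open>A\<close> nor \<open>b'\<close> matters.\<close>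

definition tensor :: "'k rel \<Rightarrow> 'a::{ord,inf} gtype \<Rightarrow> 'a gtype \<Rightarrow> 'a gtype" where
  "tensor \<kappa> = (\<lambda>(n, p) (m, q). (n + m,
     {\<phi>\<in>formulas (n + m) UNIV. \<exists>A b. small \<kappa> A \<and> invariant A p \<and> params \<phi> \<subseteq> A
        \<and> (\<forall>\<psi>\<in>restrict_type q A. sat b \<psi>)
        \<and> fsubst (\<lambda>i. if i < n then Var i else Par (b (i - n))) \<phi> \<in> p}))"

definition dominates :: "'k rel \<Rightarrow> 'a::{ord,inf} gtype \<Rightarrow> 'a gtype \<Rightarrow> bool" where
  "dominates \<kappa> = (\<lambda>(n, p) (m, q). \<exists>A. small \<kappa> A \<and> (\<exists>r\<in>types (n + m) A.
     restrict_type p A \<union> shift n ` restrict_type q A \<subseteq> r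
     \<and> (\<forall>\<phi>\<in>q. entails (p \<union> r) (shift n \<phi>))))"

definition dom_equiv :: "'k rel \<Rightarrow> 'a::{ord,inf} gtype rel" where
  "dom_equiv \<kappa> = {(p, q). p \<in> inv_types \<kappa> \<and> q \<in> inv_types \<kappa>
      \<and> dominates \<kappa> p q \<and> dominates \<kappa> q p}"

definition dom_class :: "'k rel \<Rightarrow> 'a::{ord,inf} gtype \<Rightarrow> 'a gtype set" where
  "dom_class \<kappa> p = dom_equiv \<kappa> `` {p}"

definition dom_monoid :: "'k rel \<Rightarrow> 'a::{ord,inf} gtype set monoid" where
  "dom_monoid \<kappa> = \<lparr>carrier = inv_types \<kappa> // dom_equiv \<kappa>,
     mult = (\<lambda>P Q. \<Union>p\<in>P. \<Union>q\<in>Q. dom_class \<kappa> (tensor \<kappa> p q)),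
     one = realised_types\<rparr>"

definition dom_le :: "'k rel \<Rightarrow> 'a::{ord,inf} gtype set \<Rightarrow> 'a gtype set \<Rightarrow> bool" where
  "dom_le \<kappa> Q P \<longleftrightarrow> (\<exists>p\<in>P. \<exists>q\<in>Q. dominates \<kappa> p q)"

abbreviation x\<^sub>0 :: "'a trm" where
  "x\<^sub>0 \<equiv> Var 0"

text \<open>The set \<open>A\<close> may be empty in kind (Ib), which gives the type of an element below everything.
  In kind (Ia) consistency of \<open>p\<close> forces \<open>A\<close> to be nonempty.\<close>

definition kind_Ia :: "'k rel \<Rightarrow> 'a::dense_meet_tree set \<Rightarrow> 'a fm set \<Rightarrow> bool" where
  "kind_Ia \<kappa> A p \<longleftrightarrow> p \<in> types 1 UNIV \<and> small \<kappa> A \<and> Complete_Partial_Order.chain (\<le>) A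
     \<and> {Less x\<^sub>0 (Par a) | a. a \<in> A} \<union> {Less (Par b) x\<^sub>0 | b. \<forall>a\<in>A. b < a} \<subseteq> p"

definition has_max :: "'a::order set \<Rightarrow> bool" where
  "has_max A \<longleftrightarrow> (\<exists>m\<in>A. \<forall>a\<in>A. a \<le> m)"

definition kind_Ib :: "'k rel \<Rightarrow> 'a::dense_meet_tree fm set \<Rightarrow> bool" where
  "kind_Ib \<kappa> p \<longleftrightarrow> p \<in> types 1 UNIV \<and>
     ((\<exists>A. small \<kappa> A \<and> Complete_Partial_Order.chain (\<le>) A \<and> \<not> has_max A
        \<and> {Less (Par a) x\<^sub>0 | a. a \<in> A} \<union> {Less x\<^sub>0 (Par b) | b. \<forall>a\<in>A. a < b} \<subseteq> p)
      \<or> (\<exists>a c. {Less (Par a) x\<^sub>0, Less x\<^sub>0 (Par c)}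
            \<union> {Less x\<^sub>0 (Par b) | b. a < b \<and> b < c} \<subseteq> p))"

definition kind_II :: "'a::dense_meet_tree \<Rightarrow> 'a fm set \<Rightarrow> bool" where
  "kind_II g p \<longleftrightarrow> p \<in> types 1 UNIV
     \<and> {Less (Par g) x\<^sub>0} \<union> {Eq (Meet x\<^sub>0 (Par b)) (Par g) | b. g < b} \<subseteq> p"

text \<open>The type over the monster model of the meet of \<open>c\<close> with a realisation of \<open>p\<close>.\<close>

definition meet_type :: "'a \<Rightarrow> 'a fm set \<Rightarrow> 'a fm set" where
  "meet_type c p = {\<phi>\<in>formulas 1 UNIV. fsubst (\<lambda>_. Meet x\<^sub>0 (Par c)) \<phi> \<in> p}"

definition kind_IIIa :: "'k rel \<Rightarrow> 'a::dense_meet_tree set \<Rightarrow> 'a fm set \<Rightarrow> bool" where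
  "kind_IIIa \<kappa> A p \<longleftrightarrow> p \<in> types 1 UNIV \<and> {Neg (Le x\<^sub>0 (Par b)) | b. True} \<subseteq> p
     \<and> (\<exists>c. kind_Ia \<kappa> A (meet_type c p))"

definition kind_IIIb :: "'k rel \<Rightarrow> 'a::dense_meet_tree fm set \<Rightarrow> bool" where
  "kind_IIIb \<kappa> p \<longleftrightarrow> p \<in> types 1 UNIV \<and> {Neg (Le x\<^sub>0 (Par b)) | b. True} \<subseteq> p
     \<and> (\<exists>c. kind_Ib \<kappa> (meet_type c p))"

definition type_cut :: "'a fm set \<Rightarrow> 'a set" where
  "type_cut p = {c. Le (Par c) x\<^sub>0 \<in> p}"

definition small_coinitial_chains :: "'k rel \<Rightarrow> 'a::order set set" where
  "small_coinitial_chains \<kappa> = {A. A \<noteq> {} \<and> Complete_Partial_Order.chain (\<le>) A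
      \<and> (\<exists>B\<subseteq>A. small \<kappa> B \<and> (\<forall>a\<in>A. \<exists>b\<in>B. b \<le> a))}"

definition mutually_coinitial :: "'k rel \<Rightarrow> 'a::order set rel" where
  "mutually_coinitial \<kappa> = {(A, B). A \<in> small_coinitial_chains \<kappa> \<and> B \<in> small_coinitial_chains \<kappa>
      \<and> (\<forall>a\<in>A. \<exists>b\<in>B. b \<le> a) \<and> (\<forall>b\<in>B. \<exists>a\<in>A. a \<le> b)}"

definition chain_classes :: "'k rel \<Rightarrow> 'a::order set set set" where
  "chain_classes \<kappa> = small_coinitial_chains \<kappa> // mutually_coinitial \<kappa>"

definition small_cofinal_cuts :: "'k rel \<Rightarrow> 'a::dense_meet_tree set set" where
  "small_cofinal_cuts \<kappa> = {C. (\<exists>p\<in>types 1 UNIV. C = type_cut p) \<and> \<not> has_max C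
      \<and> (\<exists>B\<subseteq>C. small \<kappa> B \<and> (\<forall>c\<in>C. \<exists>b\<in>B. c \<le> b))}"

datatype 'a point = Chain_pt "'a set set" | Cut_pt "'a set" | Cone_pt 'a "'a set"

definition points :: "'k rel \<Rightarrow> 'a::dense_meet_tree point set" where
  "points \<kappa> = Chain_pt ` chain_classes \<kappa> \<union> Cut_pt ` small_cofinal_cuts \<kappa>
     \<union> {Cone_pt g C | g C. C \<in> open_cones g}"

definition Pfin :: "'b set \<Rightarrow> 'b set monoid" where
  "Pfin X = \<lparr>carrier = {F. finite F \<and> F \<subseteq> X}, mult = (\<union>), one = {}\<rparr>"

definition sum_nat :: "('a \<Rightarrow>\<^sub>0 nat) monoid" where
  "sum_nat = \<lparr>carrier = UNIV, mult = (+), one = 0\<rparr>"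

definition target_le :: "'b set \<times> ('a \<Rightarrow>\<^sub>0 nat) \<Rightarrow> 'b set \<times> ('a \<Rightarrow>\<^sub>0 nat) \<Rightarrow> bool" where
  "target_le = (\<lambda>(F, h) (F', h'). F \<subseteq> F' \<and> (\<forall>g. Poly_Mapping.lookup h g \<le> Poly_Mapping.lookup h' g))"

end

theory Submission
  imports Defs
begin

text \<open>In a meet-tree every meet of finitely many elements is a meet of two of them, so the type of a tuple
  is determined by the ternary relation \<open>x \<sqinter> y \<le> z\<close> on the tuple and the parameters, and by back and
  forth, saturation and homogeneity every small partial map preserving this relation extends to an
  automorphism. Each coordinate of an invariant type is either realised, or lies in a new open cone
  above some \<open>g\<close>, or determines, through its meets with the monster model, a cut of a chain that is
  approached from exactly one side by a small set; such cuts are the points of \<open>X\<close>. A global type is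
  mapped to the set of its points together with, for each \<open>g\<close>, the number of new open cones above
  \<open>g\<close> that it meets. If \<open>q\<close> has no more points and new cones than \<open>p\<close>, then \<open>p\<close> dominates \<open>q\<close>: place a
  realisation of \<open>q\<close> deeper into the common cuts and into the new cones of a realisation of \<open>p\<close>.
  Conversely, a point or an excess of new cones of \<open>q\<close> missing from \<open>p\<close> leaves enough freedom for an
  automorphism fixing a realisation of \<open>p\<close> to move a realisation of \<open>q\<close> to a place forbidden by \<open>q\<close>.\<close>

section \<open>Partial isomorphisms of meet-trees\<close>

text \<open>A global type that is not realised in the model, and each new open cone, exists only in
  an extension. No extension is built: every argument uses realisations over small sets together
  with automorphisms of the model. That a cut is small on exactly one side has two sources:
  saturation excludes two small sides, invariance excludes two large ones. Points are idempotent
  while new cones add up, for the following reason. A small type can say of two elements in the same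
  cut that the first separates the second from the large side; a small set bounds the second on the
  other side, so the type of the first determines the cut of the second. In a tensor product, by
  contrast, the new cones of one factor avoid the realisation of the other, and each cone has to be
  matched by a cone of its own. Hence unions in one coordinate and sums in the other. Only the meet
  with an anchor counts, so an element that branches off inside a cut is worth as much as its
  branching point. This is why kinds (I) and (III) share their points.\<close>

lemma tree_linear:
  fixes x y c :: "'a::dense_meet_tree"
  shows "x \<le> c \<Longrightarrow> y \<le> c \<Longrightarrow> x \<le> y \<or> y \<le> x"
  using predecessors_linear[of x c y] by (auto simp: order.order_iff_strict)

lemma tree_not_le:
  fixes x y c :: "'a::dense_meet_tree"
  shows "x \<le> c \<Longrightarrow> y \<le> c \<Longrightarrow> \<not> x \<le> y \<longleftrightarrow> y < x"
  using tree_linear[of x c y] by (auto simp: less_le_not_le)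

lemma inf_le_chain:
  fixes x y c :: "'a::dense_meet_tree"
  assumes "x \<le> c" "y \<le> c"
  shows "inf x y \<le> k \<longleftrightarrow> x \<le> k \<or> y \<le> k"
  using tree_linear[OF assms] by (auto simp: inf_absorb1 inf_absorb2 intro: le_infI1 le_infI2)

text \<open>Meets with \<open>x\<close> all lie in the chain below \<open>x\<close>, so a meet of
  three is the smaller of two binary ones. In this way inequalities between meets reduce to the form
  \<open>inf x y \<le> z\<close>.\<close>

lemma inf3_le:
  fixes x y z u :: "'a::dense_meet_tree"
  shows "inf (inf x y) z \<le> u \<longleftrightarrow> inf x y \<le> u \<or> inf x z \<le> u"
proof -
  have "inf (inf x y) z = inf (inf x y) (inf x z)"
    by (simp add: inf.left_commute inf.commute inf.assoc)
  then show ?thesis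
    using inf_le_chain[of "inf x y" x "inf x z" u] by simp
qed

lemma inf4_le:
  fixes x y z w u :: "'a::dense_meet_tree"
  shows "inf (inf x y) (inf z w) \<le> u \<longleftrightarrow> inf x y \<le> u \<or> inf x z \<le> u \<or> inf x w \<le> u"
proof -
  have "inf (inf x y) (inf z w) = inf (inf x (inf y z)) w"
    by (simp add: inf.assoc)
  then show ?thesis
    using inf3_le[of x "inf y z" w u] inf3_le[of x y z u] by (simp add: inf.assoc)
qed

text \<open>A relation rather than a function, so that repeated entries of tuples need no bookkeeping.\<close>

definition piso :: "('a::semilattice_inf \<times> 'a) set \<Rightarrow> bool" where
  "piso G \<longleftrightarrow> (\<forall>x x' y y' z z'. (x, x') \<in> G \<longrightarrow> (y, y') \<in> G \<longrightarrow> (z, z') \<in> G \<longrightarrow>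
     (inf x y \<le> z \<longleftrightarrow> inf x' y' \<le> z'))"

lemma pisoD:
  "piso G \<Longrightarrow> (x, x') \<in> G \<Longrightarrow> (y, y') \<in> G \<Longrightarrow> (z, z') \<in> G \<Longrightarrow> inf x y \<le> z \<longleftrightarrow> inf x' y' \<le> z'"
  unfolding piso_def by blast

lemma piso_le: "piso G \<Longrightarrow> (x, x') \<in> G \<Longrightarrow> (z, z') \<in> G \<Longrightarrow> x \<le> z \<longleftrightarrow> x' \<le> z'"
  using pisoD[of G x x' x x' z z'] by simp

lemma piso_eq: "piso G \<Longrightarrow> (x, x') \<in> G \<Longrightarrow> (z, z') \<in> G \<Longrightarrow> x = z \<longleftrightarrow> x' = z'"
  using piso_le[of G x x' z z'] piso_le[of G z z' x x'] by (auto simp: order.eq_iff)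

lemma piso_less: "piso G \<Longrightarrow> (x, x') \<in> G \<Longrightarrow> (z, z') \<in> G \<Longrightarrow> x < z \<longleftrightarrow> x' < z'"
  using piso_le[of G x x' z z'] piso_le[of G z z' x x'] by (auto simp: less_le_not_le)

lemma piso_subset: "piso G \<Longrightarrow> H \<subseteq> G \<Longrightarrow> piso H"
  unfolding piso_def by blast

lemma piso_Id_on: "piso (Id_on A)"
  by (auto simp: piso_def)

lemma piso_converse: "piso G \<Longrightarrow> piso (G\<inverse>)"
  by (auto simp: piso_def)

definition inf_closed_rel :: "('a::inf \<times> 'a) set \<Rightarrow> bool" where
  "inf_closed_rel G \<longleftrightarrow> (\<forall>x x' y y'. (x, x') \<in> G \<longrightarrow> (y, y') \<in> G \<longrightarrow> (inf x y, inf x' y') \<in> G)"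

lemma inf_closed_relD:
  "inf_closed_rel G \<Longrightarrow> (x, x') \<in> G \<Longrightarrow> (y, y') \<in> G \<Longrightarrow> (inf x y, inf x' y') \<in> G"
  unfolding inf_closed_rel_def by blast

definition inf_closure :: "('a::inf \<times> 'a) set \<Rightarrow> ('a \<times> 'a) set" where
  "inf_closure G = (\<lambda>(p, q). (inf (fst p) (fst q), inf (snd p) (snd q))) ` (G \<times> G)"

lemma inf_closure_iff:
  "(z, z') \<in> inf_closure G \<longleftrightarrow> (\<exists>x x' y y'. (x, x') \<in> G \<and> (y, y') \<in> G \<and> z = inf x y \<and> z' = inf x' y')"
  by (force simp: inf_closure_def)

lemma inf_closureE:
  assumes "(z, z') \<in> inf_closure G"
  obtains x x' y y' where "(x, x') \<in> G" "(y, y') \<in> G" "z = inf x y" "z' = inf x' y'"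
  using assms unfolding inf_closure_def by auto

lemma inf_closure_superset: "G \<subseteq> inf_closure (G :: ('a::semilattice_inf \<times> 'a) set)"
  by (force simp: inf_closure_iff)

lemma finite_inf_closure: "finite G \<Longrightarrow> finite (inf_closure G)"
  by (simp add: inf_closure_def)

lemma piso_inf_closure:
  fixes G :: "('a::dense_meet_tree \<times> 'a) set"
  assumes "piso G"
  shows "piso (inf_closure G)"
  unfolding piso_def
proof (intro allI impI)
  fix a a' b b' c c'
  assume a: "(a, a') \<in> inf_closure G" and b: "(b, b') \<in> inf_closure G" and c: "(c, c') \<in> inf_closure G"
  obtain x x' y y' where 1: "(x, x') \<in> G" "(y, y') \<in> G" "a = inf x y" "a' = inf x' y'"
    by (rule inf_closureE[OF a])
  obtain z z' w w' where 2: "(z, z') \<in> G" "(w, w') \<in> G" "b = inf z w" "b' = inf z' w'"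
    by (rule inf_closureE[OF b])
  obtain u u' v v' where 3: "(u, u') \<in> G" "(v, v') \<in> G" "c = inf u v" "c' = inf u' v'"
    by (rule inf_closureE[OF c])
  note g = 1(1,2) 2(1,2) 3(1,2) and e = 1(3,4) 2(3,4) 3(3,4)
  show "inf a b \<le> c \<longleftrightarrow> inf a' b' \<le> c'"
    unfolding e le_inf_iff inf4_le
    using pisoD[OF assms g(1,2,5)] pisoD[OF assms g(1,3,5)] pisoD[OF assms g(1,4,5)]
      pisoD[OF assms g(1,2,6)] pisoD[OF assms g(1,3,6)] pisoD[OF assms g(1,4,6)]
    by blast
qed

text \<open>One round of binary meets is enough: the least of the meets of \<open>x\<close> with
  \<open>y\<close>, \<open>z\<close> and \<open>w\<close> is the meet of all four, and the ternary
  relation tells on both sides which one is least.\<close>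

lemma inf_closed_inf_closure:
  fixes G :: "('a::dense_meet_tree \<times> 'a) set"
  assumes G: "piso G"
  shows "inf_closed_rel (inf_closure G)"
  unfolding inf_closed_rel_def
proof (intro allI impI)
  fix a a' b b' assume a: "(a, a') \<in> inf_closure G" and b: "(b, b') \<in> inf_closure G"
  obtain x x' y y' where 1: "(x, x') \<in> G" "(y, y') \<in> G" "a = inf x y" "a' = inf x' y'"
    by (rule inf_closureE[OF a])
  obtain z z' w w' where 2: "(z, z') \<in> G" "(w, w') \<in> G" "b = inf z w" "b' = inf z' w'"
    by (rule inf_closureE[OF b])
  note g = 1(1,2) 2(1,2) and e = 1(3,4) 2(3,4)
  have m: "inf (inf x y) (inf z w) = inf x z" if "inf x z \<le> y" "inf x z \<le> w" for x y z w :: 'a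
  proof -
    have "inf (inf x y) (inf z w) = inf (inf x z) (inf y w)" by (simp add: inf_aci)
    then show ?thesis using that by (simp add: inf_absorb1)
  qed
  have m': "inf (inf x y) (inf z w) = inf x w" if "inf x w \<le> y" "inf x w \<le> z" for x y z w :: 'a
    using m[of x w y z] that by (simp add: inf_aci)
  have "inf x y \<le> inf x z \<or> inf x z \<le> inf x y" "inf x y \<le> inf x w \<or> inf x w \<le> inf x y"
    "inf x z \<le> inf x w \<or> inf x w \<le> inf x z"
    by (rule tree_linear[of _ x]; simp)+
  then consider "inf x y \<le> inf x z" "inf x y \<le> inf x w" | "inf x z \<le> inf x y" "inf x z \<le> inf x w"
    | "inf x w \<le> inf x y" "inf x w \<le> inf x z"
    using order_trans by blast
  then consider "inf x y \<le> z" "inf x y \<le> w" | "inf x z \<le> y" "inf x z \<le> w" | "inf x w \<le> y" "inf x w \<le> z"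
    by cases simp_all
  then show "(inf a b, inf a' b') \<in> inf_closure G"
  proof cases
    case 1
    then have "inf x' y' \<le> z'" "inf x' y' \<le> w'" using pisoD[OF G] g by blast+
    with 1 have "inf a b = inf x y" "inf a' b' = inf x' y'" using e by (auto intro: inf_absorb1)
    then show ?thesis using g by (auto simp: inf_closure_iff)
  next
    case 2
    then have "inf x' z' \<le> y'" "inf x' z' \<le> w'" using pisoD[OF G] g by blast+
    with 2 have "inf a b = inf x z" "inf a' b' = inf x' z'" using e m by auto
    then show ?thesis using g by (auto simp: inf_closure_iff)
  next
    case 3
    then have "inf x' w' \<le> y'" "inf x' w' \<le> z'" using pisoD[OF G] g by blast+
    with 3 have "inf a b = inf x w" "inf a' b' = inf x' w'" using e m' by auto
    then show ?thesis using g by (auto simp: inf_closure_iff)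
  qed
qed

text \<open>An element \<open>c\<close> with \<open>b \<sqinter> d \<le> c\<close> for all \<open>d\<close> acts as an anchor of \<open>b\<close>: the branch of \<open>b\<close> leaves
  the domain of \<open>G\<close> at \<open>b \<sqinter> c\<close>, so only the cut of \<open>b \<sqinter> c\<close> in the chain below \<open>c\<close> matters.\<close>

lemma piso_Un:
  fixes G :: "('a::dense_meet_tree \<times> 'a) set"
  assumes G: "piso G" and cl: "inf_closed_rel G" and sub: "G0 \<subseteq> G" and H: "piso (G0 \<union> H)"
    and anch: "\<And>b b'. (b, b') \<in> H \<Longrightarrow> \<exists>c c'. (c, c') \<in> G0 \<and>
       (\<forall>d d'. (d, d') \<in> G \<longrightarrow> inf b d \<le> c \<and> inf b' d' \<le> c') \<and>
       (\<forall>d d'. (d, d') \<in> G \<longrightarrow> d \<le> c \<longrightarrow> (d \<le> b \<longleftrightarrow> d' \<le> b') \<and> (inf b c \<le> d \<longleftrightarrow> inf b' c' \<le> d'))"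
  shows "piso (G \<union> H)"
proof -
  have two: "f \<le> b \<longleftrightarrow> f' \<le> b'" if "(f, f') \<in> G" "(b, b') \<in> H" for f f' b b'
  proof -
    note th = that
    obtain c c' where c: "(c, c') \<in> G0" "inf b f \<le> c" "inf b' f' \<le> c'"
      "f \<le> c \<Longrightarrow> f \<le> b \<longleftrightarrow> f' \<le> b'" using anch[OF th(2)] th(1) by blast
    have "f \<le> c \<longleftrightarrow> f' \<le> c'" using piso_le[OF G th(1), of c c'] c(1) sub by blast
    then show ?thesis using c by (metis inf.absorb2)
  qed
  have three: "inf d b \<le> e \<longleftrightarrow> inf d' b' \<le> e'"
    if "(d, d') \<in> G" "(b, b') \<in> H" "(e, e') \<in> G" for d d' b b' e e'
  proof -
    note th = that
    obtain c c' where c: "(c, c') \<in> G0" "inf b d \<le> c" "inf b' d' \<le> c'"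
      and cut: "\<And>k k'. (k, k') \<in> G \<Longrightarrow> k \<le> c \<Longrightarrow> inf b c \<le> k \<longleftrightarrow> inf b' c' \<le> k'"
      using anch[OF th(2)] th(1) by blast
    have cG: "(c, c') \<in> G" using c sub by blast
    have f: "(inf d c, inf d' c') \<in> G" and k: "(inf e c, inf e' c') \<in> G"
      using cl cG th by (auto intro: inf_closed_relD)
    \<comment> \<open>As \<open>inf b d\<close> is below \<open>c\<close>, it is the smaller of
      \<open>inf d c\<close> and \<open>inf b c\<close>. The comparison with \<open>e\<close> takes
      place in the chain below \<open>c\<close>, where \<open>inf e c\<close> stands for
      \<open>e\<close>.\<close>
    have *: "inf d b \<le> e \<longleftrightarrow> inf d c \<le> inf e c \<or> inf b c \<le> inf e c" if "inf b d \<le> c" for d b e c :: 'a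
    proof -
      have "inf d b = inf (inf d c) (inf b c)"
        using that by (metis inf.absorb1 inf.assoc inf.commute inf.left_idem)
      moreover have "inf d b \<le> e \<longleftrightarrow> inf d b \<le> inf e c" using that by (simp add: inf.commute)
      ultimately show ?thesis using inf_le_chain[of "inf d c" c "inf b c"] by simp
    qed
    show ?thesis
      unfolding *[OF c(2)] *[OF c(3)]
      using piso_le[OF G f k] cut[OF k] by simp
  qed
  have four: "inf d b \<le> v \<longleftrightarrow> inf d' b' \<le> v'"
    if "(d, d') \<in> G" "(b, b') \<in> H" "(v, v') \<in> H" for d d' b b' v v'
  proof -
    note th = that
    obtain c c' where c: "(c, c') \<in> G0" "inf b d \<le> c" "inf b' d' \<le> c'"
      using anch[OF th(2)] th(1) by blast
    have cG: "(c, c') \<in> G" using c sub by blast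
    have f: "(inf d c, inf d' c') \<in> G" using cl cG that by (auto intro: inf_closed_relD)
    have *: "inf d b \<le> v \<longleftrightarrow> inf d c \<le> v \<or> inf b c \<le> v" if "inf b d \<le> c" for d b v c :: 'a
    proof -
      have "inf d b = inf (inf d c) (inf b c)"
        using that by (metis inf.absorb1 inf.assoc inf.commute inf.left_idem)
      then show ?thesis using inf_le_chain[of "inf d c" c "inf b c"] by simp
    qed
    show ?thesis
      unfolding *[OF c(2)] *[OF c(3)]
      using two[OF f th(3)] pisoD[OF H, of b b' c c' v v'] c(1) th by blast
  qed
  have five: "inf b v \<le> d \<longleftrightarrow> inf b' v' \<le> d'"
    if "(d, d') \<in> G" "(b, b') \<in> H" "(v, v') \<in> H" for d d' b b' v v'
  proof -
    note th = that
    obtain c c' where c: "(c, c') \<in> G0" "inf b d \<le> c" "inf b' d' \<le> c'"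
      using anch[OF th(2)] th(1) by blast
    have cG: "(c, c') \<in> G" using c sub by blast
    \<comment> \<open>If \<open>inf b v\<close> is below \<open>d\<close>, it is below
      \<open>inf b d\<close> and hence below \<open>c\<close>; it then equals the meet of
      \<open>c\<close>, \<open>b\<close> and \<open>v\<close>.\<close>
    have *: "inf b v \<le> d \<longleftrightarrow> inf b v \<le> c \<and> (inf c b \<le> d \<or> inf c v \<le> d)" if "inf b d \<le> c"
      for d b v c :: 'a
    proof (cases "inf b v \<le> c")
      case True
      then have "inf b v = inf (inf c b) v" by (metis inf.absorb2 inf.assoc)
      then show ?thesis using True inf3_le[of c b v d] by simp
    next
      case False
      then show ?thesis using that by (metis inf.absorb1 inf.coboundedI1 inf.cobounded1 le_inf_iff order_trans)
    qed
    show ?thesis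
      unfolding *[OF c(2)] *[OF c(3)]
      using three[OF cG th(2,1)] three[OF cG th(3,1)] pisoD[OF H, of b b' v v' c c'] c(1) th
      by blast
  qed
  show ?thesis
    unfolding piso_def
  proof (intro allI impI)
    fix x x' y y' z z' assume as: "(x, x') \<in> G \<union> H" "(y, y') \<in> G \<union> H" "(z, z') \<in> G \<union> H"
    consider "(x, x') \<in> G" "(y, y') \<in> G" | "(x, x') \<in> G" "(y, y') \<in> H"
      | "(x, x') \<in> H" "(y, y') \<in> G" | "(x, x') \<in> H" "(y, y') \<in> H" using as by blast
    then show "inf x y \<le> z \<longleftrightarrow> inf x' y' \<le> z'"
    proof cases
      case 1
      then show ?thesis
        using as(3) pisoD[OF G 1, of z z'] two[OF inf_closed_relD[OF cl 1], of z z'] by blast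
    next
      case 2
      then show ?thesis using as(3) three[OF 2] four[OF 2] by blast
    next
      case 3
      then show ?thesis using as(3) three[OF 3(2,1), of z z'] four[OF 3(2,1), of z z'] by (auto simp: inf.commute)
    next
      case 4
      then show ?thesis
        using as(3) five[OF _ 4, of z z'] pisoD[OF H, of x x' y y' z z'] by blast
    qed
  qed
qed

text \<open>The case of a single new pair with anchor \<open>(c, c')\<close>. The last hypothesis
  tells an element on the chain below \<open>c\<close> from one that branches off it.\<close>

lemma piso_insert:
  fixes G :: "('a::dense_meet_tree \<times> 'a) set"
  assumes G: "piso G" "inf_closed_rel G" and c: "(c, c') \<in> G"
    and anch: "\<And>d d'. (d, d') \<in> G \<Longrightarrow> inf u d \<le> c \<and> inf u' d' \<le> c'"
    and cut: "\<And>d d'. (d, d') \<in> G \<Longrightarrow> d \<le> c \<Longrightarrow> (d \<le> u \<longleftrightarrow> d' \<le> u') \<and> (inf u c \<le> d \<longleftrightarrow> inf u' c' \<le> d')"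
    and "u \<le> c \<longleftrightarrow> u' \<le> c'"
  shows "piso (insert (u, u') G)"
proof -
  have "c \<le> u \<longleftrightarrow> c' \<le> u'" using cut[OF c] by simp
  then have "piso ({(c, c')} \<union> {(u, u')})"
    using assms(6) by (auto simp: piso_def inf.coboundedI1 inf.coboundedI2)
  moreover have "{(c, c')} \<subseteq> G" using c by simp
  ultimately show ?thesis
    using piso_Un[OF G(1,2), of "{(c, c')}" "{(u, u')}"] anch cut
    by (auto simp del: le_inf_iff)
qed

section \<open>Back and forth, and quantifier elimination\<close>

text \<open>Both \<open>g\<close> and \<open>inf u x\<close> lie below \<open>u\<close>, so they are
  comparable. For \<open>g < u\<close>, the inequality \<open>inf u x \<le> g\<close> thus says that
  \<open>x\<close> is outside the open cone of \<open>u\<close> above \<open>g\<close>; new cones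
  are expressed in this form throughout.\<close>

lemma new_above:
  fixes g u x :: "'a::dense_meet_tree"
  shows "g \<le> u \<Longrightarrow> \<not> g < inf u x \<longleftrightarrow> inf u x \<le> g"
  using tree_not_le[of "inf u x" u g] by auto

lemma equiv_cones:
  fixes g :: "'a::dense_meet_tree"
  shows "equiv {x. g < x} {(x, y). g < x \<and> g < y \<and> g < inf x y}"
proof (rule equivI)
  show "trans {(x, y). g < x \<and> g < y \<and> g < inf x y}"
  proof (rule transI, clarify)
    fix x y z assume as: "g < inf x y" "g < inf y z" "g < x" "g < y" "g < z"
    have "\<not> inf (inf y x) z \<le> g"
      unfolding inf3_le using as(1,2) by (auto simp: inf.commute less_le_not_le)
    then have "\<not> inf x z \<le> g" by (metis inf.assoc le_infI2)
    then show "g < inf x z" using new_above[of g x z] as by auto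
  qed
qed (auto simp: refl_on_def sym_on_def inf.commute)

text \<open>Each element of \<open>X\<close> lies in at most one of the infinitely many open cones
  above \<open>g\<close>.\<close>

lemma new_cone_finite:
  fixes g :: "'a::dense_meet_tree"
  assumes "finite X"
  shows "\<exists>u>g. \<forall>x\<in>X. inf u x \<le> g"
proof -
  let ?R = "{(x, y). g < x \<and> g < y \<and> g < inf x y}"
  have "\<not> open_cones g \<subseteq> (\<lambda>x. ?R `` {x}) ` X"
    using infinite_open_cones[of g] assms finite_subset by blast
  then obtain C where C: "C \<in> open_cones g" "C \<notin> (\<lambda>x. ?R `` {x}) ` X" by blast
  then obtain u where u: "g < u" "C = ?R `` {u}"
    unfolding open_cones_def by (auto elim!: quotientE)
  have "inf u x \<le> g" if "x \<in> X" for x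
  proof (rule ccontr)
    assume "\<not> inf u x \<le> g"
    then have "g < inf u x" using new_above[of g u x] u by auto
    then have "(u, x) \<in> ?R" using u(1) by (auto simp: less_le_trans)
    then have "C = ?R `` {x}" using equiv_class_eq[OF equiv_cones] u(2) by blast
    then show False using C(2) that by blast
  qed
  then show ?thesis using u(1) by blast
qed

text \<open>Density applies between the maximum of \<open>L\<close> and the minimum of
  \<open>M\<close>; if \<open>L\<close> is empty, the absence of a bottom provides the
  point.\<close>

lemma dense_finite:
  fixes c :: "'a::dense_meet_tree"
  assumes "finite L" "finite M" "M \<noteq> {}" "\<And>l m. l \<in> L \<Longrightarrow> m \<in> M \<Longrightarrow> l < m"
    and below: "\<And>l. l \<in> L \<Longrightarrow> l \<le> c" "\<And>m. m \<in> M \<Longrightarrow> m \<le> c"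
  shows "\<exists>z. (\<forall>l\<in>L. l < z) \<and> (\<forall>m\<in>M. z < m)"
proof -
  obtain m where "m \<in> M" "\<forall>x\<in>M. x \<le> m \<longrightarrow> m = x"
    using finite_has_minimal[OF assms(2,3)] by blast
  then have m: "m \<in> M" "\<forall>x\<in>M. m \<le> x"
    using tree_linear[OF below(2) below(2)] by blast+
  have "\<exists>z<m. \<forall>l\<in>L. l < z"
  proof (cases "L = {}")
    case True
    then show ?thesis using lt_ex[of m] by auto
  next
    case False
    then obtain l where l: "l \<in> L" "\<forall>x\<in>L. l \<le> x \<longrightarrow> l = x"
      using finite_has_maximal[OF assms(1)] by blast
    then have "\<forall>x\<in>L. x \<le> l" using tree_linear[OF below(1) below(1)] by blast
    with l(1) show ?thesis using dense[of l m] assms(4) m(1) by (meson le_less_trans)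
  qed
  then show ?thesis using m by (meson less_le_trans)
qed

text \<open>With \<open>c\<close> in the meet-closed domain such that \<open>inf u c\<close> is
  largest, \<open>inf u c\<close> is the point where \<open>u\<close> leaves the domain, and
  \<open>c\<close> serves as an anchor in \<open>piso_insert\<close>.\<close>

lemma piso_forth:
  fixes G :: "('a::dense_meet_tree \<times> 'a) set"
  assumes "finite G" "piso G"
  shows "\<exists>v. piso (insert (u, v) G)"
proof (cases "G = {}")
  case True
  then show ?thesis by (auto simp: piso_def)
next
  case False
  define K where "K = inf_closure G"
  have K: "finite K" "piso K" "inf_closed_rel K" "G \<subseteq> K"
    unfolding K_def by (simp_all add: assms finite_inf_closure piso_inf_closure inf_closed_inf_closure
        inf_closure_superset)
  have linu: "inf u x \<le> inf u y \<or> inf u y \<le> inf u x" for x y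
    by (rule tree_linear[of _ u]) simp_all
  have "\<exists>c\<in>X. \<forall>d\<in>X. inf u d \<le> inf u c" if "finite X" "X \<noteq> {}" for X :: "'a set"
  proof -
    note th = that
    obtain c where c: "c \<in> X" "\<forall>z\<in>inf u ` X. inf u c \<le> z \<longrightarrow> inf u c = z"
      using finite_has_maximal[of "inf u ` X"] th by blast
    have "inf u d \<le> inf u c" if "d \<in> X" for d
      using linu[of c d]
    proof
      assume "inf u c \<le> inf u d"
      then have "inf u c = inf u d" by (rule c(2)[rule_format, OF imageI[OF that]])
      then show ?thesis by simp
    qed
    then show ?thesis using c(1) by blast
  qed
  from this[of "Domain K"] obtain c c' where c: "(c, c') \<in> K" and "\<forall>d\<in>Domain K. inf u d \<le> inf u c"
    using K(1,4) False by (auto simp: finite_Domain Domain_empty_iff simp del: le_inf_iff)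
  then have anch: "inf u d \<le> inf u c" if "(d, d') \<in> K" for d d' using that by blast
  have "\<exists>v. piso (insert (u, v) K)"
  \<comment> \<open>The branch of \<open>u\<close> leaves either at a point of the domain, and a new
    open cone above its image is used, or in a gap of the chain below \<open>c\<close>, whose image
    is filled by density.\<close>
  proof (cases "inf u c \<in> Domain K")
    case True
    then obtain z z' where z: "(z, z') \<in> K" "z = inf u c" by auto
    have az: "inf u d \<le> z" if "(d, d') \<in> K" for d d' using anch[OF that] z by simp
    show ?thesis
    proof (cases "u = z")
      case True
      then show ?thesis using z(1) K(2) insert_absorb[of "(u, z')" K] by (intro exI[of _ z']) simp
    next
      case False
      then have "z < u" using z(2) by (simp add: order.not_eq_order_implies_strict)
      obtain v where v: "z' < v" "\<forall>x\<in>Range K. inf v x \<le> z'"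
        using new_cone_finite[of "Range K" z'] K(1) finite_Range by blast
      have "piso (insert (u, v) K)"
      proof (rule piso_insert[OF K(2,3) z(1)])
        fix d d' assume d: "(d, d') \<in> K"
        show "inf u d \<le> z \<and> inf v d' \<le> z'" using az[OF d] v d by blast
        show "(d \<le> u) = (d' \<le> v) \<and> (inf u z \<le> d) = (inf v z' \<le> d')" if "d \<le> z"
          using that piso_le[OF K(2) d z(1)] piso_le[OF K(2) z(1) d] \<open>z < u\<close> v(1)
          by (auto simp: inf_absorb2 less_imp_le)
      qed (use \<open>z < u\<close> v in auto)
      then show ?thesis ..
    qed
  next
    case False
    let ?z = "inf u c"
    define L where "L = {d'. \<exists>d. (d, d') \<in> K \<and> d < ?z}"
    define M where "M = {d'. \<exists>d. (d, d') \<in> K \<and> d \<le> c \<and> ?z < d}"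
    have zc: "?z < c" using False c by (metis Domain.intros inf.cobounded2 order.not_eq_order_implies_strict)
    have "finite L" "finite M"
      using finite_subset[of L "Range K"] finite_subset[of M "Range K"] K(1)
      by (auto simp: L_def M_def finite_Range)
    moreover have "c' \<in> M" using c zc by (auto simp: M_def)
    moreover have "l < m" if "l \<in> L" "m \<in> M" for l m
      using that piso_less[OF K(2)] by (force simp: L_def M_def)
    moreover have "l \<le> c'" if "l \<in> L" for l
      using that piso_le[OF K(2) _ c] zc by (force simp: L_def)
    moreover have "m \<le> c'" if "m \<in> M" for m
      using that piso_le[OF K(2) _ c] by (force simp: M_def)
    ultimately obtain z' where z': "\<forall>l\<in>L. l < z'" "\<forall>m\<in>M. z' < m"
      using dense_finite[of L M c'] by blast
    have z'c: "z' < c'" using z' \<open>c' \<in> M\<close> by blast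
    have split: "d < ?z \<and> d' < z' \<or> ?z < d \<and> z' < d'" if "(d, d') \<in> K" "d \<le> c" for d d'
    proof -
      have "d \<noteq> ?z" using that False by blast
      then have "d < ?z \<or> ?z < d" using tree_linear[OF that(2), of ?z] zc by (simp add: order.order_iff_strict)
      then show ?thesis using that z' by (auto simp: L_def M_def)
    qed
    \<comment> \<open>\<open>z'\<close> is the image of the branching point. If \<open>u\<close>
      lies strictly above that point, \<open>v\<close> is put into a new cone above
      \<open>z'\<close>, which leaves the meet with \<open>c'\<close> unchanged.\<close>
    obtain v where v: "inf v c' = z'" "z' \<le> v" "u \<le> c \<longleftrightarrow> v \<le> c'" "\<forall>x\<in>Range K. inf v x \<le> z'"
    proof (cases "u \<le> c")
      case True
      have "inf z' d' \<le> z'" for d' by simp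
      then show ?thesis using that[of z'] z'c True by (auto simp: inf_absorb1)
    next
      case False
      obtain v where v: "z' < v" "\<forall>x\<in>Range K. inf v x \<le> z'"
        using new_cone_finite[of "Range K" z'] K(1) finite_Range by blast
      have "inf v c' = z'" using v c z'c by (intro order.antisym) (auto simp: less_imp_le)
      moreover from this v(1) have "\<not> v \<le> c'" by (auto simp: inf_absorb1)
      ultimately show ?thesis using that[of v] v False by auto
    qed
    have "piso (insert (u, v) K)"
    proof (rule piso_insert[OF K(2,3) c])
      fix d d' assume d: "(d, d') \<in> K"
      show "inf u d \<le> c \<and> inf v d' \<le> c'"
        using anch[OF d] v(4) d z'c by (auto intro: order_trans less_imp_le)
      assume dc: "d \<le> c"
      then have d'c': "d' \<le> c'" using piso_le[OF K(2) d c] by simp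
      have "d \<le> u \<longleftrightarrow> d \<le> ?z" "d' \<le> v \<longleftrightarrow> d' \<le> z'"
        using dc d'c' v(1) by (auto simp: v(1)[symmetric])
      then show "(d \<le> u) = (d' \<le> v) \<and> (?z \<le> d) = (inf v c' \<le> d')"
        using split[OF d dc] v(1) by (auto simp: less_le_not_le)
    qed (rule v(3))
    then show ?thesis ..
  qed
  then show ?thesis using K(4) piso_subset by (meson insert_mono)
qed


section \<open>Preservation of formulas under partial isomorphisms\<close>

lemma tval_piso:
  fixes e e' :: "nat \<Rightarrow> 'a::dense_meet_tree"
  assumes "piso G" "inf_closed_rel G" "\<forall>i\<in>tvars t. (e i, e' i) \<in> G" "\<forall>a\<in>tparams t. (a, f a) \<in> G"
  shows "(tval e t, tval e' (map_trm f t)) \<in> G"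
  using assms(3,4)
  by (induction t) (auto intro: inf_closed_relD[OF assms(2)])

text \<open>The quantifier step extends the relation by \<open>piso_forth\<close>, or its converse
  for the other direction; this is where finiteness enters. Variables and parameters are moved
  together, so the lemma serves both for elementary maps and for tuples of equal type.\<close>

lemma sat_piso_finite:
  fixes e e' :: "nat \<Rightarrow> 'a::dense_meet_tree"
  assumes "finite G" "piso G" "\<forall>i\<in>fvars \<phi>. (e i, e' i) \<in> G" "\<forall>a\<in>params \<phi>. (a, f a) \<in> G"
  shows "sat e \<phi> \<longleftrightarrow> sat e' (map_fm f \<phi>)"
  using assms
proof (induction \<phi> arbitrary: e e' G)
  case (Eq s t)
  have "(tval e u, tval e' (map_trm f u)) \<in> inf_closure G" if "u = s \<or> u = t" for u
    using that Eq.prems inf_closure_superset[of G]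
    by (intro tval_piso piso_inf_closure inf_closed_inf_closure) auto
  then show ?case using piso_eq[OF piso_inf_closure[OF Eq.prems(2)]] by simp
next
  case (Less s t)
  have "(tval e u, tval e' (map_trm f u)) \<in> inf_closure G" if "u = s \<or> u = t" for u
    using that Less.prems inf_closure_superset[of G]
    by (intro tval_piso piso_inf_closure inf_closed_inf_closure) auto
  then show ?case using piso_less[OF piso_inf_closure[OF Less.prems(2)]] by simp
next
  case (Neg \<phi>)
  then show ?case by simp
next
  case (Conj \<phi> \<psi>)
  then show ?case by simp blast
next
  case (Ex \<phi>)
  have *: "sat (case_nat a e) \<phi> \<longleftrightarrow> sat (case_nat a' e') (map_fm f \<phi>)"
    if "piso (insert (a, a') G)" for a a'
    by (rule Ex.IH[OF _ that]) (use Ex.prems in \<open>auto split: nat.splits\<close>)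
  show ?case
  proof
    assume "sat e (Ex \<phi>)"
    then obtain a where "sat (case_nat a e) \<phi>" by auto
    moreover obtain a' where "piso (insert (a, a') G)" using piso_forth[OF Ex.prems(1,2)] by blast
    ultimately show "sat e' (map_fm f (Ex \<phi>))" using * by auto
  next
    assume "sat e' (map_fm f (Ex \<phi>))"
    then obtain a' where a': "sat (case_nat a' e') (map_fm f \<phi>)" by auto
    have "finite (G\<inverse>)" "piso (G\<inverse>)" using Ex.prems piso_converse by auto
    then obtain a where "piso (insert (a', a) (G\<inverse>))" using piso_forth by blast
    then have "piso ((insert (a', a) (G\<inverse>))\<inverse>)" by (rule piso_converse)
    then have "piso (insert (a, a') G)" by (rule piso_subset) auto
    then show "sat e (Ex \<phi>)" using * a' by auto
  qed
qed

lemma finite_params: "finite (params \<phi>)" "finite (fvars \<phi>)"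
proof -
  have t: "finite (tparams t)" "finite (tvars t)" for t :: "'a trm" by (induction t) auto
  show "finite (params \<phi>)" by (induction \<phi>) (auto simp: t)
  have "finite {i. Suc i \<in> A}" if "finite A" for A
    using that finite_vimageI[of A Suc] by (simp add: vimage_def)
  then show "finite (fvars \<phi>)" by (induction \<phi>) (auto simp: t)
qed

text \<open>A formula sees only the finitely many values of its free variables and its parameters,
  so the relation may be cut down to these.\<close>

lemma sat_piso:
  fixes e e' :: "nat \<Rightarrow> 'a::dense_meet_tree"
  assumes "piso G" "\<forall>i\<in>fvars \<phi>. (e i, e' i) \<in> G" "\<forall>a\<in>params \<phi>. (a, f a) \<in> G"
  shows "sat e \<phi> \<longleftrightarrow> sat e' (map_fm f \<phi>)"
proof (rule sat_piso_finite)
  let ?K = "(\<lambda>i. (e i, e' i)) ` fvars \<phi> \<union> (\<lambda>a. (a, f a)) ` params \<phi>"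
  show "finite ?K" by (simp add: finite_params)
  show "piso ?K" using assms by (intro piso_subset[OF assms(1)]) auto
qed auto

section \<open>Substitution and renaming of parameters\<close>

lemma tval_cong: "(\<And>i. i \<in> tvars t \<Longrightarrow> e i = e' i) \<Longrightarrow> tval e t = tval e' t"
  by (induction t) auto

lemma sat_cong: "(\<And>i. i \<in> fvars \<phi> \<Longrightarrow> e i = e' i) \<Longrightarrow> sat e \<phi> \<longleftrightarrow> sat e' \<phi>"
proof (induction \<phi> arbitrary: e e')
  case (Eq s t)
  then show ?case using tval_cong[of s e e'] tval_cong[of t e e'] by simp
next
  case (Less s t)
  then show ?case using tval_cong[of s e e'] tval_cong[of t e e'] by simp
next
  case (Neg \<phi>)
  have "sat e \<phi> \<longleftrightarrow> sat e' \<phi>" by (rule Neg.IH) (use Neg.prems in auto)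
  then show ?case by simp
next
  case (Conj \<phi> \<psi>)
  have "sat e \<phi> \<longleftrightarrow> sat e' \<phi>" by (rule Conj.IH) (use Conj.prems in auto)
  moreover have "sat e \<psi> \<longleftrightarrow> sat e' \<psi>" by (rule Conj.IH) (use Conj.prems in auto)
  ultimately show ?case by simp
next
  case (Ex \<phi>)
  have "sat (case_nat a e) \<phi> \<longleftrightarrow> sat (case_nat a e') \<phi>" for a
    by (rule Ex.IH) (use Ex.prems in \<open>auto split: nat.splits\<close>)
  then show ?case by simp
qed

lemma tval_tsubst: "tval e (tsubst \<sigma> t) = tval (\<lambda>i. tval e (\<sigma> i)) t"
  by (induction t) auto

lemma sat_fsubst: "sat e (fsubst \<sigma> \<phi>) \<longleftrightarrow> sat (\<lambda>i. tval e (\<sigma> i)) \<phi>"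
proof (induction \<phi> arbitrary: e \<sigma>)
  case (Ex \<phi>)
  have "(\<lambda>i. tval (case_nat a e) (case_nat (Var 0) (\<lambda>i. tsubst (\<lambda>j. Var (Suc j)) (\<sigma> i)) i))
      = case_nat a (\<lambda>i. tval e (\<sigma> i))" for a
    by (auto simp: tval_tsubst split: nat.splits)
  then show ?case by (simp add: Ex.IH)
qed (simp_all add: tval_tsubst)

lemma tvars_tsubst: "tvars (tsubst \<sigma> t) = (\<Union>i\<in>tvars t. tvars (\<sigma> i))"
  by (induction t) auto

lemma fvars_fsubst: "fvars (fsubst \<sigma> \<phi>) = (\<Union>i\<in>fvars \<phi>. tvars (\<sigma> i))"
proof (induction \<phi> arbitrary: \<sigma>)
  case (Ex \<phi>)
  have "Suc x \<in> tvars (case i of 0 \<Rightarrow> Var 0 | Suc i \<Rightarrow> tsubst (\<lambda>j. Var (Suc j)) (\<sigma> i))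
      \<longleftrightarrow> (\<exists>j. i = Suc j \<and> x \<in> tvars (\<sigma> j))" for x i
    by (cases i) (auto simp: tvars_tsubst)
  then show ?case by (auto simp: Ex.IH)
qed (auto simp: tvars_tsubst)

lemma tparams_tsubst: "tparams (tsubst \<sigma> t) \<subseteq> tparams t \<union> (\<Union>i\<in>tvars t. tparams (\<sigma> i))"
  by (induction t) auto

lemma tparams_rename [simp]: "tparams (tsubst (\<lambda>j. Var (Suc j)) t) = tparams t"
  by (induction t) auto

lemma params_fsubst: "params (fsubst \<sigma> \<phi>) \<subseteq> params \<phi> \<union> (\<Union>i\<in>fvars \<phi>. tparams (\<sigma> i))"
proof (induction \<phi> arbitrary: \<sigma>)
  case (Eq s t)
  then show ?case using tparams_tsubst[of \<sigma> s] tparams_tsubst[of \<sigma> t] by auto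
next
  case (Less s t)
  then show ?case using tparams_tsubst[of \<sigma> s] tparams_tsubst[of \<sigma> t] by auto
next
  case (Conj \<phi> \<psi>)
  then show ?case by (simp; blast)
next
  case (Ex \<phi>)
  let ?s = "case_nat (Var 0) (\<lambda>i. tsubst (\<lambda>j. Var (Suc j)) (\<sigma> i))"
  have "(\<Union>i\<in>fvars \<phi>. tparams (?s i)) \<subseteq> (\<Union>i\<in>fvars (Ex \<phi>). tparams (\<sigma> i))"
    by (auto split: nat.splits)
  then have "params (fsubst ?s \<phi>) \<subseteq> params \<phi> \<union> (\<Union>i\<in>fvars (Ex \<phi>). tparams (\<sigma> i))"
    by (rule order_trans[OF Ex.IH[of ?s] Un_mono[OF order_refl]])
  then show ?case by simp
qed simp

lemma tvars_map [simp]: "tvars (map_trm f t) = tvars t"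
  by (induction t) auto

lemma fvars_map [simp]: "fvars (map_fm f \<phi>) = fvars \<phi>"
  by (induction \<phi>) auto

lemma map_fm_formulas: "\<phi> \<in> formulas n B \<Longrightarrow> map_fm f \<phi> \<in> formulas n (f ` B)"
  by (auto simp: formulas_def fm.set_map)

lemma map_fm_id_on: "(\<And>a. a \<in> params \<phi> \<Longrightarrow> f a = a) \<Longrightarrow> map_fm f \<phi> = \<phi>"
  using fm.map_cong0[of \<phi> f id] by (simp add: fm.map_id)

lemma formulas_mono: "n \<le> m \<Longrightarrow> B \<subseteq> C \<Longrightarrow> formulas n B \<subseteq> formulas m C"
  by (auto simp: formulas_def)

lemma shift_formulas: "\<phi> \<in> formulas m B \<Longrightarrow> shift n \<phi> \<in> formulas (n + m) B"
  using params_fsubst[of "\<lambda>i. Var (n + i)" \<phi>]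
  by (auto simp: formulas_def shift_def fvars_fsubst)

lemma sat_shift: "sat e (shift n \<phi>) \<longleftrightarrow> sat (\<lambda>i. e (n + i)) \<phi>"
  by (simp add: shift_def sat_fsubst)

lemma sat_Le [simp]: "sat e (Le s t) \<longleftrightarrow> tval e s \<le> tval (e :: nat \<Rightarrow> 'a::{order,inf}) t"
  by (auto simp: Le_def order.order_iff_strict)

lemma fvars_Le [simp]: "fvars (Le s t) = tvars s \<union> tvars t"
  by (auto simp: Le_def)

lemma params_Le [simp]: "params (Le s t) = tparams s \<union> tparams t"
  by (auto simp: Le_def)

lemma map_fm_Le [simp]: "map_fm f (Le s t) = Le (map_trm f s) (map_trm f t)"
  by (simp add: Le_def)

section \<open>Automorphisms\<close>

lemma automorphismsD:
  assumes "\<sigma> \<in> automorphisms A"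
  shows "bij \<sigma>" "\<sigma> x < \<sigma> y \<longleftrightarrow> x < y" "\<sigma> (inf x y) = inf (\<sigma> x) (\<sigma> y)" "a \<in> A \<Longrightarrow> \<sigma> a = a"
  using assms by (auto simp: automorphisms_def)

lemma automorphisms_mono: "\<sigma> \<in> automorphisms A \<Longrightarrow> B \<subseteq> A \<Longrightarrow> \<sigma> \<in> automorphisms B"
  by (auto simp: automorphisms_def)

lemma automorphism_eq: "\<sigma> \<in> automorphisms A \<Longrightarrow> \<sigma> x = \<sigma> y \<longleftrightarrow> x = y"
  by (rule inj_eq[OF bij_is_inj[OF automorphismsD(1)]])

lemma automorphism_le:
  fixes \<sigma> :: "'a::{order,inf} \<Rightarrow> 'a"
  shows "\<sigma> \<in> automorphisms A \<Longrightarrow> \<sigma> x \<le> \<sigma> y \<longleftrightarrow> x \<le> y"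
  using automorphismsD(2)[of \<sigma> A x y] automorphism_eq[of \<sigma> A x y] by (auto simp: order.order_iff_strict)

lemma sat_automorphism:
  assumes "\<sigma> \<in> automorphisms A"
  shows "sat (\<lambda>i. \<sigma> (e i)) (map_fm \<sigma> \<phi>) \<longleftrightarrow> sat e \<phi>"
proof (induction \<phi> arbitrary: e)
  case (Eq s t)
  have "tval (\<lambda>i. \<sigma> (e i)) (map_trm \<sigma> t) = \<sigma> (tval e t)" for t
    by (induction t) (auto simp: automorphismsD(3)[OF assms])
  then show ?case by (simp add: automorphism_eq[OF assms])
next
  case (Less s t)
  have "tval (\<lambda>i. \<sigma> (e i)) (map_trm \<sigma> t) = \<sigma> (tval e t)" for t
    by (induction t) (auto simp: automorphismsD(3)[OF assms])
  then show ?case by (simp add: automorphismsD(2)[OF assms])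
next
  case (Ex \<phi>)
  have *: "case_nat (\<sigma> a) (\<lambda>i. \<sigma> (e i)) = (\<lambda>i. \<sigma> (case_nat a e i))" for a
    by (auto split: nat.splits)
  have "sat (\<lambda>i. \<sigma> (e i)) (map_fm \<sigma> (Ex \<phi>)) \<longleftrightarrow> (\<exists>a. sat (case_nat (\<sigma> a) (\<lambda>i. \<sigma> (e i))) (map_fm \<sigma> \<phi>))"
    using automorphismsD(1)[OF assms] by (simp, metis bij_pointE)
  then show ?case by (simp add: * Ex.IH)
qed simp_all

lemma sat_automorphism_fix:
  assumes "\<sigma> \<in> automorphisms A" "params \<phi> \<subseteq> A"
  shows "sat (\<lambda>i. \<sigma> (e i)) \<phi> \<longleftrightarrow> sat e \<phi>"
  using sat_automorphism[OF assms(1), of e \<phi>] map_fm_id_on[of \<phi> \<sigma>] automorphismsD(4)[OF assms(1)] assms(2)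
  by (auto simp: subset_iff)

lemma automorphism_inv:
  fixes \<sigma> :: "'a::{ord,inf} \<Rightarrow> 'a"
  assumes "\<sigma> \<in> automorphisms A"
  shows "inv_into UNIV \<sigma> \<in> automorphisms A" "\<sigma> (inv_into UNIV \<sigma> x) = x" "inv_into UNIV \<sigma> (\<sigma> x) = x"
proof -
  have b: "bij \<sigma>" using automorphismsD(1)[OF assms] .
  then have s: "\<sigma> (inv_into UNIV \<sigma> x) = x" "inv_into UNIV \<sigma> (\<sigma> x) = x" for x
    by (simp_all add: bij_is_surj surj_f_inv_f bij_is_inj)
  then show "\<sigma> (inv_into UNIV \<sigma> x) = x" "inv_into UNIV \<sigma> (\<sigma> x) = x" by blast+
  have "inv_into UNIV \<sigma> x < inv_into UNIV \<sigma> y \<longleftrightarrow> x < y" for x y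
    using automorphismsD(2)[OF assms, of "inv_into UNIV \<sigma> x" "inv_into UNIV \<sigma> y"] s by simp
  moreover have "inv_into UNIV \<sigma> (inf x y) = inf (inv_into UNIV \<sigma> x) (inv_into UNIV \<sigma> y)" for x y
    using automorphismsD(3)[OF assms, of "inv_into UNIV \<sigma> x" "inv_into UNIV \<sigma> y"] s by metis
  moreover have "a \<in> A \<Longrightarrow> inv_into UNIV \<sigma> a = a" for a
    using automorphismsD(4)[OF assms, of a] s by metis
  ultimately show "inv_into UNIV \<sigma> \<in> automorphisms A"
    by (simp add: automorphisms_def bij_imp_bij_inv[OF b])
qed

section \<open>Types\<close>

definition fin_sat :: "'a::{ord,inf} fm set \<Rightarrow> bool" where
  "fin_sat \<Gamma> \<longleftrightarrow> (\<forall>F. finite F \<and> F \<subseteq> \<Gamma> \<longrightarrow> (\<exists>e. \<forall>\<phi>\<in>F. sat e \<phi>))"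

lemma types_iff:
  "p \<in> types n B \<longleftrightarrow> p \<subseteq> formulas n B \<and> fin_sat p \<and> (\<forall>\<phi>\<in>formulas n B. \<phi> \<in> p \<or> Neg \<phi> \<in> p)"
  by (simp add: types_def fin_sat_def)

lemma fin_satD: "fin_sat \<Gamma> \<Longrightarrow> finite F \<Longrightarrow> F \<subseteq> \<Gamma> \<Longrightarrow> \<exists>e. \<forall>\<phi>\<in>F. sat e \<phi>"
  by (auto simp: fin_sat_def)

lemma fin_sat_mono: "fin_sat \<Gamma> \<Longrightarrow> \<Delta> \<subseteq> \<Gamma> \<Longrightarrow> fin_sat \<Delta>"
  by (auto simp: fin_sat_def)

lemma fin_sat_insert_or:
  assumes "fin_sat \<Gamma>"
  shows "fin_sat (insert \<phi> \<Gamma>) \<or> fin_sat (insert (Neg \<phi>) \<Gamma>)"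
proof (rule ccontr)
  assume "\<not> ?thesis"
  then obtain F G where F: "finite F" "F \<subseteq> insert \<phi> \<Gamma>" "\<nexists>e. \<forall>\<psi>\<in>F. sat e \<psi>"
    and G: "finite G" "G \<subseteq> insert (Neg \<phi>) \<Gamma>" "\<nexists>e. \<forall>\<psi>\<in>G. sat e \<psi>"
    unfolding fin_sat_def by blast
  have "finite (F - {\<phi>} \<union> (G - {Neg \<phi>}))" "F - {\<phi>} \<union> (G - {Neg \<phi>}) \<subseteq> \<Gamma>" using F G by auto
  from fin_satD[OF assms this] obtain e where e: "\<forall>\<psi>\<in>F - {\<phi>} \<union> (G - {Neg \<phi>}). sat e \<psi>" by blast
  show False
  proof (cases "sat e \<phi>")
    case True
    then have "sat e \<psi>" if "\<psi> \<in> F" for \<psi> using e that by (cases "\<psi> = \<phi>") simp_all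
    then show ?thesis using F(3) by blast
  next
    case False
    then have "sat e (Neg \<phi>)" by simp
    then have "sat e \<psi>" if "\<psi> \<in> G" for \<psi> using e that by (cases "\<psi> = Neg \<phi>") simp_all
    then show ?thesis using G(3) by blast
  qed
qed

lemma fin_sat_Union_chain:
  assumes "C \<noteq> {}" "subset.chain {\<Gamma>. fin_sat \<Gamma>} C"
  shows "fin_sat (\<Union>C)"
  unfolding fin_sat_def
proof (intro allI impI, elim conjE)
  fix F assume "finite F" "F \<subseteq> \<Union>C"
  then obtain X where "X \<in> C" "F \<subseteq> X"
    using finite_subset_Union_chain[of F C "{\<Gamma>. fin_sat \<Gamma>}"] assms by blast
  then show "\<exists>e. \<forall>\<phi>\<in>F. sat e \<phi>"
    using assms(2) \<open>finite F\<close> fin_satD[of X F] by (auto simp: subset.chain_def)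
qed

lemma extend_to_type:
  assumes "fin_sat \<Gamma>" "\<Gamma> \<subseteq> formulas n B"
  shows "\<exists>p\<in>types n B. \<Gamma> \<subseteq> p"
proof -
  let ?A = "{\<Delta>. fin_sat \<Delta> \<and> \<Gamma> \<subseteq> \<Delta> \<and> \<Delta> \<subseteq> formulas n B}"
  have "\<Union>C \<in> ?A" if "C \<noteq> {}" "subset.chain ?A C" for C
  proof -
    have "subset.chain {\<Gamma>. fin_sat \<Gamma>} C" using that(2) by (auto simp: subset.chain_def)
    then have "fin_sat (\<Union>C)" using fin_sat_Union_chain that(1) by blast
    moreover have "C \<subseteq> ?A" using that(2) by (auto simp: subset.chain_def)
    ultimately show ?thesis using that(1) by blast
  qed
  then obtain p where p: "p \<in> ?A" "\<forall>X\<in>?A. p \<subseteq> X \<longrightarrow> X = p"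
    using subset_Zorn_nonempty[of ?A] assms by blast
  have "\<phi> \<in> p \<or> Neg \<phi> \<in> p" if "\<phi> \<in> formulas n B" for \<phi>
  proof -
    have "Neg \<phi> \<in> formulas n B" using that by (simp add: formulas_def)
    then have "\<psi> = \<phi> \<or> \<psi> = Neg \<phi> \<Longrightarrow> fin_sat (insert \<psi> p) \<Longrightarrow> \<psi> \<in> p" for \<psi>
      using p(2)[rule_format, of "insert \<psi> p"] p(1) that by blast
    then show ?thesis using fin_sat_insert_or[of p \<phi>] p(1) by blast
  qed
  then show ?thesis using p(1) by (auto simp: types_iff)
qed

lemma types_neg:
  assumes "p \<in> types n B" "\<phi> \<in> formulas n B"
  shows "Neg \<phi> \<in> p \<longleftrightarrow> \<phi> \<notin> p"
proof -
  have "\<not> (\<phi> \<in> p \<and> Neg \<phi> \<in> p)"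
    using fin_satD[of p "{\<phi>, Neg \<phi>}"] assms(1) by (auto simp: types_iff)
  then show ?thesis using assms by (auto simp: types_iff)
qed

lemma types_consequence:
  assumes "p \<in> types n B" "finite F" "F \<subseteq> p" "\<phi> \<in> formulas n B"
    "\<And>e. (\<And>\<psi>. \<psi> \<in> F \<Longrightarrow> sat e \<psi>) \<Longrightarrow> sat e \<phi>"
  shows "\<phi> \<in> p"
proof (rule ccontr)
  assume "\<phi> \<notin> p"
  then have "insert (Neg \<phi>) F \<subseteq> p" using types_neg assms by blast
  then obtain e where "\<forall>\<psi>\<in>insert (Neg \<phi>) F. sat e \<psi>"
    using fin_satD[of p "insert (Neg \<phi>) F"] assms by (auto simp: types_iff)
  then show False using assms(5)[of e] by auto
qed

text \<open>Replaces finitely many formulas by a single one, to which a quantifier can be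
  applied.\<close>

lemma types_finite_conj:
  assumes p: "p \<in> types n B" and "finite F" "F \<noteq> {}" "F \<subseteq> p"
  shows "\<exists>\<psi>\<in>p. \<forall>e. sat e \<psi> \<longleftrightarrow> (\<forall>\<phi>\<in>F. sat e \<phi>)"
  using assms(2-4)
proof (induction rule: finite_ne_induct)
  case (insert \<phi> F)
  then obtain \<psi> where \<psi>: "\<psi> \<in> p" "\<forall>e. sat e \<psi> \<longleftrightarrow> (\<forall>\<phi>\<in>F. sat e \<phi>)" by auto
  have "Conj \<phi> \<psi> \<in> p"
    by (rule types_consequence[OF p, of "{\<phi>, \<psi>}"])
      (use insert.prems \<psi>(1) p in \<open>auto simp: types_iff formulas_def\<close>)
  then show ?case using \<psi>(2) by (intro bexI[of _ "Conj \<phi> \<psi>"]) auto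
qed auto

definition complete_theory :: "nat \<Rightarrow> 'a::{ord,inf} set \<Rightarrow> (nat \<Rightarrow> 'a) \<Rightarrow> 'a fm set" where
  "complete_theory n B e = {\<phi> \<in> formulas n B. sat e \<phi>}"

lemma complete_theory_types: "complete_theory n B e \<in> types n B"
  by (auto simp: types_iff complete_theory_def fin_sat_def formulas_def)

section \<open>Monster models\<close>

locale monster =
  fixes \<kappa> :: "'k rel" and T :: "'a::dense_meet_tree itself"
  assumes monster: "monster_model \<kappa> T"
begin

abbreviation small :: "'x set \<Rightarrow> bool" where
  "small \<equiv> Defs.small \<kappa>"

lemma Card_order_kappa: "Card_order \<kappa>" and natLeq_kappa: "natLeq <o \<kappa>"
  and saturated: "saturated \<kappa> T" and homogeneous: "strongly_homogeneous \<kappa> T"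
  using monster by (auto simp: monster_model_def)

lemma infinite_Field: "infinite (Field \<kappa>)"
proof -
  have "natLeq \<le>o |Field \<kappa>|"
    using ordLess_imp_ordLeq[OF natLeq_kappa] card_of_Field_ordIso[OF Card_order_kappa]
      ordIso_symmetric ordLeq_ordIso_trans by blast
  then show ?thesis using infinite_iff_natLeq_ordLeq by blast
qed

lemma small_finite [simp]: "finite A \<Longrightarrow> small A"
  unfolding small_def using finite_iff_ordLess_natLeq natLeq_kappa ordLess_transitive by blast

lemma small_subset: "small A \<Longrightarrow> B \<subseteq> A \<Longrightarrow> small B"
  unfolding small_def using card_of_mono1 ordLeq_ordLess_trans by blast

lemma small_Un [simp]: "small (A \<union> B) \<longleftrightarrow> small A \<and> small B"
  unfolding small_def
  using card_of_Un_ordLess_infinite_Field[OF infinite_Field Card_order_kappa]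
    small_subset[unfolded small_def, of "A \<union> B"] by blast

lemma small_insert [simp]: "small (insert a A) \<longleftrightarrow> small A"
  using small_Un[of "{a}" A] by simp

lemma small_image: "small A \<Longrightarrow> small (f ` A)"
  unfolding small_def using card_of_image ordLeq_ordLess_trans by blast

text \<open>Nothing makes \<open>\<kappa>\<close> regular, so a small union of small sets may fail
  to be small. The bound by the index set is what keeps the union small.\<close>

lemma small_UN_small:
  assumes "small I" "\<And>i. i \<in> I \<Longrightarrow> finite (A i) \<or> |A i| \<le>o |I|"
  shows "small (\<Union>i\<in>I. A i)"
proof (cases "finite I")
  case True
  then have "finite (A i)" if "i \<in> I" for i
    using assms(2)[OF that] card_of_ordLeq_finite by blast
  then show ?thesis using True by simp
next
  case False
  have "|A i| \<le>o |I|" if "i \<in> I" for i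
    using assms(2)[OF that] False by (meson card_of_ordLeq_infinite ordLeq_total card_of_Well_order
        infinite_iff_natLeq_ordLeq finite_iff_ordLess_natLeq ordLess_imp_ordLeq ordLeq_transitive)
  then have "|\<Union>i\<in>I. A i| \<le>o |I|" using card_of_UNION_ordLeq_infinite[of I I A] False
    card_of_mono1[of I I] by blast
  then show ?thesis using assms(1) unfolding small_def using ordLeq_ordLess_trans by blast
qed

text \<open>The domain of \<open>inf_closure (Id_on X)\<close>; a single round of meets already
  gives a set closed under meets, see \<open>icl_closed\<close>.\<close>

definition icl :: "'a set \<Rightarrow> 'a set" where
  "icl X = (\<Union>x\<in>X. inf x ` X)"

lemma small_icl: "small X \<Longrightarrow> small (icl X)"
  unfolding icl_def by (rule small_UN_small) (auto intro: card_of_image)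

lemma finite_icl: "finite X \<Longrightarrow> finite (icl X)"
  by (auto simp: icl_def)

lemma subset_icl: "X \<subseteq> icl X"
  by (force simp: icl_def)

lemma icl_iff: "d \<in> icl X \<longleftrightarrow> (\<exists>x\<in>X. \<exists>y\<in>X. d = inf x y)"
  by (auto simp: icl_def)

lemma inf_closure_Id_on: "inf_closure (Id_on X) = Id_on (icl X)"
proof -
  have "z \<in> inf_closure (Id_on X) \<longleftrightarrow> z \<in> Id_on (icl X)" for z
    by (cases z) (auto simp: inf_closure_iff icl_iff Id_on_iff)
  then show ?thesis by blast
qed

lemma inf_closed_icl: "inf_closed_rel (Id_on (icl X))"
  using inf_closed_inf_closure[OF piso_Id_on, of X] inf_closure_Id_on by simp

lemma icl_closed: "a \<in> icl X \<Longrightarrow> b \<in> icl X \<Longrightarrow> inf a b \<in> icl X"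
  using inf_closed_relD[OF inf_closed_icl, of a a X b b] by (auto simp: Id_on_iff)

section \<open>Saturation in several variables, compactness and homogeneity\<close>

lemma realise:
  fixes \<Gamma> :: "'a fm set"
  assumes "small A" "fin_sat \<Gamma>" "\<Gamma> \<subseteq> formulas n A"
  shows "\<exists>a. \<forall>\<phi>\<in>\<Gamma>. sat a \<phi>"
  using assms
proof (induction n arbitrary: \<Gamma> A)
  case 0
  have "sat e \<phi>" if "\<phi> \<in> \<Gamma>" for e \<phi>
  proof -
    obtain e' where "sat e' \<phi>" using fin_satD[OF 0(2), of "{\<phi>}"] \<open>\<phi> \<in> \<Gamma>\<close> by auto
    then show ?thesis using sat_cong[of \<phi> e e'] 0(3) that by (auto simp: formulas_def)
  qed
  then show ?case by blast
next
  case (Suc n)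
  obtain p where p: "p \<in> types (Suc n) A" "\<Gamma> \<subseteq> p" using extend_to_type Suc.prems by blast
  have pf: "p \<subseteq> formulas (Suc n) A" using p(1) by (simp add: types_iff)
  \<comment> \<open>Saturation speaks of one variable only. The formulas \<open>Ex \<phi>\<close>
    are realised first, by induction, by a tuple for the variables after 0; then variable 0 is
    realised over \<open>A\<close> and that tuple.\<close>
  let ?E = "{Ex \<phi> |\<phi>. \<phi> \<in> p}"
  have fsE: "fin_sat ?E"
    unfolding fin_sat_def
  proof (intro allI impI, elim conjE)
    fix F assume "finite F" "F \<subseteq> ?E"
    moreover have "?E = Ex ` p" by auto
    ultimately obtain F' where F': "finite F'" "F' \<subseteq> p" "F = Ex ` F'"
      by (metis (no_types, lifting) finite_subset_image)
    then obtain e where e: "\<forall>\<phi>\<in>F'. sat e \<phi>" using fin_satD[of p F'] p(1) unfolding types_iff by blast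
    have "case_nat (e 0) (\<lambda>i. e (Suc i)) = e" by (auto split: nat.splits)
    then have "\<forall>\<phi>\<in>F. sat (\<lambda>i. e (Suc i)) \<phi>" using e F'(3) by auto metis
    then show "\<exists>e. \<forall>\<phi>\<in>F. sat e \<phi>" by blast
  qed
  have "Ex \<phi> \<in> formulas n A" if "\<phi> \<in> p" for \<phi>
    using subsetD[OF pf that] by (auto simp: formulas_def)
  then have "?E \<subseteq> formulas n A" by blast
  from Suc.IH[OF Suc.prems(1) fsE this] obtain a where "\<forall>\<phi>\<in>?E. sat a \<phi>" by blast
  then have a: "sat a (Ex \<phi>)" if "\<phi> \<in> p" for \<phi> using that by blast
  define s where "s = case_nat (Var 0) (\<lambda>i. Par (a i))"
  let ?P = "fsubst s ` p"
  have ev: "(\<lambda>i. tval e (s i)) = case_nat (e 0) a" for e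
    by (auto simp: s_def split: nat.splits)
  have fsP: "fin_sat ?P"
    unfolding fin_sat_def
  proof (intro allI impI, elim conjE)
    fix F assume "finite F" "F \<subseteq> ?P"
    then obtain F' where F': "finite F'" "F' \<subseteq> p" "F = fsubst s ` F'"
      by (metis (no_types, lifting) finite_subset_image)
    show "\<exists>e. \<forall>\<phi>\<in>F. sat e \<phi>"
    proof (cases "F' = {}")
      case True
      then show ?thesis using F' by simp
    next
      case False
      \<comment> \<open>Separate existential formulas might have different witnesses; a single
        formula equivalent to the conjunction has a common one.\<close>
      then obtain \<psi> where "\<psi> \<in> p" "\<forall>e. sat e \<psi> \<longleftrightarrow> (\<forall>\<phi>\<in>F'. sat e \<phi>)"
        using types_finite_conj[OF p(1) F'(1) False F'(2)] by blast
      then obtain b where "\<forall>\<phi>\<in>F'. sat (case_nat b a) \<phi>" using a[of \<psi>] by auto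
      then have "\<forall>\<phi>\<in>F. sat (\<lambda>_. b) \<phi>" using F'(3) by (auto simp: sat_fsubst ev)
      then show ?thesis by blast
    qed
  qed
  let ?A = "A \<union> a ` {..<n}"
  have "?P \<subseteq> formulas 1 ?A"
  proof
    fix \<phi> assume "\<phi> \<in> ?P"
    then obtain \<psi> where \<psi>: "\<psi> \<in> p" "\<phi> = fsubst s \<psi>" by auto
    then have "fvars \<psi> \<subseteq> {..<Suc n}" "params \<psi> \<subseteq> A" using pf by (auto simp: formulas_def)
    moreover have "tparams (s i) \<subseteq> a ` {..<n}" "tvars (s i) \<subseteq> {0}" if "i < Suc n" for i
      using that by (cases i; auto simp: s_def)+
    ultimately have "fvars \<phi> \<subseteq> {0}" "params \<phi> \<subseteq> ?A"
      using params_fsubst[of s \<psi>] by (auto simp: \<psi>(2) fvars_fsubst subset_iff) blast+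
    then show "\<phi> \<in> formulas 1 ?A" by (auto simp: formulas_def)
  qed
  then obtain q where q: "q \<in> types 1 ?A" "?P \<subseteq> q" using extend_to_type[OF fsP] by blast
  have sA: "small ?A" using Suc.prems(1) by simp
  have "\<exists>b. \<forall>\<phi>\<in>q. sat (\<lambda>_. b) \<phi>"
    using saturated[unfolded saturated_def, rule_format, OF sA q(1)] .
  then obtain b where "\<forall>\<phi>\<in>?P. sat (\<lambda>_. b) \<phi>" using q(2) by blast
  then have "\<forall>\<phi>\<in>p. sat (case_nat b a) \<phi>" by (simp add: sat_fsubst ev)
  then show ?case using p(2) by blast
qed

text \<open>Saturation used as compactness: as the parameters form a small set, what holds for all
  realisations of \<open>\<Delta>\<close> in the model itself already follows from finitely many
  members of \<open>\<Delta>\<close>.\<close>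

lemma entailsI:
  fixes \<phi> :: "'a fm"
  assumes "small D" "\<Delta> \<subseteq> \<Gamma>" "\<Delta> \<subseteq> formulas n D" "\<phi> \<in> formulas n D"
    and "\<And>e. (\<And>\<psi>. \<psi> \<in> \<Delta> \<Longrightarrow> sat e \<psi>) \<Longrightarrow> sat e \<phi>"
  shows "entails \<Gamma> \<phi>"
proof (rule ccontr)
  assume ne: "\<not> entails \<Gamma> \<phi>"
  have "fin_sat (insert (Neg \<phi>) \<Delta>)"
    unfolding fin_sat_def
  proof (intro allI impI, elim conjE)
    fix F assume "finite F" "F \<subseteq> insert (Neg \<phi>) \<Delta>"
    then have "finite (F - {Neg \<phi>})" "F - {Neg \<phi>} \<subseteq> \<Gamma>" using assms(2) by auto
    then obtain e where "\<forall>\<psi>\<in>F - {Neg \<phi>}. sat e \<psi>" "\<not> sat e \<phi>"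
      using ne unfolding entails_def by blast
    then have "\<forall>\<psi>\<in>F. sat e \<psi>" by (metis Diff_iff insertE empty_iff sat.simps(3))
    then show "\<exists>e. \<forall>\<psi>\<in>F. sat e \<psi>" by blast
  qed
  moreover have "insert (Neg \<phi>) \<Delta> \<subseteq> formulas n D" using assms by (auto simp: formulas_def)
  ultimately obtain e where "\<forall>\<psi>\<in>insert (Neg \<phi>) \<Delta>. sat e \<psi>" using realise[OF assms(1)] by blast
  then show False using assms(5)[of e] by auto
qed

text \<open>By \<open>sat_piso\<close> such a relation is the graph of a partial elementary map, to
  which strong homogeneity applies.\<close>

lemma extend_automorphism:
  fixes G :: "('a \<times> 'a) set"
  assumes "piso G" "small (Domain G)"
  shows "\<exists>\<sigma>\<in>automorphisms {}. \<forall>x y. (x, y) \<in> G \<longrightarrow> \<sigma> x = y"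
proof -
  define f where "f x = (SOME y. (x, y) \<in> G)" for x
  have fG: "(x, f x) \<in> G" if "x \<in> Domain G" for x
    using that unfolding f_def by (meson DomainE someI)
  have f: "f x = y" if "(x, y) \<in> G" for x y
    using piso_eq[OF assms(1) that, of x "f x"] fG[of x] that by blast
  have "partial_elementary (Domain G) f"
    unfolding partial_elementary_def
  proof (intro ballI allI)
    fix \<phi> :: "'a fm" and e assume "\<phi> \<in> formulas 0 (Domain G)"
    then have "fvars \<phi> = {}" "params \<phi> \<subseteq> Domain G" by (auto simp: formulas_def)
    moreover have "\<forall>a\<in>params \<phi>. (a, f a) \<in> G" using fG subsetD[OF \<open>params \<phi> \<subseteq> Domain G\<close>] by blast
    ultimately show "sat e \<phi> \<longleftrightarrow> sat e (map_fm f \<phi>)"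
      by (intro sat_piso[OF assms(1)]) auto
  qed
  then obtain \<sigma> where "\<sigma> \<in> automorphisms {}" "\<forall>a\<in>Domain G. \<sigma> a = f a"
    using homogeneous assms(2) unfolding strongly_homogeneous_def by blast
  then show ?thesis using f by blast
qed

lemma extend_automorphism_over:
  fixes X :: "'a set"
  assumes "piso (Id_on X \<union> H)" "small X" "finite H"
  shows "\<exists>\<sigma>\<in>automorphisms X. \<forall>x y. (x, y) \<in> H \<longrightarrow> \<sigma> x = y"
proof -
  have "Domain (Id_on X \<union> H) = X \<union> Domain H" by auto
  then have "small (Domain (Id_on X \<union> H))" using assms by (simp add: finite_Domain)
  then obtain \<sigma> where "\<sigma> \<in> automorphisms {}" "\<forall>x y. (x, y) \<in> Id_on X \<union> H \<longrightarrow> \<sigma> x = y"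
    using extend_automorphism[OF assms(1)] by blast
  then show ?thesis by (intro bexI[of _ \<sigma>]) (auto simp: automorphisms_def)
qed

definition tuple_rel :: "nat \<Rightarrow> (nat \<Rightarrow> 'a) \<Rightarrow> (nat \<Rightarrow> 'a) \<Rightarrow> ('a \<times> 'a) set" where
  "tuple_rel n a b = (\<lambda>i. (a i, b i)) ` {..<n}"

lemma sat_tuple_rel:
  assumes "piso (Id_on D \<union> tuple_rel n a b)" "\<phi> \<in> formulas n D"
  shows "sat a \<phi> \<longleftrightarrow> sat b \<phi>"
proof -
  have "sat a \<phi> \<longleftrightarrow> sat b (map_fm id \<phi>)"
    by (rule sat_piso[OF assms(1)]) (use assms(2) in \<open>auto simp: formulas_def tuple_rel_def\<close>)
  then show ?thesis by (simp add: fm.map_id)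
qed

lemma piso_tuple_rel:
  fixes a b :: "nat \<Rightarrow> 'a"
  assumes "\<And>\<phi>. \<phi> \<in> formulas n D \<Longrightarrow> sat a \<phi> \<Longrightarrow> sat b \<phi>"
  shows "piso (Id_on D \<union> tuple_rel n a b)"
proof -
  let ?G = "Id_on D \<union> tuple_rel n a b"
  have iff: "sat a \<phi> \<longleftrightarrow> sat b \<phi>" if "\<phi> \<in> formulas n D" for \<phi>
    using assms[of \<phi>] assms[of "Neg \<phi>"] that by (auto simp: formulas_def)
  have t: "\<exists>t. tval a t = x \<and> tval b t = x' \<and> tvars t \<subseteq> {..<n} \<and> tparams t \<subseteq> D" if "(x, x') \<in> ?G" for x x'
  proof (cases "(x, x') \<in> Id_on D")
    case True
    then show ?thesis by (intro exI[of _ "Par x"]) auto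
  next
    case False
    with that have "(x, x') \<in> tuple_rel n a b" by simp
    then obtain i where "i < n" "x = a i" "x' = b i" by (auto simp: tuple_rel_def)
    then show ?thesis by (intro exI[of _ "Var i"]) auto
  qed
  show ?thesis
    unfolding piso_def
  proof (intro allI impI)
    fix x x' y y' z z' assume "(x, x') \<in> ?G" "(y, y') \<in> ?G" "(z, z') \<in> ?G"
    then obtain s t u where "tval a s = x" "tval b s = x'" "tvars s \<subseteq> {..<n}" "tparams s \<subseteq> D"
      "tval a t = y" "tval b t = y'" "tvars t \<subseteq> {..<n}" "tparams t \<subseteq> D"
      "tval a u = z" "tval b u = z'" "tvars u \<subseteq> {..<n}" "tparams u \<subseteq> D"
      using t by (metis (no_types))
    then show "inf x y \<le> z \<longleftrightarrow> inf x' y' \<le> z'"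
      using iff[of "Le (Meet s t) u"] by (auto simp: formulas_def)
  qed
qed

lemma tuple_automorphism:
  fixes a b :: "nat \<Rightarrow> 'a"
  assumes "small D" "\<And>\<phi>. \<phi> \<in> formulas n D \<Longrightarrow> sat a \<phi> \<Longrightarrow> sat b \<phi>"
  shows "\<exists>\<sigma>\<in>automorphisms D. \<forall>i<n. \<sigma> (a i) = b i"
proof -
  have "finite (tuple_rel n a b)" by (simp add: tuple_rel_def)
  then obtain \<sigma> where "\<sigma> \<in> automorphisms D" "\<forall>x y. (x, y) \<in> tuple_rel n a b \<longrightarrow> \<sigma> x = y"
    using extend_automorphism_over[OF piso_tuple_rel[of n D a b]] assms by blast
  then show ?thesis by (auto simp: tuple_rel_def)
qed

section \<open>Geometric automorphisms\<close>

text \<open>With \<open>c\<close> as an anchor, only the position of \<open>z\<close> and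
  \<open>l\<close> in the chain below \<open>c\<close> matters, and each point of that chain in the
  meet closure of \<open>X\<close> and \<open>c\<close> is \<open>c\<close> or some
  \<open>inf x c\<close>.\<close>

lemma gap_automorphism:
  fixes X :: "'a set"
  assumes "small X" and z: "z < c" "l < c"
    and gap: "\<And>x. x \<in> X \<Longrightarrow> inf x c < l \<and> inf x c < z \<or> l < inf x c \<and> z < inf x c"
  shows "\<exists>\<tau>\<in>automorphisms (insert c X). \<tau> z = l"
proof -
  let ?X = "icl (insert c X)"
  have gap': "d < l \<and> d < z \<or> l < d \<and> z < d" if "d \<in> ?X" "d \<le> c" for d
  proof -
    obtain x y where xy: "x \<in> insert c X" "y \<in> insert c X" "d = inf x y" using \<open>d \<in> ?X\<close> icl_iff by blast
    then have "d = inf (inf x c) (inf y c)"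
      using \<open>d \<le> c\<close> by (metis inf.absorb1 inf_aci(1) inf_aci(2) inf_idem)
    moreover have "inf x c \<le> inf y c \<or> inf y c \<le> inf x c" by (rule tree_linear[of _ c]) simp_all
    ultimately have "d = inf x c \<or> d = inf y c" by (auto simp: inf_absorb1 inf_absorb2)
    then show ?thesis using xy gap z by (metis inf.idem insertE)
  qed
  have "piso (insert (z, l) (Id_on ?X))"
  proof (rule piso_insert[OF piso_Id_on inf_closed_icl])
    show "(c, c) \<in> Id_on ?X" using subset_icl[of "insert c X"] by auto
    fix d d' assume d: "(d, d') \<in> Id_on ?X"
    show "inf z d \<le> c \<and> inf l d' \<le> c" using z by (auto intro: le_infI1 less_imp_le)
    assume "d \<le> c"
    then show "(d \<le> z) = (d' \<le> l) \<and> (inf z c \<le> d) = (inf l c \<le> d')"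
      using gap'[of d] d z by (auto simp: inf_absorb1 less_imp_le Id_on_iff)
  qed (use z in \<open>auto simp: less_imp_le\<close>)
  then have "piso (Id_on ?X \<union> {(z, l)})" by simp
  then obtain \<tau> where "\<tau> \<in> automorphisms ?X" "\<tau> z = l"
    using extend_automorphism_over[of ?X "{(z, l)}"] assms(1) small_icl by auto
  then show ?thesis using automorphisms_mono subset_icl by blast
qed

text \<open>The meet of two distinct elements does not change when each \<open>v j\<close> or
  \<open>w j\<close> is replaced by \<open>g j\<close>. All these meets are therefore computed
  inside \<open>X\<close>, in the same way for \<open>v\<close> and for \<open>w\<close>.\<close>

lemma piso_new_above:
  fixes X :: "'a set"
  assumes cl: "\<And>x y. x \<in> X \<Longrightarrow> y \<in> X \<Longrightarrow> inf x y \<in> X" and g: "g ` J \<subseteq> X"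
    and v: "\<And>j. j \<in> J \<Longrightarrow> g j < v j" "\<And>j x. j \<in> J \<Longrightarrow> x \<in> X \<Longrightarrow> inf (v j) x \<le> g j"
    "\<And>j k. j \<in> J \<Longrightarrow> k \<in> J \<Longrightarrow> j \<noteq> k \<Longrightarrow> inf (v j) (v k) \<le> g j"
    and w: "\<And>j. j \<in> J \<Longrightarrow> g j < w j" "\<And>j x. j \<in> J \<Longrightarrow> x \<in> X \<Longrightarrow> inf (w j) x \<le> g j"
    "\<And>j k. j \<in> J \<Longrightarrow> k \<in> J \<Longrightarrow> j \<noteq> k \<Longrightarrow> inf (w j) (w k) \<le> g j"
  shows "piso (Id_on X \<union> (\<lambda>j. (v j, w j)) ` J)"
proof -
  have *: "inf (u j) x = inf (g j) x" "x \<le> u j \<longleftrightarrow> x \<le> g j" "\<not> u j \<le> x"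
    if "j \<in> J" "x \<in> X" "u = v \<or> u = w" for u j x
  proof -
    have u: "g j < u j" "inf (u j) x \<le> g j" using that v w by auto
    show "inf (u j) x = inf (g j) x"
      using u by (intro order.antisym) (auto intro: le_infI1 less_imp_le)
    then show "x \<le> u j \<longleftrightarrow> x \<le> g j" by (metis inf.absorb_iff2)
    show "\<not> u j \<le> x" using u by (metis inf.absorb1 leD)
  qed
  have **: "inf (u j) (u k) = inf (g j) (g k)" "\<not> u j \<le> u k"
    if "j \<in> J" "k \<in> J" "j \<noteq> k" "u = v \<or> u = w" for u j k
  proof -
    have u: "g j < u j" "g k < u k" "inf (u j) (u k) \<le> g j" "inf (u k) (u j) \<le> g k" using that v w by auto
    show "inf (u j) (u k) = inf (g j) (g k)"
      using u by (intro order.antisym) (auto simp: inf.commute intro: le_infI1 le_infI2 less_imp_le)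
    show "\<not> u j \<le> u k" using u by (metis inf.absorb1 leD)
  qed
  \<comment> \<open>The sum type lists the elements of \<open>X\<close> and the new ones;
    \<open>B g\<close> projects the list onto \<open>X\<close>.\<close>
  define B where "B u s = (case s of Inl x \<Rightarrow> x | Inr j \<Rightarrow> u j)" for u :: "'b \<Rightarrow> 'a" and s :: "'a + 'b"
  have rep: "\<exists>s. s \<in> Inl ` X \<union> Inr ` J \<and> x = B v s \<and> x' = B w s"
    if "(x, x') \<in> Id_on X \<union> (\<lambda>j. (v j, w j)) ` J" for x x'
    using that by (auto simp: B_def Id_on_iff intro: exI[of _ "Inl x"] exI[of _ "Inr j" for j])
  have meet: "inf (B u s) (B u t) = inf (B g s) (B g t)" "inf (B g s) (B g t) \<in> X"
    if "s \<in> Inl ` X \<union> Inr ` J" "t \<in> Inl ` X \<union> Inr ` J" "s \<noteq> t" "u = v \<or> u = w" for s t u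
  proof -
    show "inf (B u s) (B u t) = inf (B g s) (B g t)"
    proof (cases "\<exists>j k. s = Inr j \<and> t = Inr k")
      case True
      then obtain j k where "s = Inr j" "t = Inr k" by blast
      then show ?thesis using that **[of j k u] by (auto simp: B_def)
    next
      case False
      then show ?thesis using that *[of _ _ u] by (auto simp: B_def inf.commute)
    qed
    show "inf (B g s) (B g t) \<in> X" using that g cl by (auto simp: B_def image_subset_iff)
  qed
  have le: "x \<le> B u s \<longleftrightarrow> x \<le> B g s" if "s \<in> Inl ` X \<union> Inr ` J" "x \<in> X" "u = v \<or> u = w" for s x u
    using that * by (auto simp: B_def)
  have self: "B u s \<le> B u t \<longleftrightarrow> s \<in> Inl ` X \<and> B g s \<le> B g t \<or> s = t"
    if "s \<in> Inl ` X \<union> Inr ` J" "t \<in> Inl ` X \<union> Inr ` J" "u = v \<or> u = w" for s t u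
    using that * ** by (auto simp: B_def)
  have main: "inf (B v s) (B v t) \<le> B v r \<longleftrightarrow> inf (B w s) (B w t) \<le> B w r"
    if "s \<in> Inl ` X \<union> Inr ` J" "t \<in> Inl ` X \<union> Inr ` J" "r \<in> Inl ` X \<union> Inr ` J" for s t r
  proof (cases "s = t")
    case True
    then show ?thesis using self[OF that(1,3)] by simp
  next
    case False
    then show ?thesis
      using meet[OF that(1,2) False, of v] meet[OF that(1,2) False, of w] le[OF that(3), of _ v] le[OF that(3), of _ w]
      by simp
  qed
  show ?thesis
    unfolding piso_def
  proof (intro allI impI)
    fix x x' y y' z z'
    assume "(x, x') \<in> Id_on X \<union> (\<lambda>j. (v j, w j)) ` J" "(y, y') \<in> Id_on X \<union> (\<lambda>j. (v j, w j)) ` J"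
      "(z, z') \<in> Id_on X \<union> (\<lambda>j. (v j, w j)) ` J"
    from this[THEN rep] show "inf x y \<le> z \<longleftrightarrow> inf x' y' \<le> z'" using main by (elim exE conjE) simp
  qed
qed

lemma new_automorphism:
  fixes X :: "'a set"
  assumes X: "small X" "finite J" and g: "g ` J \<subseteq> X"
    and v: "\<And>j. j \<in> J \<Longrightarrow> g j < v j" "\<And>j x. j \<in> J \<Longrightarrow> x \<in> X \<Longrightarrow> inf (v j) x \<le> g j"
    "\<And>j k. j \<in> J \<Longrightarrow> k \<in> J \<Longrightarrow> j \<noteq> k \<Longrightarrow> inf (v j) (v k) \<le> g j"
    and w: "\<And>j. j \<in> J \<Longrightarrow> g j < w j" "\<And>j x. j \<in> J \<Longrightarrow> x \<in> X \<Longrightarrow> inf (w j) x \<le> g j"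
    "\<And>j k. j \<in> J \<Longrightarrow> k \<in> J \<Longrightarrow> j \<noteq> k \<Longrightarrow> inf (w j) (w k) \<le> g j"
  shows "\<exists>\<tau>\<in>automorphisms X. \<forall>j\<in>J. \<tau> (v j) = w j"
proof -
  have "inf u x \<le> h" if "\<And>x. x \<in> X \<Longrightarrow> inf u x \<le> h" "x \<in> icl X" for u x h
    using that by (metis icl_iff inf.assoc le_infI1)
  note u = this
  have "piso (Id_on (icl X) \<union> (\<lambda>j. (v j, w j)) ` J)"
  proof (rule piso_new_above[where g = g])
    show "g ` J \<subseteq> icl X" using g subset_icl by blast
    show "inf (v j) x \<le> g j" "inf (w j) x \<le> g j" if "j \<in> J" "x \<in> icl X" for j x
      using that u[of "v j" "g j" x] u[of "w j" "g j" x] v(2) w(2) by auto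
  qed (use v w icl_closed in auto)
  then obtain \<tau> where "\<tau> \<in> automorphisms (icl X)" "\<forall>j\<in>J. \<tau> (v j) = w j"
    using extend_automorphism_over[of "icl X" "(\<lambda>j. (v j, w j)) ` J"] X small_icl by blast
  then show ?thesis using automorphisms_mono subset_icl by blast
qed

text \<open>\<open>new_cone_finite\<close> gives finite satisfiability; saturation then passes from
  finite to small sets.\<close>

lemma ex_new_cone:
  fixes X :: "'a set"
  assumes "small X"
  shows "\<exists>u>g. \<forall>x\<in>X. inf u x \<le> g"
proof -
  let ?\<Gamma> = "insert (Less (Par g) (Var 0)) ((\<lambda>x. Le (Meet (Var 0) (Par x)) (Par g)) ` X)"
  have "fin_sat ?\<Gamma>"
    unfolding fin_sat_def
  proof (intro allI impI, elim conjE)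
    fix F assume F: "finite F" "F \<subseteq> ?\<Gamma>"
    have "finite (\<Union>\<phi>\<in>F. params \<phi>)" using F(1) finite_params by blast
    from new_cone_finite[OF this, of g]
    obtain u where "g < u" "\<forall>x\<in>(\<Union>\<phi>\<in>F. params \<phi>). inf u x \<le> g" by blast
    then have "\<forall>\<phi>\<in>F. sat (\<lambda>_. u) \<phi>" using F(2) by fastforce
    then show "\<exists>e. \<forall>\<phi>\<in>F. sat e \<phi>" by blast
  qed
  moreover have "?\<Gamma> \<subseteq> formulas 1 (insert g X)" by (auto simp: formulas_def)
  moreover have "small (insert g X)" using assms by simp
  ultimately obtain e where "\<forall>\<phi>\<in>?\<Gamma>. sat e \<phi>" using realise by blast
  then show ?thesis by auto
qed

text \<open>The saturated form of \<open>dense_finite\<close>. It is the reason why a cut cannot be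
  approached by small sets from both sides.\<close>

lemma ex_between:
  fixes L M :: "'a set"
  assumes "small L" "small M" "M \<noteq> {}" "\<And>l m. l \<in> L \<Longrightarrow> m \<in> M \<Longrightarrow> l < m"
    and "\<And>l. l \<in> L \<Longrightarrow> l \<le> c" "\<And>m. m \<in> M \<Longrightarrow> m \<le> c"
  shows "\<exists>z. (\<forall>l\<in>L. l < z) \<and> (\<forall>m\<in>M. z < m)"
proof -
  let ?\<Gamma> = "(\<lambda>l. Less (Par l) (Var 0)) ` L \<union> (\<lambda>m. Less (Var 0) (Par m)) ` M"
  have "fin_sat ?\<Gamma>"
    unfolding fin_sat_def
  proof (intro allI impI, elim conjE)
    fix F assume F: "finite F" "F \<subseteq> ?\<Gamma>"
    obtain m where m: "m \<in> M" using assms(3) by blast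
    let ?P = "\<Union>\<phi>\<in>F. params \<phi>"
    have "finite ?P" using F(1) finite_params by blast
    then have "\<exists>z. (\<forall>l\<in>L \<inter> ?P. l < z) \<and> (\<forall>m\<in>insert m (M \<inter> ?P). z < m)"
      by (intro dense_finite[where c = c]) (use m assms(4-6) in auto)
    then obtain z where "\<forall>l\<in>L \<inter> ?P. l < z" "\<forall>m\<in>M \<inter> ?P. z < m" by auto
    then have "\<forall>\<phi>\<in>F. sat (\<lambda>_. z) \<phi>" using F(2) by fastforce
    then show "\<exists>e. \<forall>\<phi>\<in>F. sat e \<phi>" by blast
  qed
  moreover have "?\<Gamma> \<subseteq> formulas 1 (L \<union> M)" by (auto simp: formulas_def)
  moreover have "small (L \<union> M)" using assms by simp
  ultimately have "\<exists>e. \<forall>\<phi>\<in>?\<Gamma>. sat e \<phi>" by (intro realise)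
  then obtain e where e: "\<And>\<phi>. \<phi> \<in> ?\<Gamma> \<Longrightarrow> sat e \<phi>" by blast
  have "\<forall>l\<in>L. l < e 0" "\<forall>m\<in>M. e 0 < m"
    using e[of "Less (Par _) (Var 0)"] e[of "Less (Var 0) (Par _)"] by auto
  then show ?thesis by blast
qed

end

section \<open>Global types and their realisations over small sets\<close>

text \<open>Stands in for a realisation in an extension: only formulas over \<open>D\<close> are
  tested, and for small \<open>D\<close> such a tuple exists in the model, see
  \<open>ex_rlz\<close>.\<close>

definition rlz :: "nat \<Rightarrow> 'a::dense_meet_tree fm set \<Rightarrow> 'a set \<Rightarrow> (nat \<Rightarrow> 'a) \<Rightarrow> bool" where
  "rlz n p D a \<longleftrightarrow> (\<forall>\<phi>\<in>formulas n D. \<phi> \<in> p \<longleftrightarrow> sat a \<phi>)"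

definition cut :: "'a fm set \<Rightarrow> nat \<Rightarrow> 'a set" where
  "cut p i = {u. Le (Par u) (Var i) \<in> p}"

text \<open>The variable lies in the open cone of \<open>c\<close> above \<open>g\<close>.\<close>

definition above :: "'a fm set \<Rightarrow> nat \<Rightarrow> 'a \<Rightarrow> 'a \<Rightarrow> bool" where
  "above p i g c \<longleftrightarrow> Less (Par g) (Meet (Var i) (Par c)) \<in> p"

definition joined :: "'a fm set \<Rightarrow> 'a \<Rightarrow> nat \<Rightarrow> nat \<Rightarrow> bool" where
  "joined p g i j \<longleftrightarrow> Less (Par g) (Meet (Var i) (Var j)) \<in> p"

text \<open>No element of the model shares a piece of the branch of the variable beyond
  \<open>c\<close>. If moreover \<open>c\<close> is in the cut, the variable equals \<open>c\<close>
  or lies in a new open cone above \<open>c\<close>.\<close>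

definition anchor :: "'a fm set \<Rightarrow> nat \<Rightarrow> 'a \<Rightarrow> bool" where
  "anchor p i c \<longleftrightarrow> (\<forall>d. Le (Meet (Var i) (Par d)) (Par c) \<in> p)"

text \<open>\<open>gap p i c L\<close>: the meet with \<open>c\<close> of the \<open>i\<close>-th variable fills the cut \<open>L\<close> of the chain below \<open>c\<close>.\<close>

definition gap :: "'a::dense_meet_tree fm set \<Rightarrow> nat \<Rightarrow> 'a \<Rightarrow> 'a set \<Rightarrow> bool" where
  "gap p i c L \<longleftrightarrow> (\<forall>l\<in>L. above p i l c) \<and> (\<forall>m. m \<le> c \<longrightarrow> m \<notin> L \<longrightarrow> m \<notin> cut p i)"

lemma rlzD: "rlz n p D a \<Longrightarrow> \<phi> \<in> formulas n D \<Longrightarrow> \<phi> \<in> p \<longleftrightarrow> sat a \<phi>"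
  by (simp add: rlz_def)

lemma rlz_mono: "rlz n p D a \<Longrightarrow> C \<subseteq> D \<Longrightarrow> rlz n p C a"
  using formulas_mono[of n n C D] by (auto simp: rlz_def)

lemma rlzI:
  assumes "p \<in> types n UNIV" "\<And>\<phi>. \<phi> \<in> p \<Longrightarrow> \<phi> \<in> formulas n D \<Longrightarrow> sat a \<phi>"
  shows "rlz n p D a"
  unfolding rlz_def
proof
  fix \<phi> assume "\<phi> \<in> formulas n D"
  then have "Neg \<phi> \<in> p \<longleftrightarrow> \<phi> \<notin> p" "Neg \<phi> \<in> formulas n D"
    using types_neg[OF assms(1), of \<phi>] by (auto simp: formulas_def)
  then show "\<phi> \<in> p \<longleftrightarrow> sat a \<phi>" using assms(2)[of \<phi>] assms(2)[of "Neg \<phi>"] \<open>\<phi> \<in> formulas n D\<close> by auto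
qed

lemma rlz_iff_restrict:
  assumes "p \<in> types n UNIV"
  shows "rlz n p D a \<longleftrightarrow> (\<forall>\<phi>\<in>restrict_type p D. sat a \<phi>)"
proof
  have "\<phi> \<in> formulas n UNIV" if "\<phi> \<in> p" for \<phi> using assms that by (auto simp: types_iff)
  then have f: "\<phi> \<in> formulas n D \<longleftrightarrow> params \<phi> \<subseteq> D" if "\<phi> \<in> p" for \<phi> using that by (auto simp: formulas_def)
  show "rlz n p D a \<Longrightarrow> \<forall>\<phi>\<in>restrict_type p D. sat a \<phi>" using f by (auto simp: rlz_def restrict_type_def)
  show "\<forall>\<phi>\<in>restrict_type p D. sat a \<phi> \<Longrightarrow> rlz n p D a"
    by (rule rlzI[OF assms]) (use f in \<open>auto simp: restrict_type_def\<close>)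
qed

lemma rlz_cong: "(\<And>i. i < n \<Longrightarrow> a i = b i) \<Longrightarrow> rlz n p D a \<Longrightarrow> rlz n p D b"
  unfolding rlz_def formulas_def using sat_cong[of _ a b] by (auto simp: subset_iff)

lemma rlz_automorphism: "\<sigma> \<in> automorphisms D \<Longrightarrow> rlz n p D a \<Longrightarrow> rlz n p D (\<lambda>i. \<sigma> (a i))"
  unfolding rlz_def formulas_def using sat_automorphism_fix[of \<sigma> D _ a] by auto

lemma rlz_transfer:
  "rlz n p D a \<Longrightarrow> (\<And>\<phi>. \<phi> \<in> formulas n D \<Longrightarrow> sat a \<phi> \<longleftrightarrow> sat b \<phi>) \<Longrightarrow> rlz n p D b"
  by (simp add: rlz_def)

context
  fixes n p D and a :: "nat \<Rightarrow> 'a::dense_meet_tree"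
  assumes r: "rlz n p D a"
begin

lemma rlz_cut: "i < n \<Longrightarrow> u \<in> D \<Longrightarrow> u \<in> cut p i \<longleftrightarrow> u \<le> a i"
  using rlzD[OF r, of "Le (Par u) (Var i)"] by (simp add: cut_def formulas_def)

lemma rlz_above: "i < n \<Longrightarrow> g \<in> D \<Longrightarrow> c \<in> D \<Longrightarrow> above p i g c \<longleftrightarrow> g < inf (a i) c"
  using rlzD[OF r, of "Less (Par g) (Meet (Var i) (Par c))"] by (simp add: above_def formulas_def)

lemma rlz_joined: "i < n \<Longrightarrow> j < n \<Longrightarrow> g \<in> D \<Longrightarrow> joined p g i j \<longleftrightarrow> g < inf (a i) (a j)"
  using rlzD[OF r, of "Less (Par g) (Meet (Var i) (Var j))"] by (simp add: joined_def formulas_def)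

lemma rlz_eq: "i < n \<Longrightarrow> g \<in> D \<Longrightarrow> Eq (Var i) (Par g) \<in> p \<longleftrightarrow> a i = g"
  using rlzD[OF r, of "Eq (Var i) (Par g)"] by (simp add: formulas_def)

lemma rlz_less: "i < n \<Longrightarrow> g \<in> D \<Longrightarrow> Less (Par g) (Var i) \<in> p \<longleftrightarrow> g < a i"
  using rlzD[OF r, of "Less (Par g) (Var i)"] by (simp add: formulas_def)

lemma rlz_meet_le:
  "i < n \<Longrightarrow> d \<in> D \<Longrightarrow> c \<in> D \<Longrightarrow> Le (Meet (Var i) (Par d)) (Par c) \<in> p \<longleftrightarrow> inf (a i) d \<le> c"
  using rlzD[OF r, of "Le (Meet (Var i) (Par d)) (Par c)"] by (simp add: formulas_def)

lemma rlz_anchor: "anchor p i c \<Longrightarrow> i < n \<Longrightarrow> d \<in> D \<Longrightarrow> c \<in> D \<Longrightarrow> inf (a i) d \<le> c"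
  using rlz_meet_le[of i d c] by (simp add: anchor_def)

lemma rlz_gap:
  assumes "gap p i c L" "i < n" "c \<in> D" "d \<in> D"
  shows "d \<in> L \<Longrightarrow> d < inf (a i) c" "d \<notin> L \<Longrightarrow> d \<le> c \<Longrightarrow> inf (a i) c < d"
proof -
  show "d \<in> L \<Longrightarrow> d < inf (a i) c" using assms rlz_above[of i d c] by (auto simp: gap_def)
  assume "d \<notin> L" "d \<le> c"
  then have "\<not> d \<le> a i" using assms rlz_cut[of i d] by (auto simp: gap_def)
  then show "inf (a i) c < d" using tree_not_le[of d c "inf (a i) c"] \<open>d \<le> c\<close> by auto
qed

end

text \<open>Of the three pairwise meets of \<open>b\<close>, \<open>c\<close> and \<open>d\<close>
  the two smaller ones coincide. If those with \<open>c\<close> differ, \<open>inf b d\<close> is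
  the smaller of them.\<close>

lemma inf_le_of_ne:
  fixes b c d :: "'a::dense_meet_tree"
  assumes "inf d c \<noteq> inf b c"
  shows "inf b d \<le> c"
proof -
  have "inf d c \<le> inf b c \<or> inf b c \<le> inf d c" by (rule tree_linear[of _ c]) simp_all
  then consider "\<not> inf b c \<le> inf d c" | "\<not> inf d c \<le> inf b c" using assms by (auto simp: order.eq_iff)
  then show ?thesis
  proof cases
    case 1
    have "inf b d \<le> inf b c \<or> inf b c \<le> inf b d" by (rule tree_linear[of _ b]) simp_all
    then show ?thesis using 1 by auto
  next
    case 2
    have "inf b d \<le> inf d c \<or> inf d c \<le> inf b d" by (rule tree_linear[of _ d]) simp_all
    then show ?thesis using 2 by auto
  qed
qed

text \<open>The choice of the representative \<open>A\<close> or \<open>c\<close> does not matter: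
  all chains of a class have the same lower bounds, and by \<open>above_mono\<close> one element of
  a cone may be replaced by another.\<close>

fun at :: "'a::dense_meet_tree fm set \<Rightarrow> nat \<Rightarrow> 'a point \<Rightarrow> bool" where
  "at p i (Chain_pt K) \<longleftrightarrow> (\<exists>A\<in>K. cut p i = {b. \<forall>a\<in>A. b < a})"
| "at p i (Cut_pt C) \<longleftrightarrow> cut p i = C"
| "at p i (Cone_pt g C) \<longleftrightarrow> cut p i = {..g} \<and> (\<exists>c\<in>C. above p i g c)"

lemma open_cones_member:
  fixes g :: "'a::dense_meet_tree"
  assumes "C \<in> open_cones g"
  shows "\<exists>c\<in>C. \<forall>x. x \<in> C \<longleftrightarrow> g < inf c x"
proof -
  obtain c where c: "g < c" "C = {(x, y). g < x \<and> g < y \<and> g < inf x y} `` {c}"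
    using assms unfolding open_cones_def by (auto elim!: quotientE)
  moreover have "g < x" if "g < inf c x" for x using that by (rule less_le_trans) simp
  ultimately show ?thesis by (intro bexI[of _ c]) auto
qed

lemma open_cone_of:
  fixes g :: "'a::dense_meet_tree"
  assumes "g < c"
  shows "{x. g < inf c x} \<in> open_cones g"
proof -
  have "{x. g < inf c x} = {(x, y). g < x \<and> g < y \<and> g < inf x y} `` {c}"
    using assms by (auto intro: less_le_trans)
  moreover have "{(x, y). g < x \<and> g < y \<and> g < inf x y} `` {c} \<in> open_cones g"
    unfolding open_cones_def by (rule quotientI) (simp add: assms)
  ultimately show ?thesis by simp
qed

lemma inf_greater_trans:
  fixes g x y z :: "'a::dense_meet_tree"
  assumes "g < inf x y" "g < inf y z"
  shows "g < inf x z"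
proof -
  have "\<not> inf (inf y x) z \<le> g"
    unfolding inf3_le using assms by (auto simp: inf.commute less_le_not_le)
  then have "\<not> inf x z \<le> g" by (metis inf.assoc le_infI2)
  moreover have "g \<le> x" using assms(1) by (meson inf.cobounded1 less_le_trans less_imp_le)
  ultimately show ?thesis using new_above[of g x z] by auto
qed

context monster
begin

lemma ex_rlz:
  fixes p :: "'a fm set"
  assumes "p \<in> types n UNIV" "small D"
  shows "\<exists>a. rlz n p D a"
proof -
  have "fin_sat (p \<inter> formulas n D)"
    using fin_sat_mono[OF _ Int_lower1, of p] assms(1) by (simp add: types_iff)
  then obtain a where "\<forall>\<phi>\<in>p \<inter> formulas n D. sat a \<phi>" using realise[OF assms(2)] by blast
  then show ?thesis using rlzI[OF assms(1)] by blast
qed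

text \<open>A tuple realises \<open>p\<close> over \<open>D\<close> as soon as it realises \<open>p\<close> over a set containing an anchor for
  each variable, and its cuts and cones over \<open>D\<close> are those prescribed by \<open>p\<close>.\<close>

lemma rlz_extend:
  fixes p :: "'a fm set"
  assumes p: "p \<in> types n UNIV" and D: "small D" "\<And>x y. x \<in> D \<Longrightarrow> y \<in> D \<Longrightarrow> inf x y \<in> D"
    and A: "A \<subseteq> D" "rlz n p A b"
    and anch: "\<And>i. i < n \<Longrightarrow> \<exists>c\<in>A. c \<in> cut p i \<and> anchor p i c \<and> (\<forall>d\<in>D. inf (b i) d \<le> c) \<or>
       (\<exists>L. gap p i c L \<and> (\<forall>d\<in>D \<inter> L. d < inf (b i) c) \<and> (\<forall>d\<in>D - L. d \<le> c \<longrightarrow> inf (b i) c < d))"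
  shows "rlz n p D b"
proof -
  \<comment> \<open>The given tuple is compared with a true realisation \<open>a\<close> over
    \<open>D\<close>: matching \<open>a\<close> with \<open>b\<close> and fixing \<open>D\<close> is
    a partial isomorphism, so both satisfy the same formulas over \<open>D\<close>.\<close>
  obtain a where a: "rlz n p D a" using ex_rlz[OF p D(1)] by blast
  have Aa: "rlz n p A a" using rlz_mono[OF a A(1)] .
  have pA: "piso (Id_on A \<union> tuple_rel n a b)"
    by (rule piso_tuple_rel) (use rlzD[OF Aa] rlzD[OF A(2)] in blast)
  have icD: "inf_closed_rel (Id_on D)" using D(2) by (auto simp: inf_closed_rel_def Id_on_iff)
  have AD: "Id_on A \<subseteq> Id_on D" using A(1) by auto
  have "piso (Id_on D \<union> tuple_rel n a b)"
  proof (rule piso_Un[OF piso_Id_on icD AD pA])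
    fix x x' assume "(x, x') \<in> tuple_rel n a b"
    then obtain i where i: "i < n" "x = a i" "x' = b i" by (auto simp: tuple_rel_def)
    obtain c where c: "c \<in> A" "c \<in> cut p i \<and> anchor p i c \<and> (\<forall>d\<in>D. inf (b i) d \<le> c) \<or>
       (\<exists>L. gap p i c L \<and> (\<forall>d\<in>D \<inter> L. d < inf (b i) c) \<and> (\<forall>d\<in>D - L. d \<le> c \<longrightarrow> inf (b i) c < d))"
      using anch[OF i(1)] by blast
    have cD: "c \<in> D" using c A(1) by blast
    have "inf (a i) d \<le> c \<and> inf (b i) d \<le> c \<and>
      (d \<le> c \<longrightarrow> (d \<le> a i \<longleftrightarrow> d \<le> b i) \<and> (inf (a i) c \<le> d \<longleftrightarrow> inf (b i) c \<le> d))" if d: "d \<in> D" for d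
      using c(2)
    proof (elim disjE exE conjE)
      assume *: "c \<in> cut p i" "anchor p i c" "\<forall>d\<in>D. inf (b i) d \<le> c"
      have "c \<le> a i" "c \<le> b i" using *(1) rlz_cut[OF Aa i(1) c(1)] rlz_cut[OF A(2) i(1) c(1)] by auto
      then show ?thesis using * d rlz_anchor[OF a _ i(1) d cD] by (auto simp: inf_absorb2)
    next
      fix L assume *: "gap p i c L" "\<forall>d\<in>D \<inter> L. d < inf (b i) c" "\<forall>d\<in>D - L. d \<le> c \<longrightarrow> inf (b i) c < d"
      have ga: "d \<in> L \<Longrightarrow> d < inf (a i) c" "d \<notin> L \<Longrightarrow> d \<le> c \<Longrightarrow> inf (a i) c < d" if "d \<in> D" for d
        using rlz_gap[OF a *(1) i(1) cD that] by blast+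
      \<comment> \<open>The point \<open>inf d c\<close> belongs to \<open>D\<close> and lies below
        \<open>c\<close>, so it is strictly on one side of the gap and differs from the meets of
        \<open>a i\<close> and \<open>b i\<close> with \<open>c\<close>.\<close>
      have "inf d c \<in> D" using D(2) d cD by blast
      moreover have "inf d c \<le> c" by simp
      ultimately have "inf d c \<noteq> inf (a i) c" "inf d c \<noteq> inf (b i) c"
        using *(2,3) ga[of "inf d c"] by (metis DiffI IntI less_irrefl)+
      then have 1: "inf (a i) d \<le> c" "inf (b i) d \<le> c" using inf_le_of_ne by blast+
      have "(d \<le> a i \<longleftrightarrow> d \<le> b i) \<and> (inf (a i) c \<le> d \<longleftrightarrow> inf (b i) c \<le> d)" if "d \<le> c"
      proof (cases "d \<in> L")
        case True
        then have "d < inf (a i) c" "d < inf (b i) c" using ga(1) *(2) d by auto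
        then show ?thesis by (auto simp: less_le_not_le)
      next
        case False
        then have "inf (a i) c < d" "inf (b i) c < d" using ga(2) *(3) d that by auto
        then show ?thesis using that by (auto simp: less_le_not_le)
      qed
      then show ?thesis using 1 by blast
    qed
    then show "\<exists>c c'. (c, c') \<in> Id_on A \<and> (\<forall>d d'. (d, d') \<in> Id_on D \<longrightarrow> inf x d \<le> c \<and> inf x' d' \<le> c') \<and>
       (\<forall>d d'. (d, d') \<in> Id_on D \<longrightarrow> d \<le> c \<longrightarrow> (d \<le> x \<longleftrightarrow> d' \<le> x') \<and> (inf x c \<le> d \<longleftrightarrow> inf x' c' \<le> d'))"
      using i c(1) by (intro exI[of _ c]) (auto simp: Id_on_iff)
  qed
  from sat_tuple_rel[OF this] show ?thesis using rlz_transfer[OF a] by blast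
qed

section \<open>Cuts of a variable\<close>

lemma cut_down:
  assumes "p \<in> types n (UNIV :: 'a set)" "i < n" "u \<in> cut p i" "v \<le> u"
  shows "v \<in> cut p i"
proof -
  obtain a where "rlz n p {u, v} a" using ex_rlz[OF assms(1), of "{u, v}"] by auto
  then show ?thesis using rlz_cut[of n p "{u, v}" a i] assms by (auto intro: order_trans)
qed

lemma cut_chain:
  assumes "p \<in> types n (UNIV :: 'a set)" "i < n" "u \<in> cut p i" "v \<in> cut p i"
  shows "u \<le> v \<or> v \<le> u"
proof -
  obtain a where "rlz n p {u, v} a" using ex_rlz[OF assms(1), of "{u, v}"] by auto
  then show ?thesis using rlz_cut[of n p "{u, v}" a i] assms tree_linear[of u "a i" v] by auto
qed

lemma above_mono:
  assumes "p \<in> types n (UNIV :: 'a set)" "i < n" "above p i g c" "g' \<le> g"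
  shows "above p i g' c" "g < inf c c' \<Longrightarrow> above p i g c'" "g \<in> cut p i" "g < c"
proof -
  obtain a where a: "rlz n p {g, g', c, c'} a" using ex_rlz[OF assms(1), of "{g, g', c, c'}"] by auto
  have g: "g < inf (a i) c" using rlz_above[OF a, of i g c] assms by auto
  show "above p i g' c" using rlz_above[OF a, of i g' c] assms g by (auto intro: le_less_trans)
  show "g \<in> cut p i" using rlz_cut[OF a, of i g] assms g by (auto simp: less_le_not_le)
  show "g < c" using g by (rule less_le_trans) simp
  show "above p i g c'" if "g < inf c c'"
    using rlz_above[OF a, of i g c'] assms inf_greater_trans[OF g that] by auto
qed

text \<open>A gap mentions only the chain below \<open>c\<close>, yet it fixes the whole cut: if
  \<open>u\<close> is in the cut, \<open>inf u c\<close> is in \<open>L\<close> and hence strictly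
  below the meet of the variable with \<open>c\<close>, which forces \<open>u\<close> itself below
  that meet.\<close>

lemma gap_iff:
  assumes p: "p \<in> types n (UNIV :: 'a set)" "i < n"
    and L: "\<And>l u. l \<in> L \<Longrightarrow> u \<le> l \<Longrightarrow> u \<in> L" "\<And>l. l \<in> L \<Longrightarrow> l < c"
  shows "gap p i c L \<longleftrightarrow> cut p i = L \<and> (\<forall>l\<in>L. above p i l c)"
proof
  assume g: "gap p i c L"
  have "u \<in> L" if "u \<in> cut p i" for u
  proof -
    obtain a where a: "rlz n p {u, c, inf u c} a" using ex_rlz[OF p(1), of "{u, c, inf u c}"] by auto
    have u: "u \<le> a i" using rlz_cut[OF a p(2)] that by auto
    have "inf u c \<in> cut p i" using cut_down[OF p that] by simp
    then have uL: "inf u c \<in> L" using g inf_le2[of u c] unfolding gap_def by blast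
    then have "inf u c < inf (a i) c" using rlz_gap(1)[OF a g p(2)] by auto
    then have "\<not> inf (a i) c \<le> u" by (auto simp: less_le_not_le)
    then have "u \<le> inf (a i) c" using tree_linear[OF u, of "inf (a i) c"] by auto
    then have "inf u c = u" by (simp add: inf_absorb1)
    then show "u \<in> L" using uL by simp
  qed
  moreover have "L \<subseteq> cut p i" using g above_mono(3)[OF p _ order_refl] by (auto simp: gap_def)
  ultimately show "cut p i = L \<and> (\<forall>l\<in>L. above p i l c)" using g by (auto simp: gap_def)
qed (auto simp: gap_def)

text \<open>A larger element of the cut lies below both the variable and \<open>c\<close>.\<close>

lemma above_of_no_max:
  assumes p: "p \<in> types n (UNIV :: 'a set)" "i < n" and m: "\<not> has_max (cut p i)"
    and l: "l \<in> cut p i" "\<And>l. l \<in> cut p i \<Longrightarrow> l \<le> c"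
  shows "above p i l c"
proof -
  obtain l' where l': "l' \<in> cut p i" "\<not> l' \<le> l" using m l(1) by (auto simp: has_max_def)
  then have "l < l'" using cut_chain[OF p l(1), of l'] by (auto simp: less_le_not_le)
  obtain a where a: "rlz n p {l, l', c} a" using ex_rlz[OF p(1), of "{l, l', c}"] by auto
  have "l' \<le> inf (a i) c" using rlz_cut[OF a p(2)] l' l(2)[of l'] by auto
  with \<open>l < l'\<close> have "l < inf (a i) c" by (rule less_le_trans)
  then show ?thesis using rlz_above[OF a p(2)] by auto
qed

section \<open>Cofinality and coinitiality of cuts\<close>

definition small_cofinal :: "'a set \<Rightarrow> bool" where
  "small_cofinal L \<longleftrightarrow> (\<exists>B\<subseteq>L. small B \<and> (\<forall>l\<in>L. \<exists>b\<in>B. l \<le> b))"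

definition small_coinitial :: "'a set \<Rightarrow> bool" where
  "small_coinitial M \<longleftrightarrow> (\<exists>B\<subseteq>M. small B \<and> (\<forall>m\<in>M. \<exists>b\<in>B. b \<le> m))"

lemma not_small_cofinal:
  assumes "\<not> small_cofinal L" "small B" "B \<subseteq> L" "\<And>l. l \<in> L \<Longrightarrow> l \<le> c"
  shows "\<exists>l\<in>L. \<forall>b\<in>B. b < l"
proof -
  obtain l where l: "l \<in> L" "\<forall>b\<in>B. \<not> l \<le> b" using assms(1-3) by (auto simp: small_cofinal_def)
  have "b < l" if "b \<in> B" for b using that l assms(3,4) tree_not_le[of l c b] by blast
  then show ?thesis using l(1) by blast
qed

lemma not_small_coinitial:
  assumes "\<not> small_coinitial M" "small B" "B \<subseteq> M" "\<And>l. l \<in> M \<Longrightarrow> l \<le> c"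
  shows "\<exists>l\<in>M. \<forall>b\<in>B. l < b"
proof -
  obtain l where l: "l \<in> M" "\<forall>b\<in>B. \<not> b \<le> l" using assms(1-3) by (auto simp: small_coinitial_def)
  have "l < b" if "b \<in> B" for b using that l assms(3,4) tree_not_le[of b c l] by blast
  then show ?thesis using l(1) by blast
qed

text \<open>By saturation a cut of the chain below \<open>c\<close> is approached from at most one side by a small set;
  this is what makes types filling it invariant.\<close>

definition one_sided :: "'a \<Rightarrow> 'a set \<Rightarrow> bool" where
  "one_sided c L \<longleftrightarrow> (\<forall>l\<in>L. l < c) \<and> (\<forall>l\<in>L. \<forall>u\<le>l. u \<in> L) \<and>
     (small_cofinal L \<and> \<not> small_coinitial ({..c} - L) \<or> \<not> small_cofinal L \<and> small_coinitial ({..c} - L))"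

lemma has_max_small_cofinal: "has_max L \<Longrightarrow> small_cofinal L"
  unfolding has_max_def small_cofinal_def
proof (elim bexE)
  fix m assume "m \<in> L" "\<forall>a\<in>L. a \<le> m"
  then show "\<exists>B\<subseteq>L. small B \<and> (\<forall>l\<in>L. \<exists>b\<in>B. l \<le> b)" by (intro exI[of _ "{m}"]) auto
qed

lemma has_max_atMost [simp]: "has_max {..g :: 'a}"
  by (auto simp: has_max_def)

text \<open>If the other side were small too, \<open>ex_between\<close> would produce a point of the
  chain below \<open>c\<close> strictly between both sides, belonging to neither.\<close>

lemma one_sidedI_cofinal:
  assumes "small_cofinal L" "\<And>l. l \<in> L \<Longrightarrow> l < c" "\<And>l u. l \<in> L \<Longrightarrow> u \<le> l \<Longrightarrow> u \<in> L"
    "\<not> has_max L \<or> (\<exists>g. L = {..g})"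
  shows "one_sided c L"
proof -
  obtain B where B: "B \<subseteq> L" "small B" "\<forall>l\<in>L. \<exists>b\<in>B. l \<le> b"
    using assms(1) by (auto simp: small_cofinal_def)
  have "\<not> small_coinitial ({..c} - L)"
  proof
    assume "small_coinitial ({..c} - L)"
    then obtain M where M: "M \<subseteq> {..c} - L" "small M" "\<forall>m\<in>{..c} - L. \<exists>b\<in>M. b \<le> m"
      by (auto simp: small_coinitial_def)
    have "c \<in> {..c} - L" using assms(2) by auto
    then have "M \<noteq> {}" using M(3) by blast
    moreover have "b < m" if "b \<in> B" "m \<in> M" for b m

    proof -
      have "m \<le> c" "b \<le> c" "\<not> m \<le> b" using that B(1) M(1) assms(2)[of b] assms(3)[of b m] by auto
      then show ?thesis using tree_not_le[of m c b] by blast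
    qed
    moreover have "b \<le> c" if "b \<in> B" for b using that B(1) assms(2) by (auto simp: less_imp_le)
    ultimately obtain z where z: "\<forall>b\<in>B. b < z" "\<forall>m\<in>M. z < m"
      using ex_between[of B M c] B(2) M by blast
    then have "z \<notin> L" using B(3) by (meson leD)
    moreover obtain m where "m \<in> M" "m \<le> c" using \<open>M \<noteq> {}\<close> M(1) by auto
    then have "z \<le> c" using z(2) by (meson less_imp_le order_trans)
    ultimately show False using M(3) z(2) by (meson DiffI atMost_iff leD)
  qed
  then show ?thesis using assms by (auto simp: one_sided_def)
qed

lemma cut_with_max:
  assumes "p \<in> types n (UNIV :: 'a set)" "i < n" "has_max (cut p i)"
  shows "\<exists>g. cut p i = {..g}"
  using assms(3) cut_down[OF assms(1,2)] by (auto simp: has_max_def)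

end

section \<open>Points\<close>

text \<open>The cut of the types of kind (Ia) over \<open>A\<close>, see
  \<open>kind_Ia_cut\<close>.\<close>

definition lowers :: "'a::order set \<Rightarrow> 'a set" where
  "lowers A = {b. \<forall>a\<in>A. b < a}"

lemma type_cut_eq: "type_cut p = cut p 0"
  by (simp add: type_cut_def cut_def)

context monster
begin

lemma small_cofinal_cuts_iff:
  "C \<in> small_cofinal_cuts \<kappa> \<longleftrightarrow>
     (\<exists>p\<in>types 1 (UNIV :: 'a set). C = cut p 0) \<and> \<not> has_max C \<and> small_cofinal C"
  by (simp add: small_cofinal_cuts_def small_cofinal_def type_cut_eq)

lemma small_coinitial_chainsE:
  fixes A :: "'a set"
  assumes "A \<in> small_coinitial_chains \<kappa>"
  obtains B c where "c \<in> A" "B \<subseteq> A" "small B" "\<And>a. a \<in> A \<Longrightarrow> \<exists>b\<in>B. b \<le> a"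
    "\<And>a b. a \<in> A \<Longrightarrow> b \<in> A \<Longrightarrow> a \<le> b \<or> b \<le> a"
  using assms unfolding small_coinitial_chains_def Complete_Partial_Order.chain_def by blast

lemma equiv_mutually_coinitial:
  "equiv (small_coinitial_chains \<kappa>) (mutually_coinitial \<kappa> :: 'a set rel)"
proof (rule equivI)
  show "trans (mutually_coinitial \<kappa> :: 'a set rel)"
    by (rule transI) (auto simp: mutually_coinitial_def; meson order_trans)
qed (auto simp: mutually_coinitial_def refl_on_def sym_on_def)

text \<open>A point between a small cofinal set of lower bounds and a small coinitial part of
  \<open>A\<close> would be a lower bound that is larger than all others. Restricting to the
  elements below \<open>c\<close> provides the common upper bound for
  \<open>ex_between\<close>.\<close>

lemma lowers_not_small_cofinal:
  fixes A :: "'a set"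
  assumes "A \<in> small_coinitial_chains \<kappa>"
  shows "\<not> small_cofinal (lowers A)"
proof
  assume "small_cofinal (lowers A)"
  then obtain S where S: "S \<subseteq> lowers A" "small S" "\<forall>l\<in>lowers A. \<exists>b\<in>S. l \<le> b"
    by (auto simp: small_cofinal_def)
  obtain B c where B: "c \<in> A" "B \<subseteq> A" "small B" "\<And>a. a \<in> A \<Longrightarrow> \<exists>b\<in>B. b \<le> a"
    "\<And>a b. a \<in> A \<Longrightarrow> b \<in> A \<Longrightarrow> a \<le> b \<or> b \<le> a"
    by (rule small_coinitial_chainsE[OF assms]) blast
  obtain b0 where b0: "b0 \<in> B" "b0 \<le> c" using B by blast
  have "\<exists>z. (\<forall>l\<in>S. l < z) \<and> (\<forall>m\<in>B \<inter> {..c}. z < m)"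
    by (rule ex_between[where c = c])
      (use S(1,2) B(1-3) b0 small_subset[of B] in \<open>auto simp: lowers_def less_imp_le\<close>)
  then obtain z where z: "\<forall>l\<in>S. l < z" "\<forall>m\<in>B \<inter> {..c}. z < m" by blast
  have "z < a" if "a \<in> A" for a
  proof -
    obtain b where "b \<in> B" "b \<le> a" using B(4) \<open>a \<in> A\<close> by blast
    moreover have "c \<le> a \<or> a \<le> c" using B(5)[OF B(1) that] .
    ultimately show ?thesis using z(2) b0 by (meson IntI atMost_iff less_le_trans order_trans)
  qed
  then have "z \<in> lowers A" by (simp add: lowers_def)
  then show False using S(3) z(1) by (meson leD)
qed

lemma lowers_one_sided:
  fixes A :: "'a set"
  assumes A: "A \<in> small_coinitial_chains \<kappa>" and c: "c \<in> A"
  shows "one_sided c (lowers A)"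
proof -
  obtain B c' where B: "B \<subseteq> A" "small B" "\<And>a. a \<in> A \<Longrightarrow> \<exists>b\<in>B. b \<le> a"
    "\<And>a b. a \<in> A \<Longrightarrow> b \<in> A \<Longrightarrow> a \<le> b \<or> b \<le> a"
    by (rule small_coinitial_chainsE[OF A]) blast
  have "\<exists>b\<in>B \<inter> {..c}. b \<le> m" if m: "m \<le> c" "m \<notin> lowers A" for m
  proof -
    obtain a where a: "a \<in> A" "\<not> m < a" using m(2) by (auto simp: lowers_def)
    have "a \<le> m"
      using B(4)[OF a(1) c]
    proof
      assume "a \<le> c"
      then show ?thesis using tree_linear[OF \<open>a \<le> c\<close> m(1)] a(2) by (auto simp: less_le_not_le)
    next
      assume "c \<le> a"
      then show ?thesis using m(1) a(2) by (auto simp: less_le_not_le)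
    qed
    then show ?thesis using B(3)[OF a(1)] m(1) by (meson IntI atMost_iff order_trans)
  qed
  moreover have "B \<inter> {..c} \<subseteq> {..c} - lowers A" using B(1) by (auto simp: lowers_def)
  moreover have "small (B \<inter> {..c})" using B(2) small_subset by blast
  ultimately have "small_coinitial ({..c} - lowers A)"
    unfolding small_coinitial_def by (intro exI[of _ "B \<inter> {..c}"]) auto
  then show ?thesis
    using lowers_not_small_cofinal[OF A] c by (auto simp: one_sided_def lowers_def intro: le_less_trans)
qed

lemma lowers_eq:
  fixes A :: "'a set"
  assumes "(A, A') \<in> mutually_coinitial \<kappa>"
  shows "lowers A = lowers A'"
  using assms unfolding mutually_coinitial_def lowers_def by (auto; meson less_le_trans)

text \<open>Elements of \<open>A\<close> and \<open>A'\<close> need not be comparable, so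
  \<open>a\<close> is met with some \<open>a0\<close> of \<open>A'\<close>. The meet
  \<open>m\<close> bounds all common lower bounds and cannot be one itself, since a maximum would
  make them small cofinal; hence \<open>A'\<close> has an element below \<open>m\<close>.\<close>

lemma coinitial_if_lowers_eq:
  fixes A A' :: "'a set"
  assumes A: "A \<in> small_coinitial_chains \<kappa>" "A' \<in> small_coinitial_chains \<kappa>" "lowers A = lowers A'"
    and a: "a \<in> A"
  shows "\<exists>a'\<in>A'. a' \<le> a"
proof -
  have ch: "\<And>a b. a \<in> A \<Longrightarrow> b \<in> A \<Longrightarrow> a \<le> b \<or> b \<le> a" "\<And>a b. a \<in> A' \<Longrightarrow> b \<in> A' \<Longrightarrow> a \<le> b \<or> b \<le> a"
    using A(1,2) unfolding small_coinitial_chains_def Complete_Partial_Order.chain_def by blast+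
  obtain a0 where a0: "a0 \<in> A'" using A(2) by (auto simp: small_coinitial_chains_def)
  define m where "m = inf a a0"
  have "m \<notin> lowers A"
  proof
    assume "m \<in> lowers A"
    moreover have "l \<le> m" if "l \<in> lowers A" for l
    proof -
      have "l < a" using that a by (simp add: lowers_def)
      moreover have "l < a0" using that a0 unfolding A(3) by (simp add: lowers_def)
      ultimately show ?thesis by (simp add: m_def less_imp_le)
    qed
    ultimately have "has_max (lowers A)" by (auto simp: has_max_def)
    then show False using has_max_small_cofinal lowers_not_small_cofinal[OF A(1)] by blast
  qed
  then obtain a1 where a1: "a1 \<in> A'" "\<not> m < a1" using A(3) by (auto simp: lowers_def)
  have "a1 \<le> m"
    using ch(2)[OF a1(1) a0]
  proof
    assume "a1 \<le> a0"
    then show ?thesis using tree_linear[OF \<open>a1 \<le> a0\<close>, of m] a1(2) unfolding m_def by (auto simp: less_le_not_le)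
  next
    assume "a0 \<le> a1"
    then have "m \<le> a1" unfolding m_def by (auto intro: le_infI2)
    then show ?thesis using a1(2) by (auto simp: less_le_not_le)
  qed
  then show ?thesis using a1(1) unfolding m_def by auto
qed

lemma lowers_inject:
  fixes K K' :: "'a set set"
  assumes "K \<in> chain_classes \<kappa>" "K' \<in> chain_classes \<kappa>" "A \<in> K" "A' \<in> K'" "lowers A = lowers A'"
  shows "K = K'"
proof -
  have "A \<in> small_coinitial_chains \<kappa>" "A' \<in> small_coinitial_chains \<kappa>"
    using assms(1-4) in_quotient_imp_subset[OF equiv_mutually_coinitial] unfolding chain_classes_def by blast+
  then have "(A, A') \<in> mutually_coinitial \<kappa>"
    using coinitial_if_lowers_eq[of A A'] coinitial_if_lowers_eq[of A' A] assms(5)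
    by (auto simp: mutually_coinitial_def)
  then show ?thesis
    using quotient_eq_iff[OF equiv_mutually_coinitial] assms(1-4) unfolding chain_classes_def by blast
qed

lemma chain_class_member:
  fixes K :: "'a set set"
  assumes "K \<in> chain_classes \<kappa>"
  shows "\<exists>A. A \<in> K" "A \<in> K \<Longrightarrow> A \<in> small_coinitial_chains \<kappa>"
    "A \<in> K \<Longrightarrow> A' \<in> K \<Longrightarrow> lowers A = lowers A'"
proof -
  show "\<exists>A. A \<in> K"
    using assms in_quotient_imp_non_empty[OF equiv_mutually_coinitial] unfolding chain_classes_def by blast
  show "A \<in> K \<Longrightarrow> A \<in> small_coinitial_chains \<kappa>"
    using assms in_quotient_imp_subset[OF equiv_mutually_coinitial] unfolding chain_classes_def by blast
  show "A \<in> K \<Longrightarrow> A' \<in> K \<Longrightarrow> lowers A = lowers A'"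
    using assms quotient_eqI[OF equiv_mutually_coinitial] lowers_eq
    unfolding chain_classes_def by (meson equiv_mutually_coinitial in_quotient_imp_in_rel bot.extremum insert_subset)
qed

lemma points_cases:
  assumes "pt \<in> points \<kappa>"
  obtains K where "pt = Chain_pt K" "K \<in> chain_classes \<kappa>"
  | C where "pt = Cut_pt C" "C \<in> small_cofinal_cuts \<kappa>"
  | g C where "pt = Cone_pt g C" "C \<in> open_cones g"
  using assms unfolding points_def by blast

lemma at_chain_iff:
  fixes K :: "'a set set"
  assumes "K \<in> chain_classes \<kappa>" "A \<in> K"
  shows "at p i (Chain_pt K) \<longleftrightarrow> cut p i = lowers A"
proof
  assume "at p i (Chain_pt K)"
  then obtain A' where "A' \<in> K" "cut p i = lowers A'" by (auto simp: lowers_def)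
  then show "cut p i = lowers A" using chain_class_member(3)[OF assms(1,2), of A'] by simp
next
  assume "cut p i = lowers A"
  then show "at p i (Chain_pt K)" using assms(2) by (auto simp: lowers_def)
qed

text \<open>One description for the three sorts of points, on which the arguments about domination
  rest. The element \<open>c\<close> comes from the chain, from above the cut, or from the open
  cone; in the last case \<open>L\<close> is \<open>{..g}\<close>.\<close>

lemma point_one_sided:
  fixes pt :: "'a point"
  assumes "pt \<in> points \<kappa>"
  shows "\<exists>c L. one_sided c L \<and> (\<forall>n p i. p \<in> types n UNIV \<longrightarrow> i < n \<longrightarrow> (at p i pt \<longleftrightarrow> gap p i c L))"
proof -
  have os: "gap p i c L \<longleftrightarrow> cut p i = L \<and> (\<forall>l\<in>L. above p i l c)"
    if "one_sided c L" "p \<in> types n UNIV" "i < n" for c L n p i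
    by (rule gap_iff[OF that(2,3)]) (use that(1) in \<open>auto simp: one_sided_def\<close>)
  have nm: "gap p i c L \<longleftrightarrow> cut p i = L"
    if "one_sided c L" "\<not> has_max L" "p \<in> types n UNIV" "i < n" for c L n p i
  proof -
    have "above p i l c" if "cut p i = L" "l \<in> L" for l
      using above_of_no_max[OF \<open>p \<in> types n UNIV\<close> \<open>i < n\<close>] that \<open>\<not> has_max L\<close> \<open>one_sided c L\<close>
      by (auto simp: one_sided_def less_imp_le)
    then show ?thesis using os[OF that(1,3,4)] by blast
  qed
  from assms show ?thesis
  proof (cases rule: points_cases)
    case (1 K)
    obtain A where A: "A \<in> K" "A \<in> small_coinitial_chains \<kappa>" using chain_class_member[OF 1(2)] by blast
    obtain c where c: "c \<in> A" using A(2) by (auto simp: small_coinitial_chains_def)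
    have o: "one_sided c (lowers A)" and m: "\<not> has_max (lowers A)"
      using lowers_one_sided[OF A(2) c] lowers_not_small_cofinal[OF A(2)] has_max_small_cofinal by blast+
    have "at p i pt \<longleftrightarrow> gap p i c (lowers A)" if "p \<in> types n UNIV" "i < n" for n p i
      using nm[OF o m that] at_chain_iff[OF 1(2) A(1)] 1(1) by simp
    then show ?thesis using o by blast
  next
    case (2 C)
    obtain p where p: "p \<in> types 1 (UNIV :: 'a set)" "C = cut p 0" and C: "\<not> has_max C" "small_cofinal C"
      using 2(2) small_cofinal_cuts_iff by auto
    obtain B where B: "B \<subseteq> C" "small B" "\<forall>l\<in>C. \<exists>b\<in>B. l \<le> b" using C(2) by (auto simp: small_cofinal_def)
    \<comment> \<open>Realising \<open>p\<close> over a small cofinal set gives an upper bound of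
      all of \<open>C\<close>; it is strict because \<open>C\<close> has no maximum.\<close>
    obtain a where a: "rlz 1 p B a" using ex_rlz[OF p(1) B(2)] by blast
    have le: "l \<le> a 0" if "l \<in> C" for l
    proof -
      obtain b where "b \<in> B" "l \<le> b" using B(3) \<open>l \<in> C\<close> by blast
      then show ?thesis using rlz_cut[OF a, of 0 b] B(1) p(2) by (auto intro: order_trans)
    qed
    have "a 0 \<notin> C" using le C(1) by (auto simp: has_max_def)
    then have lt: "l < a 0" if "l \<in> C" for l using le[OF that] that by (auto simp: order.order_iff_strict)
    have "one_sided (a 0) C"
      by (rule one_sidedI_cofinal) (use C lt cut_down[OF p(1)] p(2) in auto)
    then show ?thesis
      using nm C(1) 2(1) by (intro exI[of _ "a 0"] exI[of _ C]) auto
  next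
    case (3 g C)
    obtain c where c: "c \<in> C" "\<forall>x. x \<in> C \<longleftrightarrow> g < inf c x" using open_cones_member[OF 3(2)] by blast
    have gc: "g < c" using c by auto
    have o: "one_sided c {..g}"
      by (rule one_sidedI_cofinal) (use gc has_max_small_cofinal[of "{..g}"] in \<open>auto intro: le_less_trans\<close>)
    have "at p i pt \<longleftrightarrow> gap p i c {..g}" if p: "p \<in> types n UNIV" "i < n" for n p i
    proof -
      have "above p i g c" if "c' \<in> C" "above p i g c'" for c'
      proof -
        have "g < inf c' c" using that(1) c(2) by (simp add: inf.commute)
        then show ?thesis
          using above_mono(2)[OF p that(2) order_refl, of c] by blast
      qed
      then have "(\<exists>c'\<in>C. above p i g c') \<longleftrightarrow> above p i g c" using c(1) by blast
      also have "\<dots> \<longleftrightarrow> (\<forall>l\<in>{..g}. above p i l c)"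
        using above_mono(1)[OF p] by (meson atMost_iff order_refl)
      finally show ?thesis unfolding os[OF o p] 3(1) at.simps by simp
    qed
    then show ?thesis using o by blast
  qed
qed

text \<open>The cut alone tells the sorts apart: not small cofinal for chains, small cofinal without
  maximum for cuts, with maximum for cones.\<close>

lemma at_unique:
  assumes "p \<in> types n (UNIV :: 'a set)" "i < n" "pt \<in> points \<kappa>" "pt' \<in> points \<kappa>" "at p i pt" "at p i pt'"
  shows "pt = pt'"
proof -
  have kind: "case pt of Chain_pt K \<Rightarrow> \<not> small_cofinal (cut p i) | Cut_pt C \<Rightarrow> small_cofinal (cut p i) \<and> \<not> has_max (cut p i)
     | Cone_pt g C \<Rightarrow> has_max (cut p i)" if "pt \<in> points \<kappa>" "at p i pt" for pt
    using that(1)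
  proof (cases rule: points_cases)
    case (1 K)
    then obtain A where "A \<in> K" "A \<in> small_coinitial_chains \<kappa>" using chain_class_member by blast
    then show ?thesis using 1 at_chain_iff[OF 1(2)] that(2) lowers_not_small_cofinal by auto
  next
    case (2 C)
    then show ?thesis using that(2) small_cofinal_cuts_iff by auto
  next
    case (3 g C)
    then show ?thesis using that(2) by auto
  qed
  from assms(3) show ?thesis
  proof (cases rule: points_cases)
    case (1 K)
    obtain K' where K': "pt' = Chain_pt K'" "K' \<in> chain_classes \<kappa>"
      using assms(4) by (cases rule: points_cases)
        (use kind[OF assms(3,5)] kind[OF assms(4,6)] 1 has_max_small_cofinal in auto)
    obtain A A' where "A \<in> K" "A' \<in> K'" using chain_class_member(1) K'(2) 1(2) by blast
    then show ?thesis
      using at_chain_iff[OF 1(2)] at_chain_iff[OF K'(2)] assms(5,6) 1 K' lowers_inject by metis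
  next
    case (2 C)
    from assms(4) show ?thesis
      by (cases rule: points_cases)
        (use 2 kind[OF assms(3,5)] kind[OF assms(4,6)] assms(5,6) has_max_small_cofinal in auto)
  next
    case (3 g C)
    obtain g' C' where C': "pt' = Cone_pt g' C'" "C' \<in> open_cones g'"
      using assms(4) by (cases rule: points_cases)
        (use kind[OF assms(3,5)] kind[OF assms(4,6)] 3 has_max_small_cofinal in auto)
    have "{..g} = {..g'}" using assms(5,6) 3 C' by auto
    then have g: "g' = g" by (metis atMost_eq_iff)
    obtain c c' where c: "c \<in> C" "above p i g c" "c' \<in> C'" "above p i g c'" using assms(5,6) 3 C' g by auto
    obtain a where a: "rlz n p {g, c, c'} a" using ex_rlz[OF assms(1), of "{g, c, c'}"] by auto
    have "g < inf c (a i)" "g < inf (a i) c'"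
      using rlz_above[OF a assms(2)] c by (auto simp: inf.commute)
    then have cc: "g < inf c c'" by (rule inf_greater_trans)
    obtain d where d: "\<forall>x. x \<in> C \<longleftrightarrow> g < inf d x" using open_cones_member[OF 3(2)] by blast
    obtain d' where d': "\<forall>x. x \<in> C' \<longleftrightarrow> g < inf d' x" using open_cones_member[OF C'(2)[unfolded g]] by blast
    have "g < inf d d'"
      using inf_greater_trans[OF inf_greater_trans[of g d c c'], of d'] cc c(1,3) d d' by (auto simp: inf.commute)
    then have "C = C'" using d d' inf_greater_trans[of g d d'] inf_greater_trans[of g d' d]
      by (auto simp: inf.commute)
    then show ?thesis using 3 C' g by simp
  qed
qed

section \<open>Variables of invariant types\<close>

lemma invariant_cut:
  assumes "invariant A p" "\<sigma> \<in> automorphisms A"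
  shows "\<sigma> u \<in> cut p i \<longleftrightarrow> u \<in> cut p i"
proof -
  have "Le (Par u) (Var i) \<in> p \<longleftrightarrow> map_fm \<sigma> (Le (Par u) (Var i)) \<in> p"
    using assms unfolding invariant_def by blast
  then show ?thesis by (simp add: cut_def)
qed

lemma new_automorphism1:
  fixes X :: "'a set"
  assumes "small X" "g \<in> X" "g < u" "g < v" "\<And>x. x \<in> X \<Longrightarrow> inf u x \<le> g" "\<And>x. x \<in> X \<Longrightarrow> inf v x \<le> g"
  shows "\<exists>\<tau>\<in>automorphisms X. \<tau> u = v"
  using new_automorphism[OF assms(1), of "{()}" "\<lambda>_. g" "\<lambda>_. u" "\<lambda>_. v"] assms by auto

text \<open>If both sides were large, there would be points \<open>l\<close> in the cut and
  \<open>m\<close> outside it that no meet of \<open>A\<close> with \<open>c\<close> separates, and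
  an automorphism over \<open>A\<close> would move \<open>l\<close> to \<open>m\<close>.\<close>

lemma invariant_gap:
  fixes p :: "'a fm set"
  assumes p: "p \<in> types n UNIV" "i < n" and A: "small A" "invariant A p"
    and c: "\<And>l. l \<in> cut p i \<Longrightarrow> l < c"
  shows "small_cofinal (cut p i) \<or> small_coinitial ({..c} - cut p i)"
proof (rule ccontr)
  let ?L = "cut p i" and ?P = "(\<lambda>a. inf a c) ` A"
  assume "\<not> ?thesis"
  then have no: "\<not> small_cofinal ?L" "\<not> small_coinitial ({..c} - ?L)" by auto
  have P: "small ?P" using A(1) small_image by blast
  obtain l where l: "l \<in> ?L" "\<forall>b\<in>?P \<inter> ?L. b < l"
    using not_small_cofinal[OF no(1), of "?P \<inter> ?L" c] small_subset[OF P] c by (auto simp: less_imp_le)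
  have "insert c (?P - ?L) \<subseteq> {..c} - ?L" using c by auto
  then obtain m where m: "m \<in> {..c} - ?L" "\<forall>b\<in>insert c (?P - ?L). m < b"
    using not_small_coinitial[OF no(2), of "insert c (?P - ?L)" c] small_subset[OF P] by auto
  have lm: "l < m" using tree_not_le[of m c l] m(1) l(1) c cut_down[OF p, of l m] by (auto simp: less_imp_le)
  have "\<exists>\<tau>\<in>automorphisms (insert c A). \<tau> l = m"
  proof (rule gap_automorphism[OF A(1)])
    fix x assume "x \<in> A"
    then show "inf x c < m \<and> inf x c < l \<or> m < inf x c \<and> l < inf x c"
      using l(2) m(2) lm by (cases "inf x c \<in> ?L") (auto intro: less_trans)
  qed (use c l m in auto)
  then obtain \<tau> where "\<tau> \<in> automorphisms A" "\<tau> l = m" using automorphisms_mono by blast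
  then show False using invariant_cut[OF A(2), of \<tau> l i] l(1) m(1) by auto
qed

text \<open>In an unbounded cut of large cofinality some \<open>l0\<close> has no element of
  \<open>A\<close> above it. An automorphism over \<open>A\<close> then moves a larger point
  \<open>l1\<close> of the cut into another open cone above \<open>l0\<close>, out of the
  chain.\<close>

lemma invariant_bounded:
  fixes p :: "'a fm set"
  assumes p: "p \<in> types n UNIV" "i < n" and A: "small A" "invariant A p"
    and no: "\<not> small_cofinal (cut p i)"
  shows "\<exists>c. \<forall>l\<in>cut p i. l < c"
proof (rule ccontr)
  let ?L = "cut p i"
  assume unb: "\<nexists>c. \<forall>l\<in>?L. l < c"
  have nm: "\<exists>l'\<in>?L. l < l'" if "l \<in> ?L" for l
    using has_max_small_cofinal no cut_chain[OF p that] that unfolding has_max_def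
    by (metis order.order_iff_strict)
  have "\<exists>l\<in>?L. \<not> l \<le> a" for a using unb nm by (meson order.strict_trans2)
  then obtain f where f: "\<And>a. f a \<in> ?L" "\<And>a. \<not> f a \<le> a" by metis
  have "small (f ` A)" using A(1) small_image by blast
  then obtain l0 where l0: "l0 \<in> ?L" "\<forall>a\<in>A. \<not> l0 \<le> f a"
    using no f(1) unfolding small_cofinal_def by (metis image_subsetI imageI)
  obtain l1 where l1: "l1 \<in> ?L" "l0 < l1" using nm l0(1) by blast
  obtain u where u: "l0 < u" "inf u l1 \<le> l0" using ex_new_cone[of "{l1}" l0] by auto
  have new: "inf v x \<le> l0" if "l0 < v" "x \<in> insert l0 A" for v x
  proof (rule ccontr)
    assume n: "\<not> inf v x \<le> l0"
    then have "x \<in> A" using that by auto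
    have "l0 < inf v x" using n new_above[of l0 v x] that(1) by auto
    then have "l0 \<le> x" by (rule less_imp_le[OF less_le_trans[OF _ inf_le2]])
    moreover have "f x \<le> l0" using l0 cut_chain[OF p l0(1) f(1), of x] \<open>x \<in> A\<close> by auto
    ultimately show False using f(2) order_trans by blast
  qed
  obtain \<tau> where "\<tau> \<in> automorphisms (insert l0 A)" "\<tau> l1 = u"
    using new_automorphism1[of "insert l0 A" l0 l1 u] A(1) l1(2) u(1) new by auto
  then have "\<tau> \<in> automorphisms A" "\<tau> l1 = u" using automorphisms_mono by blast+
  then have "u \<in> ?L" using invariant_cut[OF A(2), of \<tau> l1 i] l1(1) by auto
  then have "u \<le> l1 \<or> l1 \<le> u" using cut_chain[OF p _ l1(1)] by blast
  then show False using u l1(2) by (auto simp: inf_absorb1 inf_absorb2 less_le_not_le)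
qed

text \<open>If the cut has a maximum \<open>g\<close>, the variable enters an existing cone above
  \<open>g\<close>, or else \<open>g\<close> is an anchor. If not, the cut is small cofinal or, by
  \<open>invariant_bounded\<close> and \<open>invariant_gap\<close>, approached from above by a
  small set.\<close>

lemma invariant_variable_cases:
  fixes p :: "'a fm set"
  assumes p: "p \<in> types n UNIV" "i < n" and A: "small A" "invariant A p"
  shows "(\<exists>g\<in>cut p i. anchor p i g) \<or> (\<exists>pt\<in>points \<kappa>. at p i pt)"
proof (cases "has_max (cut p i)")
  case True
  then obtain g where g: "cut p i = {..g}" using cut_with_max[OF p] by blast
  show ?thesis
  proof (cases "\<exists>d. above p i g d")
    case True
    then obtain d where d: "above p i g d" by blast
    then have "g < d" using above_mono(4)[OF p d order_refl] by blast
    then have "Cone_pt g {x. g < inf d x} \<in> points \<kappa>" using open_cone_of[of g d] unfolding points_def by blast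
    moreover have "at p i (Cone_pt g {x. g < inf d x})" using g d \<open>g < d\<close> by (auto intro!: exI[of _ d])
    ultimately show ?thesis by blast
  next
    case False
    have "Le (Meet (Var i) (Par d)) (Par g) \<in> p" for d
    proof -
      obtain a where a: "rlz n p {g, d} a" using ex_rlz[OF p(1), of "{g, d}"] by auto
      have "g \<le> a i" "\<not> g < inf (a i) d" using rlz_cut[OF a p(2), of g] rlz_above[OF a p(2), of g d] g False by auto
      then show ?thesis using rlz_meet_le[OF a p(2), of d g] new_above by auto
    qed
    then show ?thesis using g by (auto simp: anchor_def)
  qed
next
  case False
  show ?thesis
  proof (cases "small_cofinal (cut p i)")
    case True
    have "cut p i \<in> small_cofinal_cuts \<kappa>"
    proof -
      \<comment> \<open>The type of the single variable \<open>i\<close>; points of the second sort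
        are defined through types in one variable.\<close>
      let ?q = "{\<phi> \<in> formulas 1 UNIV. fsubst (\<lambda>_. Var i) \<phi> \<in> p}"
      have f: "fsubst (\<lambda>_. Var i) \<phi> \<in> formulas n UNIV" for \<phi> :: "'a fm"
        using p(2) by (auto simp: formulas_def fvars_fsubst)
      have "fin_sat ?q"
        unfolding fin_sat_def
      proof (intro allI impI, elim conjE)
        fix F assume F: "finite F" "F \<subseteq> ?q"
        have "finite (fsubst (\<lambda>_. Var i) ` F)" "fsubst (\<lambda>_. Var i) ` F \<subseteq> p" using F by auto
        then obtain e where "\<forall>\<phi>\<in>fsubst (\<lambda>_. Var i) ` F. sat e \<phi>"
          using fin_satD[of p] p(1) unfolding types_iff by blast
        then show "\<exists>e. \<forall>\<phi>\<in>F. sat e \<phi>" by (intro exI[of _ "\<lambda>_. e i"]) (simp add: sat_fsubst)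
      qed
      moreover have "\<phi> \<in> ?q \<or> Neg \<phi> \<in> ?q" if "\<phi> \<in> formulas 1 UNIV" for \<phi>
        using that types_neg[OF p(1) f[of \<phi>]] by (auto simp: formulas_def)
      ultimately have "?q \<in> types 1 UNIV" unfolding types_iff by blast
      moreover have "cut p i = cut ?q 0" by (auto simp: cut_def formulas_def Le_def)
      ultimately show ?thesis using small_cofinal_cuts_iff False True by blast
    qed
    then have "Cut_pt (cut p i) \<in> points \<kappa>" by (simp add: points_def)
    then show ?thesis by (intro disjI2 bexI[of _ "Cut_pt (cut p i)"]) simp_all
  next
    case no: False
    then obtain c where c: "\<And>l. l \<in> cut p i \<Longrightarrow> l < c" using invariant_bounded[OF p A] by blast
    \<comment> \<open>The part of the chain below a bound \<open>c\<close> that lies outside the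
      cut; it represents the class of chains.\<close>
    let ?M = "{..c} - cut p i"
    have "small_coinitial ?M" using invariant_gap[OF p A c] no by blast
    moreover have "c \<in> ?M" using c by auto
    ultimately have M: "?M \<in> small_coinitial_chains \<kappa>"
      unfolding small_coinitial_chains_def small_coinitial_def Complete_Partial_Order.chain_def
      using tree_linear[of _ c] by auto
    have "cut p i = lowers ?M"
    proof
      have "l < m" if "l \<in> cut p i" "m \<le> c" "m \<notin> cut p i" for l m
        using tree_not_le[of m c l] that c[of l] cut_down[OF p that(1), of m] by (auto simp: less_imp_le)
      then show "cut p i \<subseteq> lowers ?M" by (auto simp: lowers_def)
      show "lowers ?M \<subseteq> cut p i"
      proof
        fix b assume b: "b \<in> lowers ?M"
        then have "b < c" using \<open>c \<in> ?M\<close> by (auto simp: lowers_def)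
        then show "b \<in> cut p i" using b by (auto simp: lowers_def less_imp_le)
      qed
    qed
    moreover let ?K = "mutually_coinitial \<kappa> `` {?M}"
    have "?K \<in> chain_classes \<kappa>" unfolding chain_classes_def using M by (rule quotientI)
    moreover have "?M \<in> ?K" using equiv_class_self[OF equiv_mutually_coinitial M] .
    ultimately have "Chain_pt ?K \<in> points \<kappa>" "at p i (Chain_pt ?K)"
      using at_chain_iff by (auto simp: points_def)
    then show ?thesis by blast
  qed
qed

end

section \<open>Invariants of domination\<close>

text \<open>The variables that lie in an open cone above \<open>g\<close> without elements of the
  model.\<close>

definition news :: "nat \<Rightarrow> 'a fm set \<Rightarrow> 'a \<Rightarrow> nat set" where
  "news n p g = {i. i < n \<and> g \<in> cut p i \<and> Eq (Var i) (Par g) \<notin> p \<and> anchor p i g}"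

definition cone_class :: "nat \<Rightarrow> 'a fm set \<Rightarrow> 'a \<Rightarrow> nat \<Rightarrow> nat set" where
  "cone_class n p g i = {j \<in> news n p g. joined p g i j}"

text \<open>A new open cone exists only in an extension, so it is coded by the set of variables
  lying in it. The number of these sets becomes the coefficient at \<open>g\<close>.\<close>

definition new_cones :: "nat \<Rightarrow> 'a fm set \<Rightarrow> 'a \<Rightarrow> nat set set" where
  "new_cones n p g = cone_class n p g ` news n p g"

definition join :: "nat \<Rightarrow> (nat \<Rightarrow> 'a) \<Rightarrow> (nat \<Rightarrow> 'a) \<Rightarrow> nat \<Rightarrow> 'a" where
  "join n a b = (\<lambda>i. if i < n then a i else b (i - n))"

lemma join_simps [simp]: "i < n \<Longrightarrow> join n a b i = a i" "join n a b (n + i) = b i"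
  "(\<lambda>i. join n a b (n + i)) = b"
  by (simp_all add: join_def)

lemma finite_news: "finite (news n p g)"
  by (simp add: news_def)

lemma finite_new_cones: "finite (new_cones n p g)"
  by (simp add: new_cones_def finite_news)

text \<open>On \<open>J\<close> the map \<open>h\<close> factors through \<open>f\<close>.\<close>

lemma card_image_le_of_factor:
  assumes "finite J" "\<And>j k. j \<in> J \<Longrightarrow> k \<in> J \<Longrightarrow> f j = f k \<Longrightarrow> h j = h k"
  shows "card (h ` J) \<le> card (f ` J)"
proof -
  have "h ` J = (\<lambda>y. h (SOME j. j \<in> J \<and> f j = y)) ` f ` J"
  proof -
    have "h j = h (SOME k. k \<in> J \<and> f k = f j)" if "j \<in> J" for j
      using someI[of "\<lambda>k. k \<in> J \<and> f k = f j" j] that assms(2)[of j] by metis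
    then show ?thesis by (force simp: image_image)
  qed
  then show ?thesis using card_image_le[of "f ` J"] assms(1) by simp
qed

lemma rlz_news:
  fixes a :: "nat \<Rightarrow> 'a::dense_meet_tree"
  assumes "rlz n p D a" "g \<in> D" "i \<in> news n p g"
  shows "g < a i" "d \<in> D \<Longrightarrow> inf (a i) d \<le> g" "i < n"
  using assms rlz_cut[OF assms(1), of i g] rlz_eq[OF assms(1), of i g] rlz_anchor[OF assms(1), of i g d]
  by (auto simp: news_def)

text \<open>If \<open>v\<close> and \<open>v'\<close> met above \<open>g\<close>, then
  \<open>g\<close> would lie below \<open>g'\<close>, and comparing their meet with
  \<open>g'\<close> on the branch below \<open>v'\<close> shows that \<open>v\<close> and
  \<open>g'\<close> would meet above \<open>g\<close> too.\<close>

lemma new_new: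
  fixes v v' g g' :: "'a::dense_meet_tree"
  assumes "g \<noteq> g'" "g < v" "g' < v'" "inf v g' \<le> g" "inf v' g \<le> g'"
  shows "inf v v' \<le> g"
proof (rule ccontr)
  assume "\<not> inf v v' \<le> g"
  then have g: "g < inf v v'" using new_above[of g v v'] assms(2) by auto
  then have "g \<le> v'" by (rule less_imp_le[OF less_le_trans[OF _ inf_le2]])
  then have "g \<le> g'" using assms(5) by (simp add: inf_absorb2)
  then have "\<not> g' \<le> g" using assms(1) by auto
  have "inf v v' \<le> g' \<or> g' \<le> inf v v'"
    using tree_linear[of "inf v v'" v' g'] assms(3) by auto
  then show False
  proof
    assume "inf v v' \<le> g'"
    then have "inf v v' \<le> inf v g'" by simp
    then show False using g assms(4) by (meson leD order_trans)
  next
    assume "g' \<le> inf v v'"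
    then show False using assms(4) \<open>\<not> g' \<le> g\<close> by (simp add: inf_absorb2)
  qed
qed

context monster
begin

lemma joined_equiv:
  assumes p: "p \<in> types n (UNIV :: 'a set)" and "i \<in> news n p g" "j \<in> news n p g"
  shows "joined p g i i" "joined p g i j \<Longrightarrow> joined p g j i"
    "k \<in> news n p g \<Longrightarrow> joined p g i j \<Longrightarrow> joined p g j k \<Longrightarrow> joined p g i k"
    "cone_class n p g i = cone_class n p g j \<longleftrightarrow> joined p g i j"
proof -
  obtain a where a: "rlz n p {g} a" using ex_rlz[OF p, of "{g}"] by auto
  have J: "joined p g i j \<longleftrightarrow> g < inf (a i) (a j)" if "i \<in> news n p g" "j \<in> news n p g" for i j
    using rlz_joined[OF a] that by (auto simp: news_def)
  show 1: "joined p g i i" using J[OF assms(2,2)] rlz_news[OF a _ assms(2)] by auto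
  have s: "joined p g i j \<Longrightarrow> joined p g j i" if "i \<in> news n p g" "j \<in> news n p g" for i j
    using J[OF that] J[OF that(2,1)] by (simp add: inf.commute)
  have t: "joined p g i j \<Longrightarrow> joined p g j k \<Longrightarrow> joined p g i k"
    if "i \<in> news n p g" "j \<in> news n p g" "k \<in> news n p g" for i j k
    using J[OF that(1,2)] J[OF that(2,3)] J[OF that(1,3)] inf_greater_trans by blast
  show "joined p g i j \<Longrightarrow> joined p g j i" using s[OF assms(2,3)] .
  show "k \<in> news n p g \<Longrightarrow> joined p g i j \<Longrightarrow> joined p g j k \<Longrightarrow> joined p g i k" using t[OF assms(2,3)] .
  show "cone_class n p g i = cone_class n p g j \<longleftrightarrow> joined p g i j"
  proof
    assume "cone_class n p g i = cone_class n p g j"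
    then show "joined p g i j" using 1 s[OF assms(3,2)] assms(2) unfolding cone_class_def by blast
  next
    assume "joined p g i j"
    then show "cone_class n p g i = cone_class n p g j"
      using s[OF assms(2,3)] t[OF assms(2,3)] t[OF assms(3,2)] unfolding cone_class_def by blast
  qed
qed

lemma new_cones_member:
  assumes "p \<in> types n (UNIV :: 'a set)" "X \<in> new_cones n p g" "i \<in> X"
  shows "i \<in> news n p g" "X = cone_class n p g i"
proof -
  obtain j where j: "j \<in> news n p g" "X = cone_class n p g j" using assms(2) by (auto simp: new_cones_def)
  show i: "i \<in> news n p g" using assms(3) j(2) by (simp add: cone_class_def)
  have "joined p g j i" using assms(3) j(2) by (simp add: cone_class_def)
  then show "X = cone_class n p g i" using joined_equiv(4)[OF assms(1) j(1) i] j(2) by simp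
qed

lemma cone_class_self:
  assumes "p \<in> types n (UNIV :: 'a set)" "i \<in> news n p g"
  shows "i \<in> cone_class n p g i"
  using joined_equiv(1)[OF assms assms(2)] assms(2) by (simp add: cone_class_def)

definition pts :: "nat \<Rightarrow> 'a fm set \<Rightarrow> 'a point set" where
  "pts n p = {pt \<in> points \<kappa>. \<exists>i<n. at p i pt}"

text \<open>Together with \<open>gap_cut\<close> this keeps anchored variables away from all
  points.\<close>

lemma anchored_not_gap:
  assumes "p \<in> types n (UNIV :: 'a set)" "i < n" "g \<in> cut p i" "anchor p i g"
  shows "\<not> gap p i c (cut p i)"
proof
  assume gp: "gap p i c (cut p i)"
  obtain a where a: "rlz n p {g, c} a" using ex_rlz[OF assms(1), of "{g, c}"] by auto
  have "g < inf (a i) c" using rlz_gap(1)[OF a gp assms(2), of g] assms(3) by auto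
  moreover have "inf (a i) c \<le> g" using rlz_anchor[OF a assms(4,2)] by auto
  ultimately show False by auto
qed

lemma gap_cut:
  assumes "p \<in> types n (UNIV :: 'a set)" "i < n" "one_sided c L" "gap p i c L"
  shows "cut p i = L"
  using gap_iff[OF assms(1,2), of L c] assms(3,4) by (auto simp: one_sided_def)

section \<open>Consequences of domination\<close>

text \<open>Domination in semantic form: \<open>P e\<close> says that the tuple \<open>e\<close>
  satisfies the small type \<open>r\<close>. To refute it, one moves the coordinates of
  \<open>q\<close> by an automorphism that fixes \<open>A\<close> and the coordinates of
  \<open>p\<close> but violates a formula of \<open>q\<close>.\<close>

lemma dominatesD:
  fixes p q :: "'a fm set"
  assumes p: "p \<in> types n UNIV" and dom: "dominates \<kappa> (n, p) (m, q)"
  obtains A P where "small A"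
    "\<And>\<sigma> e. \<sigma> \<in> automorphisms A \<Longrightarrow> P e \<Longrightarrow> P (\<lambda>i. \<sigma> (e i))"
    "\<And>D. small D \<Longrightarrow> \<exists>e. rlz n p D e \<and> P e"
    "\<And>\<Phi>. small \<Phi> \<Longrightarrow> \<Phi> \<subseteq> q \<Longrightarrow>
       \<exists>D. small D \<and> (\<forall>e. rlz n p D e \<longrightarrow> P e \<longrightarrow> (\<forall>\<phi>\<in>\<Phi>. sat (\<lambda>i. e (n + i)) \<phi>))"
proof -
  obtain A r where A: "small A" and r: "r \<in> types (n + m) A" "restrict_type p A \<subseteq> r"
    and ent: "\<And>\<phi>. \<phi> \<in> q \<Longrightarrow> entails (p \<union> r) (shift n \<phi>)"
    using dom unfolding dominates_def by auto
  define P where "P e \<longleftrightarrow> (\<forall>\<phi>\<in>r. sat e \<phi>)" for e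
  have rf: "params \<phi> \<subseteq> A" if "\<phi> \<in> r" for \<phi>
    using r(1) that by (auto simp: types_iff formulas_def)
  have 1: "P (\<lambda>i. \<sigma> (e i))" if "\<sigma> \<in> automorphisms A" "P e" for \<sigma> e
    using that(2) sat_automorphism_fix[OF that(1)] rf unfolding P_def by blast
  have 2: "\<exists>e. rlz n p D e \<and> P e" if D: "small D" for D
  proof -
    have "fin_sat r" "r \<subseteq> formulas (n + m) A" using r(1) by (auto simp: types_iff)
    then obtain e0 where e0: "P e0" using realise[OF A] unfolding P_def by blast
    \<comment> \<open>A realisation of \<open>r\<close> knows \<open>p\<close> only over
      \<open>A\<close>. An automorphism over \<open>A\<close> carries its first \<open>n\<close>
      coordinates to a realisation over the larger set.\<close>
    have re0: "rlz n p A e0" using e0 r(2) unfolding rlz_iff_restrict[OF p] P_def by blast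
    obtain e1 where e1: "rlz n p (A \<union> D) e1" using ex_rlz[OF p, of "A \<union> D"] A D by auto
    have "rlz n p A e1" using rlz_mono[OF e1] by blast
    then obtain \<sigma> where \<sigma>: "\<sigma> \<in> automorphisms A" "\<forall>i<n. \<sigma> (e0 i) = e1 i"
      using tuple_automorphism[OF A, of n e0 e1] rlzD[OF re0] rlzD[of n p A e1] by blast
    have "rlz n p D e1" using rlz_mono[OF e1] by blast
    then have "rlz n p D (\<lambda>i. \<sigma> (e0 i))" by (rule rlz_cong[rotated]) (use \<sigma>(2) in simp)
    then show ?thesis using 1[OF \<sigma>(1) e0] by blast
  qed
  have 3: "\<exists>D. small D \<and> (\<forall>e. rlz n p D e \<longrightarrow> P e \<longrightarrow> (\<forall>\<phi>\<in>\<Phi>. sat (\<lambda>i. e (n + i)) \<phi>))"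
    if \<Phi>: "small \<Phi>" "\<Phi> \<subseteq> q" for \<Phi>
  proof -
    have "\<exists>D. finite D \<and> (\<forall>e. rlz n p D e \<longrightarrow> P e \<longrightarrow> sat (\<lambda>i. e (n + i)) \<phi>)" if "\<phi> \<in> q" for \<phi>
    proof -
      obtain F where F: "finite F" "F \<subseteq> p \<union> r" "\<And>e. \<forall>\<psi>\<in>F. sat e \<psi> \<Longrightarrow> sat e (shift n \<phi>)"
        using ent[OF \<open>\<phi> \<in> q\<close>] unfolding entails_def by blast
      let ?D = "\<Union>\<psi>\<in>F. params \<psi>"
      have "sat e \<psi>" if "rlz n p ?D e" "P e" "\<psi> \<in> F" for e \<psi>
      proof (cases "\<psi> \<in> r")
        case True
        then show ?thesis using that(2) by (simp add: P_def)
      next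
        case False
        then have "\<psi> \<in> p" using F(2) that(3) by blast
        moreover have "\<psi> \<in> formulas n ?D" using p that(3) \<open>\<psi> \<in> p\<close> by (auto simp: types_iff formulas_def)
        ultimately show ?thesis using rlzD[OF that(1)] by blast
      qed
      then have "\<forall>e. rlz n p ?D e \<longrightarrow> P e \<longrightarrow> sat (\<lambda>i. e (n + i)) \<phi>"
        using F(3) by (simp add: sat_shift)
      moreover have "finite ?D" using F(1) finite_params by blast
      ultimately show ?thesis by blast
    qed
    then obtain f where f: "\<And>\<phi>. \<phi> \<in> q \<Longrightarrow> finite (f \<phi>)"
      "\<And>\<phi> e. \<phi> \<in> q \<Longrightarrow> rlz n p (f \<phi>) e \<Longrightarrow> P e \<Longrightarrow> sat (\<lambda>i. e (n + i)) \<phi>" by metis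
    have "small (\<Union>\<phi>\<in>\<Phi>. f \<phi>)" by (rule small_UN_small) (use \<Phi> f(1) in auto)
    moreover have "sat (\<lambda>i. e (n + i)) \<phi>" if "rlz n p (\<Union>\<phi>\<in>\<Phi>. f \<phi>) e" "P e" "\<phi> \<in> \<Phi>" for e \<phi>
      using f(2)[of \<phi> e] rlz_mono[OF that(1), of "f \<phi>"] that \<Phi>(2) by blast
    ultimately show ?thesis by blast
  qed
  show ?thesis
  proof (rule that[of A P])
    show "small A" by (rule A)
    show "P (\<lambda>i. \<sigma> (e i))" if "\<sigma> \<in> automorphisms A" "P e" for \<sigma> e using 1[OF that] .
    show "\<exists>e. rlz n p D e \<and> P e" if "small D" for D using 2[OF that] .
    show "\<exists>D. small D \<and> (\<forall>e. rlz n p D e \<longrightarrow> P e \<longrightarrow> (\<forall>\<phi>\<in>\<Phi>. sat (\<lambda>i. e (n + i)) \<phi>))"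
      if "small \<Phi>" "\<Phi> \<subseteq> q" for \<Phi> using 3[OF that] .
  qed
qed

text \<open>If the point is missing from \<open>p\<close>, each variable of \<open>p\<close> stays
  away from the gap by a fixed element. On the large side there is then room to push the coordinate
  of \<open>q\<close> past a point \<open>u\<close> that \<open>q\<close> forbids it to cross,
  fixing all the rest.\<close>

lemma dominates_pts:
  fixes p q :: "'a fm set"
  assumes p: "p \<in> types n UNIV" and q: "q \<in> types m UNIV" and dom: "dominates \<kappa> (n, p) (m, q)"
  shows "pts m q \<subseteq> pts n p"
proof
  fix pt assume "pt \<in> pts m q"
  then obtain j where pt: "pt \<in> points \<kappa>" "j < m" "at q j pt" by (auto simp: pts_def)
  obtain c L where cL: "one_sided c L"
    "\<forall>n p i. p \<in> types n UNIV \<longrightarrow> i < n \<longrightarrow> (at p i pt \<longleftrightarrow> gap p i c L)"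
    using point_one_sided[OF pt(1)] by blast
  have gq: "gap q j c L" using cL(2) q pt by blast
  have cnL: "c \<notin> L" and dn: "\<And>l u. l \<in> L \<Longrightarrow> u \<le> l \<Longrightarrow> u \<in> L" and lc: "\<And>l. l \<in> L \<Longrightarrow> l \<le> c"
    using cL(1) by (auto simp: one_sided_def less_imp_le)
  show "pt \<in> pts n p"
  proof (rule ccontr)
    assume "pt \<notin> pts n p"
    then have ng: "\<not> gap p i c L" if "i < n" for i using that cL(2) p pt(1) by (auto simp: pts_def)
    obtain A P where A: "small A" and P1: "\<And>\<sigma> e. \<sigma> \<in> automorphisms A \<Longrightarrow> P e \<Longrightarrow> P (\<lambda>i. \<sigma> (e i))"
      and P2: "\<And>D. small D \<Longrightarrow> \<exists>e. rlz n p D e \<and> P e"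
      and P3: "\<And>\<Phi>. small \<Phi> \<Longrightarrow> \<Phi> \<subseteq> q \<Longrightarrow>
         \<exists>D. small D \<and> (\<forall>e. rlz n p D e \<longrightarrow> P e \<longrightarrow> (\<forall>\<phi>\<in>\<Phi>. sat (\<lambda>i. e (n + i)) \<phi>))"
      using dominatesD[OF p dom] by blast
    \<comment> \<open>\<open>b i\<close> witnesses that variable \<open>i\<close> of
      \<open>p\<close> does not fill the gap: its meet with \<open>c\<close> is not strictly above
      some element of \<open>L\<close>, or the variable is above some element of the other
      side.\<close>
    have "\<exists>b. b \<le> c \<and> (b \<in> L \<and> \<not> above p i b c \<or> b \<notin> L \<and> b \<in> cut p i)" if "i < n" for i
      using ng[OF that] lc unfolding gap_def by blast
    then obtain b where b: "\<And>i. i < n \<Longrightarrow> b i \<le> c"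
      "\<And>i. i < n \<Longrightarrow> b i \<in> L \<and> \<not> above p i (b i) c \<or> b i \<notin> L \<and> b i \<in> cut p i" by metis
    define Q where "Q = insert c ((\<lambda>a. inf a c) ` A \<union> b ` {..<n})"
    have Q: "small Q" "Q \<subseteq> {..c}" using A b(1) small_image by (auto simp: Q_def)
    \<comment> \<open>The formula of \<open>q\<close> that puts variable \<open>j\<close> on the
      correct side of \<open>x\<close>.\<close>
    define f where "f x = (if x \<in> L then Less (Par x) (Meet (Var j) (Par c)) else Neg (Le (Par x) (Var j)))" for x
    have fq: "f x \<in> q" if "x \<le> c" for x
    proof -
      have "Le (Par x) (Var j) \<in> formulas m UNIV" using pt(2) by (simp add: formulas_def)
      then show ?thesis using gq that types_neg[OF q] unfolding f_def gap_def above_def cut_def by auto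
    qed
    \<comment> \<open>Both lie on the large side, nearer to the gap than \<open>Q\<close>, and
      \<open>u\<close> nearer than \<open>l\<close>. The coordinate of \<open>q\<close> is beyond
      \<open>u\<close>, and moving its meet \<open>z\<close> to \<open>l\<close> takes it back
      across \<open>u\<close>.\<close>
    obtain l u where lu: "l \<le> c" "u \<le> c" "l \<noteq> c"
      and case12: "l \<in> L \<and> u \<in> L \<and> l < u \<and> (\<forall>x\<in>Q. x \<in> L \<longrightarrow> x < l) \<or>
                   l \<notin> L \<and> u \<notin> L \<and> u < l \<and> (\<forall>x\<in>Q. x \<notin> L \<longrightarrow> l < x)"
    proof (cases "small_cofinal L")
      case False
      obtain l where l: "l \<in> L" "\<forall>x\<in>Q \<inter> L. x < l"
        using not_small_cofinal[OF False, of "Q \<inter> L" c] small_subset[OF Q(1)] lc by auto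
      obtain u where "u \<in> L" "l < u" using not_small_cofinal[OF False, of "{l}" c] l(1) lc by auto
      then show ?thesis using that[of l u] l lc cnL by auto
    next
      case True
      then have no: "\<not> small_coinitial ({..c} - L)" using cL(1) by (auto simp: one_sided_def)
      obtain l where l: "l \<in> {..c} - L" "\<forall>x\<in>Q - L. l < x"
        using not_small_coinitial[OF no, of "Q - L" c] small_subset[OF Q(1)] Q(2) by auto
      obtain u where "u \<in> {..c} - L" "u < l" using not_small_coinitial[OF no, of "{l}" c] l(1) by auto
      moreover have "l < c" using l cnL by (auto simp: Q_def)
      ultimately show ?thesis using that[of l u] l by auto
    qed
    have "small (f ` insert u Q)" "f ` insert u Q \<subseteq> q" using Q fq lu(2) small_image by auto
    from P3[OF this] obtain D where D: "small D"
      "\<And>e \<phi>. rlz n p D e \<Longrightarrow> P e \<Longrightarrow> \<phi> \<in> f ` insert u Q \<Longrightarrow> sat (\<lambda>i. e (n + i)) \<phi>" by blast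
    have "small (D \<union> Q)" using D(1) Q(1) by simp
    from P2[OF this] obtain e where e: "rlz n p (D \<union> Q) e" "P e" by blast
    have eD: "rlz n p D e" using rlz_mono[OF e(1)] by blast
    define z where "z = inf (e (n + j)) c"
    have z: "if x \<in> L then x < z else z < x" if "x \<in> insert u Q" for x
    proof -
      have xc: "x \<le> c" using that lu(2) Q(2) by auto
      have "sat (\<lambda>i. e (n + i)) (f x)" using D(2)[OF eD e(2)] that by blast
      then show ?thesis using tree_not_le[OF xc, of z] xc unfolding f_def z_def by (auto split: if_splits)
    qed
    have zc: "z < c" using z[of c] cnL by (auto simp: Q_def)
    let ?X = "A \<union> e ` {..<n}"
    have cmp: "x < l \<and> x < z \<or> l < x \<and> z < x"
      if "y \<in> Q" "x \<le> c" "y \<in> L \<and> x \<le> y \<or> y \<notin> L \<and> y \<le> x" for x y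
      using case12
    proof (elim disjE conjE)
      assume *: "l \<in> L" "u \<in> L" "l < u" "\<forall>x\<in>Q. x \<in> L \<longrightarrow> x < l"
      have "l < z" using z[of u] * by auto
      then show ?thesis using z[of y] that * by (auto intro: less_le_trans le_less_trans less_trans)
    next
      assume *: "l \<notin> L" "u \<notin> L" "u < l" "\<forall>x\<in>Q. x \<notin> L \<longrightarrow> l < x"
      have "z < l" using z[of u] * by auto
      then show ?thesis using z[of y] that * by (auto intro: less_le_trans le_less_trans less_trans)
    qed
    have "\<exists>\<tau>\<in>automorphisms (insert c ?X). \<tau> z = l"
    proof (rule gap_automorphism)
      show "small ?X" using A by simp
      show "z < c" "l < c" using zc lu by auto
      fix x assume "x \<in> ?X"
      then show "inf x c < l \<and> inf x c < z \<or> l < inf x c \<and> z < inf x c"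
      proof
        assume "x \<in> A"
        then have "inf x c \<in> Q" by (simp add: Q_def)
        then show ?thesis using cmp[of "inf x c" "inf x c"] by auto
      next
        assume "x \<in> e ` {..<n}"
        then obtain i where i: "i < n" "x = e i" by auto
        have bQ: "b i \<in> Q" "c \<in> Q" using i by (auto simp: Q_def)
        have "b i \<in> L \<and> inf x c \<le> b i \<or> b i \<notin> L \<and> b i \<le> inf x c"
          using b(2)[OF i(1)]
        proof (elim disjE conjE)
          assume "b i \<in> L" "\<not> above p i (b i) c"
          then have "\<not> b i < inf x c" using rlz_above[OF e(1) i(1), of "b i" c] bQ i(2) by auto
          then show ?thesis using tree_linear[OF b(1)[OF i(1)], of "inf x c"] \<open>b i \<in> L\<close>
            by (auto simp: less_le_not_le)
        next
          assume "b i \<notin> L" "b i \<in> cut p i"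
          then show ?thesis using rlz_cut[OF e(1) i(1), of "b i"] bQ b(1)[OF i(1)] i(2) by auto
        qed
        then show ?thesis using cmp[OF bQ(1), of "inf x c"] by auto
      qed
    qed
    then obtain \<tau> where \<tau>: "\<tau> \<in> automorphisms (insert c ?X)" "\<tau> z = l" by blast
    define e' where "e' = (\<lambda>i. \<tau> (e i))"
    have "\<tau> \<in> automorphisms A" using automorphisms_mono[OF \<tau>(1)] by blast
    then have "P e'" using P1 e(2) unfolding e'_def by blast
    moreover have "rlz n p D e'"
      by (rule rlz_cong[OF _ eD]) (use automorphismsD(4)[OF \<tau>(1)] in \<open>auto simp: e'_def\<close>)
    ultimately have "sat (\<lambda>i. e' (n + i)) (f u)" using D(2) by blast
    moreover have "inf (e' (n + j)) c = l"
      using \<tau>(2) automorphismsD(3)[OF \<tau>(1), of "e (n + j)" c] automorphismsD(4)[OF \<tau>(1), of c]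
      by (simp add: e'_def z_def)
    moreover have "l \<le> e' (n + j)" using \<open>inf (e' (n + j)) c = l\<close> by auto
    then have "u < l \<Longrightarrow> u \<le> e' (n + j)" by simp
    ultimately show False using case12 by (auto simp: f_def)
  qed
qed

text \<open>With too few new cones in \<open>p\<close>, some new cone of \<open>q\<close> contains
  no coordinate of \<open>p\<close>. Its element can be moved over \<open>A\<close> and these
  coordinates to an element \<open>u\<close> of the model, although \<open>q\<close> forbids being
  in the cone of \<open>u\<close>.\<close>

lemma dominates_new_cones:
  fixes p q :: "'a fm set"
  assumes p: "p \<in> types n UNIV" and q: "q \<in> types m UNIV" and dom: "dominates \<kappa> (n, p) (m, q)"
  shows "card (new_cones m q g) \<le> card (new_cones n p g)"
proof (rule ccontr)
  assume less: "\<not> ?thesis"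
  let ?I = "news n p g" and ?J = "news m q g"
  obtain A P where A: "small A" and P1: "\<And>\<sigma> e. \<sigma> \<in> automorphisms A \<Longrightarrow> P e \<Longrightarrow> P (\<lambda>i. \<sigma> (e i))"
    and P2: "\<And>D. small D \<Longrightarrow> \<exists>e. rlz n p D e \<and> P e"
    and P3: "\<And>\<Phi>. small \<Phi> \<Longrightarrow> \<Phi> \<subseteq> q \<Longrightarrow>
       \<exists>D. small D \<and> (\<forall>e. rlz n p D e \<longrightarrow> P e \<longrightarrow> (\<forall>\<phi>\<in>\<Phi>. sat (\<lambda>i. e (n + i)) \<phi>))"
    using dominatesD[OF p dom] by blast
  \<comment> \<open>\<open>d i\<close> records why variable \<open>i\<close> of \<open>p\<close> is
    not new above \<open>g\<close>; in the last alternative the variable meets the element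
    \<open>d i\<close> beyond \<open>g\<close>.\<close>
  have "\<exists>d. i < n \<longrightarrow> i \<notin> ?I \<longrightarrow> g \<notin> cut p i \<or> Eq (Var i) (Par g) \<in> p \<or> Le (Meet (Var i) (Par d)) (Par g) \<notin> p" for i
    by (auto simp: news_def anchor_def)
  then obtain d where d: "\<And>i. i < n \<Longrightarrow> i \<notin> ?I \<Longrightarrow>
      g \<notin> cut p i \<or> Eq (Var i) (Par g) \<in> p \<or> Le (Meet (Var i) (Par (d i))) (Par g) \<notin> p" by metis
  let ?Y = "A \<union> d ` {..<n}"
  have Y: "small ?Y" using A by simp
  \<comment> \<open>\<open>u\<close> is fixed before the realisation, so that the formulas of
    \<open>q\<close> about \<open>u\<close> can be put into \<open>\<Phi>\<close>.\<close>
  obtain u where u: "g < u" "\<forall>x\<in>?Y. inf u x \<le> g" using ex_new_cone[OF Y] by blast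
  define \<Phi> where "\<Phi> = (\<lambda>j. Less (Par g) (Var j)) ` ?J
     \<union> (\<Union>j\<in>?J. (\<lambda>x. Le (Meet (Var j) (Par x)) (Par g)) ` insert u ?Y)
     \<union> (\<Union>j\<in>?J. (\<lambda>k. if joined q g j k then Less (Par g) (Meet (Var j) (Var k))
                    else Neg (Less (Par g) (Meet (Var j) (Var k)))) ` ?J)"
  have small_UN: "small (\<Union>j\<in>J. F j)" if "finite J" "\<And>j. small (F j)" for J :: "nat set" and F :: "nat \<Rightarrow> 'a fm set"
    using that by (induction rule: finite_induct) auto
  have im: "small (F ` insert u ?Y)" for F :: "'a \<Rightarrow> 'a fm" using Y by (intro small_image) simp
  have "small \<Phi>"
    unfolding \<Phi>_def small_Un
    by (intro conjI small_UN[OF finite_news] im small_finite finite_imageI finite_UN_I finite_news)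
  have "Less (Par g) (Var j) \<in> q" if "j \<in> ?J" for j
  proof -
    obtain b where b: "rlz m q {g} b" using ex_rlz[OF q, of "{g}"] by auto
    then show ?thesis using rlz_less[OF b, of j g] rlz_news[OF b _ that] by auto
  qed
  moreover have "Neg (Less (Par g) (Meet (Var j) (Var k))) \<in> q" if "j \<in> ?J" "k \<in> ?J" "\<not> joined q g j k" for j k
    using types_neg[OF q, of "Less (Par g) (Meet (Var j) (Var k))"] that by (auto simp: joined_def news_def formulas_def)
  ultimately have "\<Phi> \<subseteq> q" by (auto simp: \<Phi>_def news_def anchor_def joined_def)
  from P3[OF \<open>small \<Phi>\<close> this] obtain D where D: "small D"
    "\<And>e \<phi>. rlz n p D e \<Longrightarrow> P e \<Longrightarrow> \<phi> \<in> \<Phi> \<Longrightarrow> sat (\<lambda>i. e (n + i)) \<phi>" by blast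
  have "small (insert g (insert u (D \<union> ?Y)))" using D(1) Y by simp
  from P2[OF this] obtain e where e: "rlz n p (insert g (insert u (D \<union> ?Y))) e" "P e" by blast
  have eD: "rlz n p D e" using rlz_mono[OF e(1)] by blast
  note s = D(2)[OF eD e(2)]
  have s1: "g < e (n + j)" if "j \<in> ?J" for j
    using s[of "Less (Par g) (Var j)"] that by (auto simp: \<Phi>_def)
  have s2: "inf (e' (n + j)) x \<le> g" if "rlz n p D e'" "P e'" "j \<in> ?J" "x \<in> insert u ?Y" for j x e'
  proof -
    have "Le (Meet (Var j) (Par x)) (Par g) \<in> \<Phi>" using that unfolding \<Phi>_def by blast
    then show ?thesis using D(2)[OF that(1,2)] by fastforce
  qed
  have s3: "g < inf (e (n + j)) (e (n + k)) \<longleftrightarrow> joined q g j k" if "j \<in> ?J" "k \<in> ?J" for j k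
  proof -
    have "(if joined q g j k then Less (Par g) (Meet (Var j) (Var k))
                    else Neg (Less (Par g) (Meet (Var j) (Var k)))) \<in> \<Phi>"
      using that unfolding \<Phi>_def by blast
    then show ?thesis using s by (fastforce split: if_splits)
  qed
  \<comment> \<open>A coordinate of \<open>p\<close> that is not new above \<open>g\<close> but lies
    above it shares its cone with \<open>d i\<close>, which the cone of \<open>v\<close>
    avoids.\<close>
  have old: "inf v (e i) \<le> g" if "i < n" "i \<notin> ?I" "g < v" "inf v (d i) \<le> g" for v i
  proof (rule ccontr)
    assume "\<not> inf v (e i) \<le> g"
    then have gv: "g < inf v (e i)" using new_above[of g v "e i"] that(3) by auto
    have ge: "g \<le> e i" using gv by (auto intro: less_imp_le[OF less_le_trans[OF _ inf_le2]])
    have "e i \<noteq> g" using less_le_trans[OF gv inf_le2] by auto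
    then have "g \<in> cut p i" "Eq (Var i) (Par g) \<notin> p"
      using rlz_cut[OF e(1) that(1), of g] rlz_eq[OF e(1) that(1), of g] ge by auto
    then have "\<not> inf (e i) (d i) \<le> g" using d[OF that(1,2)] rlz_meet_le[OF e(1) that(1), of "d i" g] that(1) by auto
    then have "g < inf (e i) (d i)" using new_above[OF ge] by blast
    then have "g < inf v (d i)" using inf_greater_trans gv by blast
    then show False using that(4) by auto
  qed
  \<comment> \<open>Pigeonhole: otherwise each cone of \<open>q\<close> contains a coordinate of
    \<open>p\<close>, and cones of \<open>q\<close> that touch the same cone of \<open>p\<close>
    coincide.\<close>
  have "\<exists>j\<in>?J. \<forall>i\<in>?I. inf (e (n + j)) (e i) \<le> g"
  proof (rule ccontr)
    assume "\<not> ?thesis"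
    then obtain t where t: "\<And>j. j \<in> ?J \<Longrightarrow> t j \<in> ?I" "\<And>j. j \<in> ?J \<Longrightarrow> \<not> inf (e (n + j)) (e (t j)) \<le> g" by metis
    have t2: "g < inf (e (n + j)) (e (t j))" if "j \<in> ?J" for j
      using t(2)[OF that] new_above[of g "e (n + j)" "e (t j)"] s1[OF that] by auto
    have "cone_class m q g j = cone_class m q g k"
      if "j \<in> ?J" "k \<in> ?J" "cone_class n p g (t j) = cone_class n p g (t k)" for j k
    proof -
      have "joined p g (t j) (t k)" using joined_equiv(4)[OF p t(1) t(1)] that by blast
      then have "g < inf (e (t j)) (e (t k))"
        using rlz_joined[OF e(1), of "t j" "t k" g] t(1)[OF that(1)] t(1)[OF that(2)] by (auto simp: news_def)
      then have "g < inf (e (n + j)) (e (n + k))"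
        using inf_greater_trans[OF t2[OF that(1)]] inf_greater_trans[of g "e (n + j)" "e (t k)" "e (n + k)"]
          t2[OF that(2)] by (simp add: inf.commute)
      then show ?thesis using s3[OF that(1,2)] joined_equiv(4)[OF q that(1,2)] by blast
    qed
    then have "card (new_cones m q g) \<le> card ((\<lambda>j. cone_class n p g (t j)) ` ?J)"
      unfolding new_cones_def by (intro card_image_le_of_factor finite_news) blast
    also have "\<dots> \<le> card (new_cones n p g)"
      by (rule card_mono[OF finite_new_cones]) (use t(1) in \<open>auto simp: new_cones_def\<close>)
    finally show False using less by blast
  qed
  then obtain j where j: "j \<in> ?J" "\<And>i. i \<in> ?I \<Longrightarrow> inf (e (n + j)) (e i) \<le> g" by blast
  let ?X = "insert g (A \<union> e ` {..<n})"
  have "\<exists>\<tau>\<in>automorphisms ?X. \<tau> (e (n + j)) = u"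
  proof (rule new_automorphism1[of ?X g])
    show "small ?X" using A by simp
    show "g < e (n + j)" "g < u" using s1 j u by auto
    fix x assume x: "x \<in> ?X"
    show "inf (e (n + j)) x \<le> g"
    proof (cases "x \<in> e ` {..<n}")
      case True
      then obtain i where i: "i < n" "x = e i" by auto
      have "inf (e (n + j)) (d i) \<le> g" using s2[OF eD e(2) j(1), of "d i"] i(1) by auto
      then show ?thesis using j(2)[of i] old[OF i(1) _ s1[OF j(1)]] i(2) by blast
    next
      case False
      then show ?thesis using x s2[OF eD e(2) j(1), of x] by auto
    qed
    show "inf u x \<le> g"
    proof (cases "x \<in> e ` {..<n}")
      case True
      then obtain i where i: "i < n" "x = e i" by auto
      show ?thesis
      proof (cases "i \<in> ?I")
        case True
        then show ?thesis using rlz_news(2)[OF e(1) _ True, of u] i(2) by (simp add: inf.commute)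
      next
        case False
        have "inf u (d i) \<le> g" using u(2) i(1) by blast
        then show ?thesis using old[OF i(1) False u(1)] i(2) by blast
      qed
    next
      case False
      then show ?thesis using x u(2) by auto
    qed
  qed simp
  then obtain \<tau> where \<tau>: "\<tau> \<in> automorphisms ?X" "\<tau> (e (n + j)) = u" by blast
  define e' where "e' = (\<lambda>i. \<tau> (e i))"
  have "\<tau> \<in> automorphisms A" using automorphisms_mono[OF \<tau>(1)] by blast
  then have "P e'" using P1 e(2) unfolding e'_def by blast
  moreover have "rlz n p D e'"
    by (rule rlz_cong[OF _ eD]) (use automorphismsD(4)[OF \<tau>(1)] in \<open>auto simp: e'_def\<close>)
  ultimately have "inf (e' (n + j)) u \<le> g" using s2[of e' j u] j(1) by blast
  then show False using \<tau>(2) u(1) by (simp add: e'_def)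
qed

end

section \<open>Sufficient conditions for domination\<close>

context monster
begin

lemma small_finite_UN: "finite I \<Longrightarrow> (\<And>i. i \<in> I \<Longrightarrow> small (F i)) \<Longrightarrow> small (\<Union>i\<in>I. F i)"
  by (induction rule: finite_induct) auto

text \<open>A small set that decides the cut from its small side; only the large side remains to be
  controlled by other means.\<close>

lemma one_sided_witness:
  assumes "one_sided c L"
  shows "\<exists>S. small S \<and> S \<subseteq> {..c} \<and> ((\<forall>l\<in>L. \<exists>s\<in>S \<inter> L. l \<le> s) \<or> (\<forall>m\<le>c. m \<notin> L \<longrightarrow> (\<exists>s\<in>S - L. s \<le> m)))"
  using assms unfolding one_sided_def
proof (elim conjE disjE)
  assume "\<forall>l\<in>L. l < c" "small_cofinal L"
  then obtain B where "B \<subseteq> L" "small B" "\<forall>l\<in>L. \<exists>b\<in>B. l \<le> b" by (auto simp: small_cofinal_def)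
  moreover have "B \<subseteq> {..c}" using \<open>B \<subseteq> L\<close> \<open>\<forall>l\<in>L. l < c\<close> by (auto simp: less_imp_le)
  ultimately show ?thesis by (intro exI[of _ B]) blast
next
  assume "small_coinitial ({..c} - L)"
  then obtain B where "B \<subseteq> {..c} - L" "small B" "\<forall>l\<in>{..c} - L. \<exists>b\<in>B. b \<le> l"
    by (auto simp: small_coinitial_def)
  then show ?thesis by (intro exI[of _ B]) blast
qed

text \<open>For \<open>r\<close> the type of a concrete tuple over \<open>A\<close> is taken. By
  \<open>entailsI\<close> only realisations in the model have to be tested, and \<open>D\<close> may
  be assumed closed under meets, as \<open>rlz_extend\<close> requires.\<close>

lemma dominatesI:
  fixes p q :: "'a fm set"
  assumes p: "p \<in> types n UNIV" and q: "q \<in> types m UNIV" and A: "small A"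
    and a: "rlz n p A a" and b: "rlz m q A b"
    and ext: "\<And>D e. small D \<Longrightarrow> A \<subseteq> D \<Longrightarrow> (\<And>x y. x \<in> D \<Longrightarrow> y \<in> D \<Longrightarrow> inf x y \<in> D) \<Longrightarrow> rlz n p D e \<Longrightarrow>
       (\<And>\<phi>. \<phi> \<in> formulas (n + m) A \<Longrightarrow> sat e \<phi> \<longleftrightarrow> sat (join n a b) \<phi>) \<Longrightarrow> rlz m q D (\<lambda>i. e (n + i))"
  shows "dominates \<kappa> (n, p) (m, q)"
proof -
  define r where "r = complete_theory (n + m) A (join n a b)"
  have r: "r \<in> types (n + m) A" unfolding r_def by (rule complete_theory_types)
  have "\<phi> \<in> r" if "\<phi> \<in> restrict_type p A" for \<phi>
  proof -
    have f: "\<phi> \<in> formulas n A" using p that by (auto simp: restrict_type_def types_iff formulas_def)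
    then have "sat a \<phi>" using rlzD[OF a] that by (auto simp: restrict_type_def)
    moreover have "sat a \<phi> \<longleftrightarrow> sat (join n a b) \<phi>" using f by (intro sat_cong) (auto simp: formulas_def)
    ultimately show ?thesis using f formulas_mono[of n "n + m" A A] by (auto simp: r_def complete_theory_def)
  qed
  moreover have "shift n \<phi> \<in> r" if "\<phi> \<in> restrict_type q A" for \<phi>
  proof -
    have f: "\<phi> \<in> formulas m A" using q that by (auto simp: restrict_type_def types_iff formulas_def)
    then have "sat b \<phi>" using rlzD[OF b] that by (auto simp: restrict_type_def)
    then show ?thesis using shift_formulas[OF f] by (simp add: r_def complete_theory_def sat_shift)
  qed
  moreover have "entails (p \<union> r) (shift n \<phi>)" if "\<phi> \<in> q" for \<phi>
  proof -
    have \<phi>: "fvars \<phi> \<subseteq> {..<m}" using q that by (auto simp: types_iff formulas_def)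
    let ?D = "icl (A \<union> params \<phi>)"
    have D: "small ?D" using small_icl[of "A \<union> params \<phi>"] A finite_params by simp
    have sub: "A \<subseteq> ?D" "params \<phi> \<subseteq> ?D" using subset_icl by blast+
    have f: "\<phi> \<in> formulas m ?D" using \<phi> sub by (simp add: formulas_def)
    show ?thesis
    proof (rule entailsI[OF D, of "(p \<inter> formulas n ?D) \<union> r"])
      show "p \<inter> formulas n ?D \<union> r \<subseteq> p \<union> r" by blast
      show "p \<inter> formulas n ?D \<union> r \<subseteq> formulas (n + m) ?D"
        using formulas_mono[of n "n + m" ?D ?D] formulas_mono[of "n + m" "n + m" A ?D] r sub(1)
        by (auto simp: types_iff)
      show "shift n \<phi> \<in> formulas (n + m) ?D" using shift_formulas[OF f] .
      fix e assume e: "\<And>\<psi>. \<psi> \<in> p \<inter> formulas n ?D \<union> r \<Longrightarrow> sat e \<psi>"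
      have "rlz n p ?D e" using rlzI[OF p] e by blast
      moreover have "sat e \<psi> \<longleftrightarrow> sat (join n a b) \<psi>" if "\<psi> \<in> formulas (n + m) A" for \<psi>
      proof -
        have "\<psi> \<in> r \<or> Neg \<psi> \<in> r" using r that by (simp add: types_iff)
        moreover have "\<chi> \<in> r \<Longrightarrow> sat e \<chi> \<and> sat (join n a b) \<chi>" for \<chi>
          using e by (auto simp: r_def complete_theory_def)
        ultimately show ?thesis by fastforce
      qed
      ultimately have "rlz m q ?D (\<lambda>i. e (n + i))" using ext[OF D sub(1)] icl_closed by blast
      then show "sat e (shift n \<phi>)" using rlzD f \<open>\<phi> \<in> q\<close> by (simp add: sat_shift) blast
    qed
  qed
  ultimately have "restrict_type p A \<union> shift n ` restrict_type q A \<subseteq> r \<and> (\<forall>\<phi>\<in>q. entails (p \<union> r) (shift n \<phi>))"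
    by blast
  then show ?thesis unfolding dominates_def split using A r by blast
qed

text \<open>If \<open>v\<close> and \<open>b k\<close> met above \<open>g\<close>, then
  \<open>b k\<close> would share its open cone above \<open>g\<close> with \<open>c\<close>, hence
  so would \<open>v\<close>, but \<open>v\<close> is new over \<open>D\<close>.\<close>

lemma new_not_in_old_cone:
  fixes q :: "'a fm set"
  assumes q: "q \<in> types m UNIV" "k < m" and b: "rlz m q D b" and gc: "g \<in> D" "c \<in> D"
    and v: "g < v" "\<And>d. d \<in> D \<Longrightarrow> inf v d \<le> g"
    and k: "Eq (Var k) (Par c) \<in> q \<or> (\<exists>L. one_sided c L \<and> gap q k c L)"
  shows "inf v (b k) \<le> g"
proof (rule ccontr)
  assume "\<not> inf v (b k) \<le> g"
  then have g: "g < inf v (b k)" using new_above[of g v "b k"] v(1) by auto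
  from k show False
  proof (elim disjE exE conjE)
    assume "Eq (Var k) (Par c) \<in> q"
    then have "b k = c" using rlz_eq[OF b q(2) gc(2)] by simp
    then show False using v(2)[OF gc(2)] g by auto
  next
    fix L assume L: "one_sided c L" "gap q k c L"
    have "g \<le> b k" using less_le_trans[OF g inf_le2] by (rule less_imp_le)
    then have "g \<in> L" using rlz_cut[OF b q(2) gc(1)] gap_cut[OF q L] by simp
    then have "g < inf (b k) c" using rlz_gap(1)[OF b L(2) q(2) gc(2,1)] by simp
    then have "g < inf v c" using inf_greater_trans[OF g] by blast
    then show False using v(2)[OF gc(2)] by auto
  qed
qed

text \<open>Realise \<open>q\<close> over a realisation \<open>a\<close> of \<open>p\<close>, then move the new cones of \<open>q\<close> onto those of \<open>a\<close>,
  leaving the other coordinates in place.\<close>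

lemma dominates_if:
  fixes p q :: "'a fm set"
  assumes p: "p \<in> types n UNIV" and q: "q \<in> types m UNIV" and inv: "small B" "invariant B q"
    and pts: "pts m q \<subseteq> pts n p" and cones: "\<And>g. card (new_cones m q g) \<le> card (new_cones n p g)"
  shows "dominates \<kappa> (n, p) (m, q)"
proof -
  let ?anch = "\<lambda>j c. c \<in> cut q j \<and> anchor q j c"
  \<comment> \<open>The two alternatives of \<open>one_sided_witness\<close>, according to the side
    of the gap that \<open>S\<close> controls.\<close>
  let ?W = "\<lambda>S L c. (\<forall>l\<in>L. \<exists>s\<in>S \<inter> L. l \<le> s) \<or> (\<forall>m\<le>c. m \<notin> L \<longrightarrow> (\<exists>s\<in>S - L. s \<le> m))"
  let ?pt = "\<lambda>j c S. \<exists>L i. i < n \<and> one_sided c L \<and> gap q j c L \<and> gap p i c L \<and> ?W S L c"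
  have "\<exists>c S. small S \<and> (?anch j c \<or> ?pt j c S)" if "j < m" for j
    using invariant_variable_cases[OF q that inv]
  proof
    assume "\<exists>g\<in>cut q j. anchor q j g"
    then show ?thesis by (meson small_finite finite.emptyI)
  next
    assume "\<exists>pt\<in>points \<kappa>. at q j pt"
    then obtain pt where pt: "pt \<in> points \<kappa>" "at q j pt" by blast
    obtain c L where cL: "one_sided c L"
      "\<forall>n p i. p \<in> types n UNIV \<longrightarrow> i < n \<longrightarrow> (at p i pt \<longleftrightarrow> gap p i c L)"
      using point_one_sided[OF pt(1)] by blast
    have "pt \<in> pts n p" using pts pt \<open>j < m\<close> by (auto simp: pts_def)
    then obtain i where "i < n" "at p i pt" by (auto simp: pts_def)
    then have "i < n" "gap p i c L" "gap q j c L" using cL(2) p q pt(2) \<open>j < m\<close> by blast+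
    moreover obtain S where "small S" "?W S L c" using one_sided_witness[OF cL(1)] by blast
    ultimately show ?thesis using cL(1) by blast
  qed
  then obtain c S where S: "\<And>j. j < m \<Longrightarrow> small (S j)"
    and cS: "\<And>j. j < m \<Longrightarrow> ?anch j (c j) \<or> ?pt j (c j) (S j)" by metis
  define A where "A = c ` {..<m} \<union> (\<Union>j\<in>{..<m}. S j)"
  have A: "small A" unfolding A_def using small_finite_UN[of "{..<m}" S] S by simp
  have cA: "c j \<in> A" "S j \<subseteq> A" if "j < m" for j using that by (auto simp: A_def)
  obtain a where a: "rlz n p A a" using ex_rlz[OF p A] by blast
  \<comment> \<open>Since \<open>b\<close> fills the gaps also over the meets of \<open>a\<close>
    with \<open>c j\<close>, the meet of \<open>a\<close> separates that of \<open>b\<close> from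
    the large side of each common gap. The small side is controlled by \<open>S j\<close>.\<close>
  let ?E = "A \<union> (\<Union>j\<in>{..<m}. (\<lambda>i. inf (a i) (c j)) ` {..<n})"
  have "small ?E" using A by simp
  then obtain b where bE: "rlz m q ?E b" using ex_rlz[OF q] by blast
  have b: "rlz m q A b" using rlz_mono[OF bE] by blast
  define J where "J = {j. j < m \<and> j \<in> news m q (c j)}"
  have finJ: "finite J" by (simp add: J_def)
  \<comment> \<open>The inequality of cardinalities enters here, as an injection of the new cones of
    \<open>q\<close> above \<open>g\<close> into those of \<open>p\<close>.\<close>
  have "\<exists>f. f ` new_cones m q g \<subseteq> new_cones n p g \<and> inj_on f (new_cones m q g)" for g
    by (rule card_le_inj[OF finite_new_cones finite_new_cones cones])
  then obtain F where F: "\<And>g X. X \<in> new_cones m q g \<Longrightarrow> F g X \<in> new_cones n p g"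
    "\<And>g. inj_on (F g) (new_cones m q g)" by (metis image_subset_iff)
  define rep where "rep X = (SOME i. i \<in> X)" for X :: "nat set"
  have rep: "rep X \<in> X" if "X \<in> new_cones k r g" "r \<in> types k (UNIV :: 'a set)" for X k r g
  proof -
    have "X \<noteq> {}" using that(1) cone_class_self[OF that(2)] unfolding new_cones_def by blast
    then show ?thesis unfolding rep_def by (simp add: some_in_eq)
  qed
  \<comment> \<open>One index for each new cone: its base point and its class of variables. Only
    representatives are moved, \<open>v\<close> being the element of \<open>b\<close> and
    \<open>w\<close> its target in \<open>a\<close>.\<close>
  define K where "K = (\<lambda>j. (c j, cone_class m q (c j) j)) ` J"
  have K: "X \<in> new_cones m q g" "g \<in> A" if "(g, X) \<in> K" for g X
    using that cA by (auto simp: K_def J_def new_cones_def)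
  define v where "v = (\<lambda>(g :: 'a, X). b (rep X))"
  define w where "w = (\<lambda>(g, X). a (rep (F g X)))"
  have nv: "rep X \<in> news m q g" if "(g, X) \<in> K" for g X
    using new_cones_member(1)[OF q K(1)[OF that]] rep[OF K(1)[OF that] q] by blast
  have nw: "rep (F g X) \<in> news n p g" if "(g, X) \<in> K" for g X
    using new_cones_member(1)[OF p F(1)[OF K(1)[OF that]]] rep[OF F(1)[OF K(1)[OF that]] p] by blast
  let ?X = "A \<union> b ` ({..<m} - J)"
  have old: "inf u (b k) \<le> g" if "g \<in> A" "g < u" "\<And>d. d \<in> A \<Longrightarrow> inf u d \<le> g" "k < m" "k \<notin> J" for g u k
  proof (rule new_not_in_old_cone[OF q that(4) b that(1) cA(1)[OF that(4)] that(2,3)])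
    show "Eq (Var k) (Par (c k)) \<in> q \<or> (\<exists>L. one_sided (c k) L \<and> gap q k (c k) L)"
      using cS[OF that(4)] that(4,5) by (auto simp: J_def news_def)
  qed
  have pair_v: "g < v (g, X)" "x \<in> ?X \<Longrightarrow> inf (v (g, X)) x \<le> g" if "(g, X) \<in> K" for g X x
  proof -
    note r = rlz_news[OF b K(2)[OF that] nv[OF that]]
    show "g < v (g, X)" using r by (simp add: v_def)
    show "x \<in> ?X \<Longrightarrow> inf (v (g, X)) x \<le> g" using r old[OF K(2)[OF that]] by (auto simp: v_def)
  qed
  have pair_w: "g < w (g, X)" "x \<in> ?X \<Longrightarrow> inf (w (g, X)) x \<le> g" if "(g, X) \<in> K" for g X x
  proof -
    note r = rlz_news[OF a K(2)[OF that] nw[OF that]]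
    show "g < w (g, X)" using r by (simp add: w_def)
    show "x \<in> ?X \<Longrightarrow> inf (w (g, X)) x \<le> g" using r old[OF K(2)[OF that]] by (auto simp: w_def)
  qed
  have sep: "inf (b (rep X)) (b (rep X')) \<le> g" if "(g, X) \<in> K" "(g, X') \<in> K" "X \<noteq> X'" for g X X'
  proof -
    have "X = cone_class m q g (rep X)" "X' = cone_class m q g (rep X')"
      using new_cones_member(2)[OF q K(1) rep[OF K(1) q]] that by blast+
    then have "\<not> joined q g (rep X) (rep X')"
      using joined_equiv(4)[OF q nv[OF that(1)] nv[OF that(2)]] that(3) by metis
    then show ?thesis
      using rlz_joined[OF b, of "rep X" "rep X'" g] nv[OF that(1)] nv[OF that(2)] K(2)[OF that(1)]
        pair_v(1)[OF that(1)] new_above[of g "b (rep X)" "b (rep X')"] by (auto simp: news_def v_def)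
  qed
  have sep': "inf (a (rep (F g X))) (a (rep (F g X'))) \<le> g" if "(g, X) \<in> K" "(g, X') \<in> K" "X \<noteq> X'" for g X X'
  proof -
    have "F g X = cone_class n p g (rep (F g X))" "F g X' = cone_class n p g (rep (F g X'))"
      using new_cones_member(2)[OF p F(1)[OF K(1)] rep[OF F(1)[OF K(1)] p]] that by blast+
    moreover have "F g X \<noteq> F g X'" using inj_onD[OF F(2)] K(1) that by blast
    ultimately have "\<not> joined p g (rep (F g X)) (rep (F g X'))"
      using joined_equiv(4)[OF p nw[OF that(1)] nw[OF that(2)]] by metis
    then show ?thesis
      using rlz_joined[OF a, of "rep (F g X)" "rep (F g X')" g] nw[OF that(1)] nw[OF that(2)] K(2)[OF that(1)]
        pair_w(1)[OF that(1)] new_above[of g "a (rep (F g X))" "a (rep (F g X'))"] by (auto simp: news_def w_def)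
  qed
  have "\<exists>\<tau>\<in>automorphisms ?X. \<forall>k\<in>K. \<tau> (v k) = w k"
  proof (rule new_automorphism[where g = fst])
    show "small ?X" "finite K" using A finJ by (simp_all add: K_def)
    show "fst ` K \<subseteq> ?X" using K(2) by auto
    fix k assume k: "k \<in> K"
    show "fst k < v k" "fst k < w k" using pair_v(1) pair_w(1) k by (metis prod.collapse)+
    show "inf (v k) x \<le> fst k" "inf (w k) x \<le> fst k" if "x \<in> ?X" for x
      using pair_v(2) pair_w(2) k that by (metis prod.collapse)+
    fix k' assume k': "k' \<in> K" "k \<noteq> k'"
    obtain g X g' X' where e: "k = (g, X)" "k' = (g', X')" by (cases k, cases k')
    have gA: "g \<in> ?X" "g' \<in> ?X" using K(2) k k' e by blast+
    show "inf (v k) (v k') \<le> fst k"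
    proof (cases "g = g'")
      case True
      then show ?thesis using sep[of g X X'] k k' e by (auto simp: v_def)
    next
      case False
      then show ?thesis
        using new_new[of g g' "v k" "v k'"] pair_v k k' gA unfolding e by (auto simp: K_def)
    qed
    show "inf (w k) (w k') \<le> fst k"
    proof (cases "g = g'")
      case True
      then show ?thesis using sep'[of g X X'] k k' e by (auto simp: w_def)
    next
      case False
      then show ?thesis
        using new_new[of g g' "w k" "w k'"] pair_w k k' gA unfolding e by (auto simp: K_def)
    qed
  qed
  then obtain \<tau> where \<tau>: "\<tau> \<in> automorphisms ?X" "\<And>k. k \<in> K \<Longrightarrow> \<tau> (v k) = w k" by blast
  have \<tau>A: "\<tau> \<in> automorphisms A" using automorphisms_mono[OF \<tau>(1)] by blast
  define b' where "b' = (\<lambda>i. \<tau> (b i))"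
  have b': "rlz m q A b'" unfolding b'_def by (rule rlz_automorphism[OF \<tau>A b])
  \<comment> \<open>The other members of a cone follow its representative, because
    \<open>\<tau>\<close> fixes the base point and preserves meets.\<close>
  have match: "\<exists>i\<in>news n p (c j). c j < inf (b' j) (a i)" if j: "j \<in> J" for j
  proof -
    let ?g = "c j" and ?C = "cone_class m q (c j) j"
    have k: "(?g, ?C) \<in> K" using j by (simp add: K_def)
    have jn: "j \<in> news m q ?g" "j < m" using j by (auto simp: J_def)
    have "rep ?C \<in> ?C" using rep[OF K(1)[OF k] q] .
    then have "joined q ?g j (rep ?C)" by (simp add: cone_class_def)
    then have "?g < inf (b j) (b (rep ?C))"
      using rlz_joined[OF b jn(2)] nv[OF k] K(2)[OF k] by (auto simp: news_def)
    then have "\<tau> ?g < \<tau> (inf (b j) (b (rep ?C)))" using automorphismsD(2)[OF \<tau>(1)] by blast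
    moreover have "\<tau> (b (rep ?C)) = a (rep (F ?g ?C))" using \<tau>(2)[OF k] by (simp add: v_def w_def)
    moreover have "\<tau> ?g = ?g" using automorphismsD(4)[OF \<tau>A] cA(1) jn(2) by blast
    ultimately have "?g < inf (b' j) (a (rep (F ?g ?C)))"
      using automorphismsD(3)[OF \<tau>(1)] by (simp add: b'_def)
    then show ?thesis using nw[OF k] by blast
  qed
  have fixed: "b' j = b j" if "j < m" "j \<notin> J" for j
    using automorphismsD(4)[OF \<tau>(1), of "b j"] that by (auto simp: b'_def)
  show ?thesis
  proof (rule dominatesI[OF p q A a b'])
    fix D e assume D: "small D" "A \<subseteq> D" "\<And>x y. x \<in> D \<Longrightarrow> y \<in> D \<Longrightarrow> inf x y \<in> D" and e: "rlz n p D e"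
      and same: "\<And>\<phi>. \<phi> \<in> formulas (n + m) A \<Longrightarrow> sat e \<phi> \<longleftrightarrow> sat (join n a b') \<phi>"
    define y where "y = (\<lambda>i. e (n + i))"
    have yA: "rlz m q A y"
    proof (rule rlz_transfer[OF b'])
      fix \<phi> :: "'a fm" assume "\<phi> \<in> formulas m A"
      then show "sat b' \<phi> \<longleftrightarrow> sat y \<phi>"
        using same[OF shift_formulas] by (simp add: sat_shift y_def)
    qed
    show "rlz m q D (\<lambda>i. e (n + i))"
      unfolding y_def[symmetric]
    proof (rule rlz_extend[OF q D(1,3) D(2) yA])
      fix j assume j: "j < m"
      let ?c = "c j"
      have cD: "?c \<in> D" using cA(1)[OF j] D(2) by blast
      show "\<exists>c\<in>A. c \<in> cut q j \<and> anchor q j c \<and> (\<forall>d\<in>D. inf (y j) d \<le> c) \<or>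
       (\<exists>L. gap q j c L \<and> (\<forall>d\<in>D \<inter> L. d < inf (y j) c) \<and> (\<forall>d\<in>D - L. d \<le> c \<longrightarrow> inf (y j) c < d))"
        using cS[OF j]
      proof
        assume an: "?anch j ?c"
        have "inf (y j) d \<le> ?c" if d: "d \<in> D" for d
        proof (cases "j \<in> J")
          case False
          then have "Eq (Var j) (Par ?c) \<in> q" using an j by (auto simp: J_def news_def)
          then show ?thesis using rlz_eq[OF yA j cA(1)[OF j]] by simp
        next
          case True
          \<comment> \<open>That \<open>y j\<close> shares its cone with \<open>e i\<close> is part
            of the small type, and \<open>e i\<close> realises a cone that is new over all of
            \<open>D\<close>.\<close>
          obtain i where i: "i \<in> news n p ?c" "?c < inf (b' j) (a i)" using match[OF True] by blast
          have "i < n" using i(1) by (simp add: news_def)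
          then have ei: "?c < inf (y j) (e i)"
            using same[of "Less (Par ?c) (Meet (Var (n + j)) (Var i))"] i(2) j cA(1)[OF j]
            by (auto simp: formulas_def y_def)
          have cy: "?c \<le> y j" using less_le_trans[OF ei inf_le1] by (rule less_imp_le)
          show ?thesis
          proof (rule ccontr)
            assume "\<not> inf (y j) d \<le> ?c"
            then have "?c < inf (y j) d" using new_above[OF cy] by blast
            then have "?c < inf (e i) d" using inf_greater_trans[of ?c "e i" "y j" d] ei by (simp add: inf.commute)
            then show False using rlz_news(2)[OF e cD i(1) d] by auto
          qed
        qed
        then show ?thesis using an cA(1)[OF j] by blast
      next
        assume "?pt j ?c (S j)"
        then obtain L i where L: "i < n" "one_sided ?c L" "gap q j ?c L" "gap p i ?c L" "?W (S j) L ?c" by blast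
        have "j \<notin> J"
          using gap_cut[OF q j L(2,3)] anchored_not_gap[OF q j] L(3) by (auto simp: J_def news_def)
        then have b'j: "b' j = b j" using fixed j by blast
        let ?z = "inf (a i) ?c"
        have zE: "?z \<in> ?E" using j L(1) by auto
        have cE: "?c \<in> ?E" using cA(1)[OF j] by blast
        have SA: "s \<in> A" if "s \<in> S j" for s using cA(2)[OF j] that by blast
        have up: "inf (y j) ?c \<le> e i" if "inf (b j) ?c \<le> a i"
          using same[of "Le (Meet (Var (n + j)) (Par ?c)) (Var i)"] that L(1) j cA(1)[OF j]
          by (auto simp: formulas_def y_def b'j)
        have down: "inf (e i) ?c \<le> y j" if "inf (a i) ?c \<le> b j"
          using same[of "Le (Meet (Var i) (Par ?c)) (Var (n + j))"] that L(1) j cA(1)[OF j]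
          by (auto simp: formulas_def y_def b'j)
        note ge = rlz_gap[OF e L(4,1) cD] and ga = rlz_gap[OF a L(4,1) cA(1)[OF j]]
          and gb = rlz_gap[OF bE L(3) j cE] and gy = rlz_gap[OF yA L(3) j cA(1)[OF j]]
        have "(\<forall>d\<in>D \<inter> L. d < inf (y j) ?c) \<and> (\<forall>d\<in>D - L. d \<le> ?c \<longrightarrow> inf (y j) ?c < d)"
          using L(5)
        proof
          assume W: "\<forall>l\<in>L. \<exists>s\<in>S j \<inter> L. l \<le> s"
          \<comment> \<open>Here \<open>S j\<close> controls \<open>L\<close>, so the meet of
            \<open>a i\<close> falls on the large side. The meet of \<open>b j\<close> is therefore
            below it, and the small type carries this over to \<open>y j\<close> and
            \<open>e i\<close>.\<close>
          have "?z \<notin> L"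
          proof
            assume "?z \<in> L"
            then obtain s where "s \<in> S j" "s \<in> L" "?z \<le> s" using W by blast
            then show False using ga(1)[OF SA] by (auto simp: less_le_not_le)
          qed
          then have "inf (b j) ?c < ?z" using gb(2)[OF zE] by simp
          then have "inf (b j) ?c \<le> a i" by (rule less_imp_le[OF less_le_trans[OF _ inf_le1]])
          then have le: "inf (y j) ?c \<le> inf (e i) ?c" using up by simp
          have "inf (y j) ?c < d" if "d \<in> D" "d \<notin> L" "d \<le> ?c" for d
            using le_less_trans[OF le ge(2)[OF that]] .
          moreover have "d < inf (y j) ?c" if d: "d \<in> L" for d
          proof -
            obtain s where s: "s \<in> S j" "s \<in> L" "d \<le> s" using W d by blast
            then show ?thesis using le_less_trans[OF s(3) gy(1)[OF SA]] by blast
          qed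
          ultimately show ?thesis by blast
        next
          assume W: "\<forall>m\<le>?c. m \<notin> L \<longrightarrow> (\<exists>s\<in>S j - L. s \<le> m)"
          have Sc: "s \<le> m \<Longrightarrow> m \<le> ?c \<Longrightarrow> s \<le> ?c" for s m by (rule order_trans)
          have "?z \<in> L"
          proof (rule ccontr)
            assume "?z \<notin> L"
            then obtain s where s: "s \<in> S j" "s \<notin> L" "s \<le> ?z" using W inf_le2[of "a i" ?c] by blast
            then show False using ga(2)[OF SA[OF s(1)] s(2)] by (auto simp: less_le_not_le)
          qed
          then have "?z < inf (b j) ?c" using gb(1)[OF zE] by simp
          then have "?z \<le> b j" by (rule less_imp_le[OF less_le_trans[OF _ inf_le1]])
          then have le: "inf (e i) ?c \<le> inf (y j) ?c" using down by simp
          have "d < inf (y j) ?c" if "d \<in> D" "d \<in> L" for d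
            using less_le_trans[OF ge(1)[OF that] le] .
          moreover have "inf (y j) ?c < d" if d: "d \<notin> L" "d \<le> ?c" for d
          proof -
            obtain s where s: "s \<in> S j" "s \<notin> L" "s \<le> d" using W d by blast
            then show ?thesis using less_le_trans[OF gy(2)[OF SA[OF s(1)] s(2) Sc[OF s(3) d(2)]] s(3)] by blast
          qed
          ultimately show ?thesis by blast
        qed
        then show ?thesis using L(3) cA(1)[OF j] by blast
      qed
    qed
  qed
qed

lemma dominates_iff:
  fixes p q :: "'a fm set"
  assumes "(n, p) \<in> inv_types \<kappa>" "(m, q) \<in> inv_types \<kappa>"
  shows "dominates \<kappa> (n, p) (m, q) \<longleftrightarrow>
    pts m q \<subseteq> pts n p \<and> (\<forall>g. card (new_cones m q g) \<le> card (new_cones n p g))"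
proof -
  have p: "p \<in> types n UNIV" and q: "q \<in> types m UNIV" "\<exists>B. small B \<and> invariant B q"
    using assms by (auto simp: inv_types_def)
  then show ?thesis
    using dominates_pts[OF p q(1)] dominates_new_cones[OF p q(1)] dominates_if[OF p q(1)] by blast
qed

end

section \<open>Tensor products\<close>

definition plug :: "nat \<Rightarrow> (nat \<Rightarrow> 'a) \<Rightarrow> 'a fm \<Rightarrow> 'a fm" where
  "plug n b = fsubst (\<lambda>i. if i < n then Var i else Par (b (i - n)))"

lemma sat_plug: "sat e (plug n b \<phi>) \<longleftrightarrow> sat (join n e b) \<phi>"
proof -
  have "(\<lambda>i. tval e (if i < n then Var i else Par (b (i - n)))) = join n e b"
    by (auto simp: join_def)
  then show ?thesis by (simp add: plug_def sat_fsubst)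
qed

lemma plug_formulas:
  assumes "\<phi> \<in> formulas (n + m) D" "b ` {..<m} \<subseteq> D"
  shows "plug n b \<phi> \<in> formulas n D"
proof -
  let ?s = "\<lambda>i. if i < n then Var i else Par (b (i - n))"
  have f: "fvars \<phi> \<subseteq> {..<n + m}" "params \<phi> \<subseteq> D" using assms(1) by (auto simp: formulas_def)
  have s: "tparams (?s i) \<subseteq> D \<and> tvars (?s i) \<subseteq> {..<n}" if "i \<in> fvars \<phi>" for i
    using that assms(2) f(1) by (auto simp: image_subset_iff subset_iff)
  have "params (plug n b \<phi>) \<subseteq> D"
    unfolding plug_def by (rule order_trans[OF params_fsubst]) (use f(2) s in blast)
  moreover have "fvars (plug n b \<phi>) \<subseteq> {..<n}"
    unfolding plug_def fvars_fsubst using s by blast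
  ultimately show ?thesis by (simp add: formulas_def)
qed

lemma types_equivalent:
  assumes "p \<in> types n B" "\<phi> \<in> formulas n B" "\<psi> \<in> formulas n B" "\<And>e. sat e \<phi> \<longleftrightarrow> sat e \<psi>"
  shows "\<phi> \<in> p \<longleftrightarrow> \<psi> \<in> p"
  using types_consequence[OF assms(1), of "{\<phi>}" \<psi>] types_consequence[OF assms(1), of "{\<psi>}" \<phi>] assms by auto

lemma invariant_mono: "invariant A p \<Longrightarrow> A \<subseteq> B \<Longrightarrow> invariant B p"
  using automorphisms_mono unfolding invariant_def by blast

text \<open>Lets substitution instances be compared by their truth values instead of a computation
  with renamed parameters.\<close>

lemma invariant_semantic:
  fixes p :: "'a::{ord,inf} fm set"
  assumes p: "p \<in> types n UNIV" "invariant A p" and \<sigma>: "\<sigma> \<in> automorphisms A"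
    and f: "\<phi> \<in> formulas n UNIV" "\<psi> \<in> formulas n UNIV" "\<And>e. sat (\<lambda>i. \<sigma> (e i)) \<psi> \<longleftrightarrow> sat e \<phi>"
  shows "\<phi> \<in> p \<longleftrightarrow> \<psi> \<in> p"
proof -
  have "\<phi> \<in> p \<longleftrightarrow> map_fm \<sigma> \<phi> \<in> p" using p(2) \<sigma> unfolding invariant_def by blast
  also have "\<dots> \<longleftrightarrow> \<psi> \<in> p"
  proof (rule types_equivalent[OF p(1)])
    show "map_fm \<sigma> \<phi> \<in> formulas n UNIV" using f(1) by (simp add: formulas_def)
    fix e :: "nat \<Rightarrow> 'a"
    have "e = (\<lambda>i. \<sigma> (inv_into UNIV \<sigma> (e i)))" using automorphism_inv(2)[OF \<sigma>] by simp
    then show "sat e (map_fm \<sigma> \<phi>) \<longleftrightarrow> sat e \<psi>"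
      using sat_automorphism[OF \<sigma>, of "\<lambda>i. inv_into UNIV \<sigma> (e i)" \<phi>] f(3)[of "\<lambda>i. inv_into UNIV \<sigma> (e i)"] by simp
  qed (rule f(2))
  finally show ?thesis .
qed

lemma map_fm_inv:
  fixes \<sigma> :: "'a::{ord,inf} \<Rightarrow> 'a"
  assumes "\<sigma> \<in> automorphisms A"
  shows "map_fm \<sigma> (map_fm (inv_into UNIV \<sigma>) \<phi>) = \<phi>" "map_fm (inv_into UNIV \<sigma>) (map_fm \<sigma> \<phi>) = \<phi>"
  using automorphism_inv[OF assms] by (simp_all add: fm.map_comp o_def fm.map_ident)

lemma rlz_image:
  fixes q :: "'a::dense_meet_tree fm set"
  assumes "invariant A q" "\<sigma> \<in> automorphisms A" "rlz n q D a"
  shows "rlz n q (\<sigma> ` D) (\<lambda>i. \<sigma> (a i))"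
  unfolding rlz_def
proof
  fix \<phi> assume \<phi>: "\<phi> \<in> formulas n (\<sigma> ` D)"
  let ?\<psi> = "map_fm (inv_into UNIV \<sigma>) \<phi>"
  have "inv_into UNIV \<sigma> ` \<sigma> ` D = D" using automorphism_inv(3)[OF assms(2)] by (simp add: image_image)
  then have "?\<psi> \<in> formulas n D" using map_fm_formulas[OF \<phi>, of "inv_into UNIV \<sigma>"] by simp
  then have "?\<psi> \<in> q \<longleftrightarrow> sat a ?\<psi>" using rlzD[OF assms(3)] by blast
  moreover have "?\<psi> \<in> q \<longleftrightarrow> \<phi> \<in> q"
    using assms(1,2) map_fm_inv(1)[OF assms(2), of \<phi>] unfolding invariant_def by metis
  moreover have "sat (\<lambda>i. \<sigma> (a i)) \<phi> \<longleftrightarrow> sat a ?\<psi>"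
    using sat_automorphism[OF assms(2), of a ?\<psi>] map_fm_inv(1)[OF assms(2), of \<phi>] by simp
  ultimately show "\<phi> \<in> q \<longleftrightarrow> sat (\<lambda>i. \<sigma> (a i)) \<phi>" by simp
qed

lemma at_cong:
  assumes "cut p i = cut q j" "\<And>g c. above p i g c \<longleftrightarrow> above q j g c"
  shows "at p i pt \<longleftrightarrow> at q j pt"
  using assms by (cases pt) auto

context monster
begin

definition tensor_type :: "nat \<Rightarrow> 'a fm set \<Rightarrow> nat \<Rightarrow> 'a fm set \<Rightarrow> 'a fm set" where
  "tensor_type n p m q = snd (tensor \<kappa> (n, p) (m, q))"

lemma tensor_eq: "tensor \<kappa> (n, p) (m, q) = (n + m, tensor_type n p m q)"
  by (simp add: tensor_def tensor_type_def)

section \<open>The tensor product of two fixed types\<close>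

context
  fixes n m p q A
  assumes p: "p \<in> types n (UNIV :: 'a set)" and q: "q \<in> types m (UNIV :: 'a set)"
    and A: "small A" "invariant A p"
begin

text \<open>Membership does not depend on the choices: two realisations of \<open>q\<close> over the
  same base of invariance of \<open>p\<close> are conjugate over it.\<close>

lemma tensor_mem:
  assumes \<phi>: "\<phi> \<in> formulas (n + m) UNIV" and B: "small B" "invariant B p" "params \<phi> \<subseteq> B" and b: "rlz m q B b"
  shows "\<phi> \<in> tensor_type n p m q \<longleftrightarrow> plug n b \<phi> \<in> p"
proof -
  have def: "\<phi> \<in> tensor_type n p m q \<longleftrightarrow>
      (\<exists>A b. small A \<and> invariant A p \<and> params \<phi> \<subseteq> A \<and> rlz m q A b \<and> plug n b \<phi> \<in> p)"
    using \<phi> by (simp add: tensor_type_def tensor_def plug_def rlz_iff_restrict[OF q])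
  have indep: "plug n b \<phi> \<in> p \<longleftrightarrow> plug n b' \<phi> \<in> p"
    if B: "small B" "invariant B p" "params \<phi> \<subseteq> B" and b: "rlz m q B b" and b': "rlz m q B b'" for B b b'
  proof -
    obtain \<sigma> where \<sigma>: "\<sigma> \<in> automorphisms B" "\<forall>i<m. \<sigma> (b i) = b' i"
      using tuple_automorphism[OF B(1), of m b b'] rlzD[OF b] rlzD[OF b'] by blast
    show ?thesis
    proof (rule invariant_semantic[OF p B(2) \<sigma>(1)])
      show "plug n b \<phi> \<in> formulas n UNIV" "plug n b' \<phi> \<in> formulas n UNIV"
        using plug_formulas[OF \<phi>] by blast+
      fix e
      have "sat (join n (\<lambda>i. \<sigma> (e i)) b') \<phi> \<longleftrightarrow> sat (\<lambda>i. \<sigma> (join n e b i)) \<phi>"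
        by (rule sat_cong) (use \<phi> \<sigma>(2) in \<open>auto simp: join_def formulas_def subset_iff\<close>)
      then show "sat (\<lambda>i. \<sigma> (e i)) (plug n b' \<phi>) \<longleftrightarrow> sat e (plug n b \<phi>)"
        using sat_automorphism_fix[OF \<sigma>(1) B(3)] by (simp add: sat_plug)
    qed
  qed
  show ?thesis
  proof
    assume "\<phi> \<in> tensor_type n p m q"
    then obtain C c where C: "small C" "invariant C p" "params \<phi> \<subseteq> C" "rlz m q C c" "plug n c \<phi> \<in> p"
      using def by blast
    have "small (B \<union> C)" using B C by simp
    \<comment> \<open>Different bases are compared through a realisation over their union, which
      realises \<open>q\<close> over each of them.\<close>
    then obtain d where d: "rlz m q (B \<union> C) d" using ex_rlz[OF q] by blast
    have "rlz m q B d" "rlz m q C d" using rlz_mono[OF d] by blast+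
    then show "plug n b \<phi> \<in> p" using indep[OF B b] indep[OF C(1-4)] C(5) by blast
  qed (use def B b in blast)
qed

lemma tensor_rlz_over:
  assumes B: "small B" "A \<subseteq> B" and b: "rlz m q B b" and a: "rlz n p (B \<union> b ` {..<m}) a"
  shows "rlz (n + m) (tensor_type n p m q) B (join n a b)"
  unfolding rlz_def
proof
  fix \<phi> assume \<phi>: "\<phi> \<in> formulas (n + m) B"
  then have "\<phi> \<in> formulas (n + m) UNIV" "params \<phi> \<subseteq> B" by (auto simp: formulas_def)
  then have "\<phi> \<in> tensor_type n p m q \<longleftrightarrow> plug n b \<phi> \<in> p"
    using tensor_mem B b invariant_mono[OF A(2)] by blast
  also have "\<dots> \<longleftrightarrow> sat a (plug n b \<phi>)"
    using rlzD[OF a] plug_formulas[of \<phi> n m "B \<union> b ` {..<m}" b] \<phi>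
      formulas_mono[of "n + m" "n + m" B "B \<union> b ` {..<m}"] by blast
  finally show "\<phi> \<in> tensor_type n p m q \<longleftrightarrow> sat (join n a b) \<phi>" by (simp add: sat_plug)
qed

lemma tensor_rlz:
  assumes "small B"
  shows "\<exists>a b. rlz n p (B \<union> b ` {..<m}) a \<and> rlz m q B b \<and> rlz (n + m) (tensor_type n p m q) B (join n a b)"
proof -
  have s: "small (A \<union> B)" using A assms by simp
  obtain b where b: "rlz m q (A \<union> B) b" using ex_rlz[OF q s] by blast
  have "small (A \<union> B \<union> b ` {..<m})" using s by simp
  then obtain a where a: "rlz n p (A \<union> B \<union> b ` {..<m}) a" using ex_rlz[OF p] by blast
  have "rlz (n + m) (tensor_type n p m q) (A \<union> B) (join n a b)"
    using tensor_rlz_over[OF s _ b a] by blast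
  then have "rlz (n + m) (tensor_type n p m q) B (join n a b)" "rlz m q B b" "rlz n p (B \<union> b ` {..<m}) a"
    using rlz_mono[OF a, of "B \<union> b ` {..<m}"] rlz_mono[OF b, of B] by (auto elim: rlz_mono)
  then show ?thesis by blast
qed

lemma tensor_in_types: "tensor_type n p m q \<in> types (n + m) UNIV"
  unfolding types_iff
proof (intro conjI ballI)
  show sub: "tensor_type n p m q \<subseteq> formulas (n + m) UNIV" by (auto simp: tensor_type_def tensor_def)
  show "fin_sat (tensor_type n p m q)"
    unfolding fin_sat_def
  proof (intro allI impI, elim conjE)
    fix F assume F: "finite F" "F \<subseteq> tensor_type n p m q"
    have "finite (\<Union>\<phi>\<in>F. params \<phi>)" using F(1) finite_params by blast
    then obtain e where e: "rlz (n + m) (tensor_type n p m q) (\<Union>\<phi>\<in>F. params \<phi>) e"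
      using tensor_rlz[OF small_finite] by blast
    have "sat e \<phi>" if "\<phi> \<in> F" for \<phi>
      using rlzD[OF e, of \<phi>] F(2) sub that by (auto simp: formulas_def subset_iff)
    then show "\<exists>e. \<forall>\<phi>\<in>F. sat e \<phi>" by blast
  qed
  fix \<phi> :: "'a fm" assume \<phi>: "\<phi> \<in> formulas (n + m) UNIV"
  obtain e where e: "rlz (n + m) (tensor_type n p m q) (params \<phi>) e"
    using tensor_rlz[OF small_finite[OF finite_params(1)]] by blast
  show "\<phi> \<in> tensor_type n p m q \<or> Neg \<phi> \<in> tensor_type n p m q"
    using rlzD[OF e, of \<phi>] rlzD[OF e, of "Neg \<phi>"] \<phi> by (auto simp: formulas_def)
qed

lemma tensor_invariant:
  assumes C: "invariant C q"
  shows "invariant (A \<union> C) (tensor_type n p m q)"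
  unfolding invariant_def
proof (intro ballI allI)
  fix \<sigma> \<phi> assume \<sigma>: "\<sigma> \<in> automorphisms (A \<union> C)"
  have \<sigma>A: "\<sigma> \<in> automorphisms A" and \<sigma>C: "\<sigma> \<in> automorphisms C" using automorphisms_mono[OF \<sigma>] by blast+
  show "\<phi> \<in> tensor_type n p m q \<longleftrightarrow> map_fm \<sigma> \<phi> \<in> tensor_type n p m q"
  proof (cases "\<phi> \<in> formulas (n + m) UNIV")
    case False
    then have "map_fm \<sigma> \<phi> \<notin> formulas (n + m) UNIV" by (simp add: formulas_def)
    then show ?thesis using False tensor_in_types by (auto simp: types_iff)
  next
    case True
    then have mf: "map_fm \<sigma> \<phi> \<in> formulas (n + m) UNIV" by (simp add: formulas_def)
    let ?B = "A \<union> params \<phi>"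
    have B: "small ?B" using A(1) finite_params by simp
    obtain b where b: "rlz m q ?B b" using ex_rlz[OF q B] by blast
    have b': "rlz m q (\<sigma> ` ?B) (\<lambda>i. \<sigma> (b i))" by (rule rlz_image[OF C \<sigma>C b])
    have "A \<subseteq> \<sigma> ` ?B" using automorphismsD(4)[OF \<sigma>A] by force
    moreover have "params (map_fm \<sigma> \<phi>) \<subseteq> \<sigma> ` ?B" by (simp add: fm.set_map image_mono)
    ultimately have "map_fm \<sigma> \<phi> \<in> tensor_type n p m q \<longleftrightarrow> plug n (\<lambda>i. \<sigma> (b i)) (map_fm \<sigma> \<phi>) \<in> p"
      using tensor_mem[OF mf small_image[OF B] invariant_mono[OF A(2)] _ b'] by blast
    also have "\<dots> \<longleftrightarrow> plug n b \<phi> \<in> p"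
    proof (rule invariant_semantic[OF p A(2) \<sigma>A, symmetric])
      show "plug n b \<phi> \<in> formulas n UNIV" "plug n (\<lambda>i. \<sigma> (b i)) (map_fm \<sigma> \<phi>) \<in> formulas n UNIV"
        using plug_formulas[OF True] plug_formulas[OF mf] by blast+
      fix e
      have "join n (\<lambda>i. \<sigma> (e i)) (\<lambda>i. \<sigma> (b i)) = (\<lambda>i. \<sigma> (join n e b i))" by (auto simp: join_def)
      then show "sat (\<lambda>i. \<sigma> (e i)) (plug n (\<lambda>i. \<sigma> (b i)) (map_fm \<sigma> \<phi>)) \<longleftrightarrow> sat e (plug n b \<phi>)"
        using sat_automorphism[OF \<sigma>] by (simp add: sat_plug)
    qed
    also have "\<dots> \<longleftrightarrow> \<phi> \<in> tensor_type n p m q"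
      using tensor_mem[OF True B invariant_mono[OF A(2)] _ b] by simp
    finally show ?thesis by simp
  qed
qed

abbreviation (input) "t \<equiv> tensor_type n p m q"

lemma tensor_left:
  assumes "i < n"
  shows "cut t i = cut p i" "above t i g c \<longleftrightarrow> above p i g c" "Eq (Var i) (Par g) \<in> t \<longleftrightarrow> Eq (Var i) (Par g) \<in> p"
    "anchor t i g \<longleftrightarrow> anchor p i g" "j < n \<Longrightarrow> joined t g i j \<longleftrightarrow> joined p g i j"
proof -
  have r: "\<exists>a a'. rlz n p B a \<and> rlz (n + m) t B a' \<and> (\<forall>i<n. a' i = a i)" if "finite B" for B
  proof -
    obtain a b where ab: "rlz n p (B \<union> b ` {..<m}) a" "rlz (n + m) t B (join n a b)"
      using tensor_rlz[OF small_finite[OF \<open>finite B\<close>]] by blast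
    have "rlz n p B a" using rlz_mono[OF ab(1)] by blast
    then show ?thesis using ab(2) by (intro exI[of _ a] exI[of _ "join n a b"]) simp
  qed
  have i: "i < n + m" using assms by simp
  have "u \<in> cut t i \<longleftrightarrow> u \<in> cut p i" for u
  proof -
    obtain a a' where "rlz n p {u} a" "rlz (n + m) t {u} a'" "a' i = a i" using r[of "{u}"] assms by blast
    then show ?thesis using rlz_cut[of n p "{u}" a i u] rlz_cut[of "n + m" t "{u}" a' i u] assms i by simp
  qed
  then show "cut t i = cut p i" by blast
  obtain a a' where a: "rlz n p {g, c} a" "rlz (n + m) t {g, c} a'" "\<And>i. i < n \<Longrightarrow> a' i = a i"
    using r[of "{g, c}"] by auto
  show "above t i g c \<longleftrightarrow> above p i g c" using rlz_above[OF a(1)] rlz_above[OF a(2)] a(3) assms i by simp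
  show "Eq (Var i) (Par g) \<in> t \<longleftrightarrow> Eq (Var i) (Par g) \<in> p"
    using rlz_eq[OF a(1)] rlz_eq[OF a(2)] a(3) assms i by simp
  show "j < n \<Longrightarrow> joined t g i j \<longleftrightarrow> joined p g i j"
    using rlz_joined[OF a(1)] rlz_joined[OF a(2)] a(3) assms i by simp
  have "Le (Meet (Var i) (Par d)) (Par g) \<in> t \<longleftrightarrow> Le (Meet (Var i) (Par d)) (Par g) \<in> p" for d
  proof -
    obtain a a' where a: "rlz n p {g, d} a" "rlz (n + m) t {g, d} a'" "\<And>i. i < n \<Longrightarrow> a' i = a i"
      using r[of "{g, d}"] by auto
    then show ?thesis using rlz_meet_le[OF a(1)] rlz_meet_le[OF a(2)] assms i by simp
  qed
  then show "anchor t i g \<longleftrightarrow> anchor p i g" by (simp add: anchor_def)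
qed

lemma tensor_right:
  assumes "i < m"
  shows "cut t (n + i) = cut q i" "above t (n + i) g c \<longleftrightarrow> above q i g c"
    "Eq (Var (n + i)) (Par g) \<in> t \<longleftrightarrow> Eq (Var i) (Par g) \<in> q"
    "anchor t (n + i) g \<longleftrightarrow> anchor q i g" "j < m \<Longrightarrow> joined t g (n + i) (n + j) \<longleftrightarrow> joined q g i j"
proof -
  have r: "\<exists>a a'. rlz m q B a \<and> rlz (n + m) t B a' \<and> (\<forall>i<m. a' (n + i) = a i)" if "finite B" for B
  proof -
    obtain a b where ab: "rlz m q B b" "rlz (n + m) t B (join n a b)"
      using tensor_rlz[OF small_finite[OF \<open>finite B\<close>]] by blast
    then show ?thesis by (intro exI[of _ b] exI[of _ "join n a b"]) simp
  qed
  have i: "n + i < n + m" using assms by simp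
  have "u \<in> cut t (n + i) \<longleftrightarrow> u \<in> cut q i" for u
  proof -
    obtain a a' where "rlz m q {u} a" "rlz (n + m) t {u} a'" "a' (n + i) = a i" using r[of "{u}"] assms by blast
    then show ?thesis using rlz_cut[of m q "{u}" a i u] rlz_cut[of "n + m" t "{u}" a' "n + i" u] assms i by simp
  qed
  then show "cut t (n + i) = cut q i" by blast
  obtain a a' where a: "rlz m q {g, c} a" "rlz (n + m) t {g, c} a'" "\<And>i. i < m \<Longrightarrow> a' (n + i) = a i"
    using r[of "{g, c}"] by auto
  show "above t (n + i) g c \<longleftrightarrow> above q i g c" using rlz_above[OF a(1)] rlz_above[OF a(2)] a(3) assms i by simp
  show "Eq (Var (n + i)) (Par g) \<in> t \<longleftrightarrow> Eq (Var i) (Par g) \<in> q"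
    using rlz_eq[OF a(1)] rlz_eq[OF a(2)] a(3) assms i by simp
  show "j < m \<Longrightarrow> joined t g (n + i) (n + j) \<longleftrightarrow> joined q g i j"
    using rlz_joined[OF a(1)] rlz_joined[OF a(2)] a(3) assms i by simp
  have "Le (Meet (Var (n + i)) (Par d)) (Par g) \<in> t \<longleftrightarrow> Le (Meet (Var i) (Par d)) (Par g) \<in> q" for d
  proof -
    obtain a a' where a: "rlz m q {g, d} a" "rlz (n + m) t {g, d} a'" "\<And>i. i < m \<Longrightarrow> a' (n + i) = a i"
      using r[of "{g, d}"] by auto
    then show ?thesis using rlz_meet_le[OF a(1)] rlz_meet_le[OF a(2)] assms i by simp
  qed
  then show "anchor t (n + i) g \<longleftrightarrow> anchor q i g" by (simp add: anchor_def)
qed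

lemma less_add_cases: "i < n + m \<longleftrightarrow> i < n \<or> (\<exists>j<m. i = n + j)" for i :: nat
  by (metis add_less_cancel_left less_imp_add_positive not_less le_add_diff_inverse trans_less_add1)

lemma tensor_pts: "pts (n + m) t = pts n p \<union> pts m q"
proof -
  have "(\<exists>i<n + m. at t i pt) \<longleftrightarrow> (\<exists>i<n. at p i pt) \<or> (\<exists>j<m. at q j pt)" for pt
    unfolding less_add_cases using at_cong[OF tensor_left(1,2)] at_cong[OF tensor_right(1,2)] by blast
  then show ?thesis by (auto simp: pts_def)
qed

lemma tensor_news: "news (n + m) t g = news n p g \<union> (+) n ` news m q g"
  unfolding news_def less_add_cases using tensor_left tensor_right by (auto simp: image_iff)

text \<open>The tuple for \<open>p\<close> is new over a set that contains the tuple for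
  \<open>q\<close>, so its new cones above \<open>g\<close> avoid that tuple.\<close>

lemma tensor_not_joined:
  assumes "i \<in> news n p g" "j \<in> news m q g"
  shows "\<not> joined t g i (n + j)" "\<not> joined t g (n + j) i"
proof -
  have l: "i < n" "j < m" "anchor p i g" using assms by (auto simp: news_def)
  obtain a b where ab: "rlz n p ({g} \<union> b ` {..<m}) a" "rlz (n + m) t {g} (join n a b)"
    using tensor_rlz[of "{g}"] by auto
  have "inf (a i) (b j) \<le> g" using rlz_anchor[OF ab(1) l(3,1)] l(2) by auto
  then show "\<not> joined t g i (n + j)" "\<not> joined t g (n + j) i"
    using rlz_joined[OF ab(2)] l by (auto simp: inf.commute less_le_not_le)
qed

text \<open>No cone of \<open>p\<close> merges with a cone of \<open>q\<close>; those of
  \<open>q\<close> reappear with their variables shifted by \<open>n\<close>.\<close>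

lemma tensor_new_cones:
  "card (new_cones (n + m) t g) = card (new_cones n p g) + card (new_cones m q g)"
proof -
  have 1: "cone_class (n + m) t g i = cone_class n p g i" if "i \<in> news n p g" for i
    using that tensor_left(5) tensor_not_joined unfolding cone_class_def tensor_news by (auto simp: news_def)
  have 2: "cone_class (n + m) t g (n + j) = (+) n ` cone_class m q g j" if "j \<in> news m q g" for j
    using that tensor_right(5) tensor_not_joined unfolding cone_class_def tensor_news by (auto simp: news_def)
  have eq: "new_cones (n + m) t g = new_cones n p g \<union> (`) ((+) n) ` new_cones m q g"
    unfolding new_cones_def tensor_news image_Un using 1 2 by (simp add: image_image)
  have "X \<inter> Y = {} \<and> X \<noteq> {}" if "X \<in> new_cones n p g" "Y \<in> (`) ((+) n) ` new_cones m q g" for X Y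
    using that cone_class_self[OF p] by (auto simp: new_cones_def cone_class_def news_def)
  then have "new_cones n p g \<inter> (`) ((+) n) ` new_cones m q g = {}" by blast
  moreover have "inj_on ((`) ((+) n)) (new_cones m q g)"
    by (rule inj_onI) (metis inj_image_eq_iff inj_on_add)
  ultimately show ?thesis unfolding eq by (simp add: card_Un_disjoint finite_new_cones card_image)
qed

end

section \<open>Types in one variable\<close>

text \<open>By \<open>rlz_extend\<close> a type in one variable with anchor \<open>c\<close> is
  determined by its cut, so an automorphism preserving the cut and fixing \<open>c\<close> preserves
  the type.\<close>

lemma one_type_invariant:
  fixes p :: "'a fm set"
  assumes p: "p \<in> types 1 UNIV" and A: "small A" "c \<in> A"
    and cut: "\<And>\<sigma> u. \<sigma> \<in> automorphisms A \<Longrightarrow> \<sigma> u \<in> cut p 0 \<longleftrightarrow> u \<in> cut p 0"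
    and c: "c \<in> cut p 0 \<and> anchor p 0 c \<or> gap p 0 c (cut p 0)"
  shows "invariant A p"
proof -
  have fwd: "map_fm \<sigma> \<phi> \<in> p" if \<sigma>: "\<sigma> \<in> automorphisms A" and \<phi>: "\<phi> \<in> p" for \<sigma> \<phi>
  proof -
    let ?D = "icl (insert c (params \<phi>))" and ?\<sigma>D = "\<sigma> ` icl (insert c (params \<phi>))"
    have D: "small ?D" "params \<phi> \<subseteq> ?D" "c \<in> ?D"
      using finite_icl[of "insert c (params \<phi>)"] finite_params subset_icl[of "insert c (params \<phi>)"] by auto
    obtain a where a: "rlz 1 p ?D a" using ex_rlz[OF p D(1)] by blast
    have \<sigma>c: "\<sigma> c = c" using automorphismsD(4)[OF \<sigma> A(2)] .
    have "\<sigma> \<in> automorphisms {c}" using automorphisms_mono[OF \<sigma>] A(2) by blast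
    then have ac: "rlz 1 p {c} (\<lambda>i. \<sigma> (a i))"
      using rlz_automorphism rlz_mono[OF a, of "{c}"] D(3) by blast
    have inf: "inf (\<sigma> x) (\<sigma> y) = \<sigma> (inf x y)" for x y using automorphismsD(3)[OF \<sigma>] by simp
    have infc: "inf (\<sigma> x) c = \<sigma> (inf x c)" for x using inf[of x c] \<sigma>c by simp
    have "rlz 1 p ?\<sigma>D (\<lambda>i. \<sigma> (a i))"
    proof (rule rlz_extend[OF p small_image[OF D(1)] _ _ ac])
      show "inf x y \<in> ?\<sigma>D" if "x \<in> ?\<sigma>D" "y \<in> ?\<sigma>D" for x y
        using that icl_closed inf by (auto simp: image_iff)
      show "{c} \<subseteq> ?\<sigma>D" using D(3) \<sigma>c by (metis empty_subsetI image_eqI insert_subset)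
      fix i :: nat assume "i < 1"
      then have i: "i = 0" by simp
      have "c \<in> cut p i \<and> anchor p i c \<and> (\<forall>d\<in>?\<sigma>D. inf (\<sigma> (a i)) d \<le> c) \<or>
       (\<exists>L. gap p i c L \<and> (\<forall>d\<in>?\<sigma>D \<inter> L. d < inf (\<sigma> (a i)) c) \<and> (\<forall>d\<in>?\<sigma>D - L. d \<le> c \<longrightarrow> inf (\<sigma> (a i)) c < d))"
        using c
      proof
        assume *: "c \<in> cut p 0 \<and> anchor p 0 c"
        have "inf (\<sigma> (a i)) (\<sigma> d) \<le> c" if "d \<in> ?D" for d
          using rlz_anchor[OF a _ _ that D(3), of 0] * automorphism_le[OF \<sigma>, of "inf (a 0) d" c] \<sigma>c i
          by (simp add: inf)
        then show ?thesis using * i by blast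
      next
        assume *: "gap p 0 c (cut p 0)"
        have "\<sigma> d < inf (\<sigma> (a i)) c" if "d \<in> ?D" "\<sigma> d \<in> cut p 0" for d
          using rlz_gap(1)[OF a * _ D(3) that(1)] that(2) cut[OF \<sigma>] automorphismsD(2)[OF \<sigma>] i by (simp add: infc)
        moreover have "inf (\<sigma> (a i)) c < \<sigma> d" if "d \<in> ?D" "\<sigma> d \<notin> cut p 0" "\<sigma> d \<le> c" for d
        proof -
          have "d \<le> c" using that(3) automorphism_le[OF \<sigma>, of d c] \<sigma>c by simp
          then show ?thesis
            using rlz_gap(2)[OF a * _ D(3) that(1)] that(2) cut[OF \<sigma>] automorphismsD(2)[OF \<sigma>] i by (simp add: infc)
        qed
        ultimately show ?thesis using * i by blast
      qed
      then show "\<exists>c'\<in>{c}. c' \<in> cut p i \<and> anchor p i c' \<and> (\<forall>d\<in>?\<sigma>D. inf (\<sigma> (a i)) d \<le> c') \<or>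
       (\<exists>L. gap p i c' L \<and> (\<forall>d\<in>?\<sigma>D \<inter> L. d < inf (\<sigma> (a i)) c') \<and> (\<forall>d\<in>?\<sigma>D - L. d \<le> c' \<longrightarrow> inf (\<sigma> (a i)) c' < d))"
        by blast
    qed
    moreover have f: "\<phi> \<in> formulas 1 ?D" using p \<phi> D(2) by (auto simp: types_iff formulas_def)
    ultimately show ?thesis
      using rlzD[OF a f] rlzD[of 1 p ?\<sigma>D "\<lambda>i. \<sigma> (a i)" "map_fm \<sigma> \<phi>"] map_fm_formulas[OF f] \<phi> sat_automorphism[OF \<sigma>]
      by blast
  qed
  then show ?thesis
    unfolding invariant_def using automorphism_inv(1) map_fm_inv(2) by metis
qed

lemma inv_typesI: "p \<in> types n UNIV \<Longrightarrow> small A \<Longrightarrow> invariant A p \<Longrightarrow> (n, p) \<in> inv_types \<kappa>"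
  by (auto simp: inv_types_def)

text \<open>The base consists of \<open>c\<close> and a small set approaching the cut from one side:
  an automorphism fixing these preserves the cut.\<close>

lemma at_inv_type:
  fixes p :: "'a fm set"
  assumes p: "p \<in> types 1 UNIV" and pt: "pt \<in> points \<kappa>" "at p 0 pt"
  shows "(1, p) \<in> inv_types \<kappa>"
proof -
  obtain c L where cL: "one_sided c L" "gap p 0 c L"
    using point_one_sided[OF pt(1)] p pt(2) by (metis zero_less_one)
  have L: "cut p 0 = L" using gap_cut[OF p _ cL] by simp
  obtain S where S: "small S" "(\<forall>l\<in>L. \<exists>s\<in>S \<inter> L. l \<le> s) \<or> (\<forall>m\<le>c. m \<notin> L \<longrightarrow> (\<exists>s\<in>S - L. s \<le> m))"
    using one_sided_witness[OF cL(1)] by blast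
  have dn: "l \<in> L \<Longrightarrow> u \<le> l \<Longrightarrow> u \<in> L" "l \<in> L \<Longrightarrow> l \<le> c" for l u
    using cL(1) by (auto simp: one_sided_def less_imp_le)
  have "invariant (insert c S) p"
  proof (rule one_type_invariant[OF p])
    fix \<sigma> u assume \<sigma>: "\<sigma> \<in> automorphisms (insert c S)"
    have fix_S: "\<sigma> s = s" if "s \<in> insert c S" for s using automorphismsD(4)[OF \<sigma> that] .
    have le: "\<sigma> u \<le> s \<longleftrightarrow> u \<le> s" "s \<le> \<sigma> u \<longleftrightarrow> s \<le> u" if "s \<in> insert c S" for s
      using automorphism_le[OF \<sigma>, of u s] automorphism_le[OF \<sigma>, of s u] fix_S[OF that] by simp_all
    show "\<sigma> u \<in> cut p 0 \<longleftrightarrow> u \<in> cut p 0"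
      using S(2)
    proof
      assume W: "\<forall>l\<in>L. \<exists>s\<in>S \<inter> L. l \<le> s"
      then have "x \<in> L \<longleftrightarrow> (\<exists>s\<in>S \<inter> L. x \<le> s)" for x using dn(1) by blast
      then have "\<sigma> u \<in> L \<longleftrightarrow> (\<exists>s\<in>S \<inter> L. \<sigma> u \<le> s)" "u \<in> L \<longleftrightarrow> (\<exists>s\<in>S \<inter> L. u \<le> s)" by blast+
      moreover have "(\<exists>s\<in>S \<inter> L. \<sigma> u \<le> s) \<longleftrightarrow> (\<exists>s\<in>S \<inter> L. u \<le> s)" using le(1) by (meson IntD1 insertCI)
      ultimately show ?thesis by (simp add: L)
    next
      assume W: "\<forall>m\<le>c. m \<notin> L \<longrightarrow> (\<exists>s\<in>S - L. s \<le> m)"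
      then have "x \<in> L \<longleftrightarrow> x \<le> c \<and> \<not> (\<exists>s\<in>S - L. s \<le> x)" for x using dn by blast
      then have "\<sigma> u \<in> L \<longleftrightarrow> \<sigma> u \<le> c \<and> \<not> (\<exists>s\<in>S - L. s \<le> \<sigma> u)" "u \<in> L \<longleftrightarrow> u \<le> c \<and> \<not> (\<exists>s\<in>S - L. s \<le> u)"
        by blast+
      moreover have "(\<exists>s\<in>S - L. s \<le> \<sigma> u) \<longleftrightarrow> (\<exists>s\<in>S - L. s \<le> u)" using le(2) by (meson DiffD1 insertCI)
      ultimately show ?thesis using le(1)[of c] by (simp add: L)
    qed
  qed (use S(1) cL(2) L in auto)
  then show ?thesis using inv_typesI[OF p, of "insert c S"] S(1) by simp
qed

lemma ex_gap_type:
  assumes "one_sided c L"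
  shows "\<exists>p\<in>types 1 (UNIV :: 'a set). gap p 0 c L \<and> cut p 0 = L \<and> Less (Var 0) (Par c) \<in> p"
proof -
  have L: "\<And>l. l \<in> L \<Longrightarrow> l < c" "\<And>l u. l \<in> L \<Longrightarrow> u \<le> l \<Longrightarrow> u \<in> L" using assms by (auto simp: one_sided_def)
  let ?\<Gamma> = "(\<lambda>l. Less (Par l) (Var 0)) ` L \<union> (\<lambda>m. Less (Var 0) (Par m)) ` ({..c} - L)"
  have lm: "l < m" if "l \<in> L" "m \<le> c" "m \<notin> L" for l m
    using tree_not_le[of m c l] that L(1)[of l] L(2)[of l m] by (auto simp: less_imp_le)
  have c: "c \<in> {..c} - L" using L(1) by auto
  have "fin_sat ?\<Gamma>"
    unfolding fin_sat_def
  proof (intro allI impI, elim conjE)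
    fix F assume F: "finite F" "F \<subseteq> ?\<Gamma>"
    let ?P = "\<Union>\<phi>\<in>F. params \<phi>"
    have fP: "finite ?P" using F(1) finite_params by blast
    have "\<exists>z. (\<forall>l\<in>L \<inter> ?P. l < z) \<and> (\<forall>m\<in>insert c (({..c} - L) \<inter> ?P). z < m)"
      by (rule dense_finite[where c = c]) (use fP lm c L(1) in \<open>auto simp: less_imp_le\<close>)
    then obtain z where "\<forall>l\<in>L \<inter> ?P. l < z" "\<forall>m\<in>({..c} - L) \<inter> ?P. z < m" by auto
    then have "\<forall>\<phi>\<in>F. sat (\<lambda>_. z) \<phi>" using F(2) by fastforce
    then show "\<exists>e. \<forall>\<phi>\<in>F. sat e \<phi>" by blast
  qed
  moreover have "?\<Gamma> \<subseteq> formulas 1 UNIV" by (auto simp: formulas_def)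
  ultimately have "\<exists>p\<in>types 1 UNIV. ?\<Gamma> \<subseteq> p" by (rule extend_to_type)
  then obtain p where p: "p \<in> types 1 UNIV" "?\<Gamma> \<subseteq> p" by (elim bexE)
  have lt: "Less (Par l) (Var 0) \<in> p" if "l \<in> L" for l using p(2) that by auto
  have gt: "Less (Var 0) (Par m) \<in> p" if "m \<le> c" "m \<notin> L" for m using p(2) that by auto
  have "above p 0 l c" if "l \<in> L" for l
  proof -
    obtain a where a: "rlz 1 p {l, c} a" using ex_rlz[OF p(1), of "{l, c}"] by auto
    have "l < a 0" "a 0 < c"
      using rlzD[OF a, of "Less (Par l) (Var 0)"] rlzD[OF a, of "Less (Var 0) (Par c)"] lt[OF that] gt[of c] c
      by (auto simp: formulas_def)
    then show ?thesis using rlz_above[OF a, of 0 l c] by (simp add: inf_absorb1 less_imp_le)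
  qed
  moreover have "m \<notin> cut p 0" if "m \<le> c" "m \<notin> L" for m
  proof -
    obtain a where a: "rlz 1 p {m} a" using ex_rlz[OF p(1), of "{m}"] by auto
    have "a 0 < m" using rlzD[OF a, of "Less (Var 0) (Par m)"] gt[OF that] by (auto simp: formulas_def)
    then show ?thesis using rlz_cut[OF a, of 0 m] by (auto simp: less_le_not_le)
  qed
  ultimately have "gap p 0 c L" by (simp add: gap_def)
  then show ?thesis using p(1) gap_cut[OF p(1) _ assms] gt[of c] c by auto
qed

end

section \<open>The isomorphism\<close>

context monster
begin

section \<open>The invariant of a type and its behaviour under tensor products\<close>

definition FH :: "'a gtype \<Rightarrow> 'a point set \<times> ('a \<Rightarrow>\<^sub>0 nat)" where
  "FH = (\<lambda>(n, p). (pts n p, Abs_poly_mapping (\<lambda>g. card (new_cones n p g))))"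

lemma card_new_cones_eq_0: "card (new_cones n p g) = 0 \<longleftrightarrow> news n p g = {}"
  by (simp add: new_cones_def finite_news)

lemma news_cut:
  assumes "p \<in> types n (UNIV :: 'a set)" "i \<in> news n p g"
  shows "cut p i = {..g}"
proof -
  have i: "i < n" "g \<in> cut p i" "anchor p i g" using assms(2) by (auto simp: news_def)
  have "u \<le> g" if "u \<in> cut p i" for u
  proof -
    obtain a where a: "rlz n p {u, g} a" using ex_rlz[OF assms(1), of "{u, g}"] by auto
    have "u \<le> a i" "inf (a i) u \<le> g" using rlz_cut[OF a i(1)] rlz_anchor[OF a i(3,1)] that by auto
    then show ?thesis by (simp add: inf_absorb2)
  qed
  then show ?thesis using cut_down[OF assms(1) i(1,2)] by auto
qed

text \<open>\<open>Abs_poly_mapping\<close> is meaningful only for finite support. A variable that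
  is new above \<open>g\<close> has cut \<open>{..g}\<close>, so each variable contributes at most
  one \<open>g\<close>.\<close>

lemma lookup_FH:
  assumes "p \<in> types n (UNIV :: 'a set)"
  shows "Poly_Mapping.lookup (snd (FH (n, p))) g = card (new_cones n p g)"
proof -
  have "{g. card (new_cones n p g) \<noteq> 0} \<subseteq> (\<lambda>i. SOME g. cut p i = {..g}) ` {..<n}"
  proof
    fix g assume "g \<in> {g. card (new_cones n p g) \<noteq> 0}"
    then have "news n p g \<noteq> {}" using card_new_cones_eq_0[of n p g] by auto
    then obtain i where i: "i \<in> news n p g" by blast
    have "cut p i = {..g}" by (rule news_cut[OF assms i])
    then have "(SOME g. cut p i = {..g}) = g" by (intro some_equality) auto
    then show "g \<in> (\<lambda>i. SOME g. cut p i = {..g}) ` {..<n}" using i by (auto simp: news_def)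
  qed
  then have "finite {g. card (new_cones n p g) \<noteq> 0}" using finite_subset by blast
  then show ?thesis by (simp add: FH_def lookup_Abs_poly_mapping)
qed

lemma fst_FH: "fst (FH (n, p)) = pts n p"
  by (simp add: FH_def)

lemma finite_pts:
  assumes "p \<in> types n (UNIV :: 'a set)"
  shows "finite (pts n p)"
proof -
  have "finite {pt \<in> points \<kappa>. at p i pt}" if "i < n" for i
  proof (cases "{pt \<in> points \<kappa>. at p i pt} = {}")
    case False
    then obtain pt where "pt \<in> points \<kappa>" "at p i pt" by blast
    then have "{pt \<in> points \<kappa>. at p i pt} \<subseteq> {pt}" using at_unique[OF assms that] by blast
    then show ?thesis using finite_subset by blast
  next
    case True
    then show ?thesis by (metis finite.emptyI)
  qed
  moreover have "pts n p = (\<Union>i\<in>{..<n}. {pt \<in> points \<kappa>. at p i pt})" by (auto simp: pts_def)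
  ultimately show ?thesis by simp
qed

lemma inv_typesD: "(n, p) \<in> inv_types \<kappa> \<Longrightarrow> p \<in> types n (UNIV :: 'a set)"
  by (simp add: inv_types_def)

lemma inv_typesE:
  assumes "(n, p) \<in> inv_types \<kappa>"
  obtains A where "small A" "invariant A p" "p \<in> types n (UNIV :: 'a set)"
  using assms by (auto simp: inv_types_def)

lemma dominates_FH:
  assumes "P \<in> inv_types \<kappa>" "Q \<in> inv_types \<kappa>"
  shows "dominates \<kappa> P Q \<longleftrightarrow> target_le (FH Q) (FH P)"
proof -
  obtain n p m q where PQ: "P = (n, p)" "Q = (m, q)" by (cases P, cases Q)
  have "p \<in> types n UNIV" "q \<in> types m UNIV" using assms PQ inv_typesD by auto
  then have "target_le (FH Q) (FH P) \<longleftrightarrow>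
      pts m q \<subseteq> pts n p \<and> (\<forall>g. card (new_cones m q g) \<le> card (new_cones n p g))"
    unfolding PQ target_le_def by (simp add: case_prod_beta fst_FH lookup_FH)
  then show ?thesis using dominates_iff assms PQ by simp
qed

lemma target_le_antisym: "target_le x y \<Longrightarrow> target_le y x \<Longrightarrow> x = y"
  by (auto simp: target_le_def case_prod_beta prod_eq_iff intro!: poly_mapping_eqI order.antisym)

lemma target_le_refl: "target_le x x"
  by (auto simp: target_le_def)

lemma dom_equiv_iff: "(P, Q) \<in> dom_equiv \<kappa> \<longleftrightarrow> P \<in> inv_types \<kappa> \<and> Q \<in> inv_types \<kappa> \<and> FH P = FH Q"
proof -
  have "dominates \<kappa> P Q \<and> dominates \<kappa> Q P \<longleftrightarrow> FH P = FH Q" if "P \<in> inv_types \<kappa>" "Q \<in> inv_types \<kappa>"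
    unfolding dominates_FH[OF that] dominates_FH[OF that(2,1)] using target_le_antisym target_le_refl by metis
  then show ?thesis unfolding dom_equiv_def by blast
qed

lemma dom_class_eq: "P \<in> inv_types \<kappa> \<Longrightarrow> dom_class \<kappa> P = {Q \<in> inv_types \<kappa>. FH Q = FH P}"
  by (auto simp: dom_class_def dom_equiv_iff)

lemma tensor_inv:
  assumes "P \<in> inv_types \<kappa>" "Q \<in> inv_types \<kappa>"
  shows "tensor \<kappa> P Q \<in> inv_types \<kappa>"
    "FH (tensor \<kappa> P Q) = (fst (FH P) \<union> fst (FH Q), snd (FH P) + snd (FH Q))"
proof -
  obtain n p m q where PQ: "P = (n, p)" "Q = (m, q)" by (cases P, cases Q)
  obtain A where A: "small A" "invariant A p" and p: "p \<in> types n UNIV"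
    using assms(1) PQ inv_typesE by blast
  obtain B where B: "small B" "invariant B q" and q: "q \<in> types m UNIV"
    using assms(2) PQ inv_typesE by blast
  have t: "tensor_type n p m q \<in> types (n + m) UNIV" by (rule tensor_in_types[OF p q A])
  show "tensor \<kappa> P Q \<in> inv_types \<kappa>"
    unfolding PQ tensor_eq
    by (rule inv_typesI[OF t, of "A \<union> B"]) (use A B tensor_invariant[OF p q A B(2)] in auto)
  show "FH (tensor \<kappa> P Q) = (fst (FH P) \<union> fst (FH Q), snd (FH P) + snd (FH Q))"
    unfolding PQ tensor_eq
    by (intro prod_eqI poly_mapping_eqI)
      (simp_all add: fst_FH lookup_FH[OF t] lookup_FH[OF p] lookup_FH[OF q] lookup_add
        tensor_pts[OF p q A] tensor_new_cones[OF p q A])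
qed

lemma anchored_no_point:
  assumes "p \<in> types n (UNIV :: 'a set)" "i < n" "g \<in> cut p i" "anchor p i g" "pt \<in> points \<kappa>"
  shows "\<not> at p i pt"
proof
  assume "at p i pt"
  moreover obtain c L where "one_sided c L"
    "\<forall>n p i. p \<in> types n UNIV \<longrightarrow> i < n \<longrightarrow> (at p i pt \<longleftrightarrow> gap p i c L)"
    using point_one_sided[OF assms(5)] by blast
  ultimately have "gap p i c L" "cut p i = L" using assms(1,2) gap_cut by blast+
  then show False using anchored_not_gap[OF assms(1-4)] by blast
qed

lemma realised_inv:
  assumes "P \<in> realised_types"
  shows "P \<in> inv_types \<kappa>" "FH P = ({}, 0)"
proof -
  obtain n e where P: "P = (n, complete_theory n (UNIV :: 'a set) e)"
    using assms by (auto simp: realised_types_def complete_theory_def)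
  let ?p = "complete_theory n UNIV e"
  have t: "?p \<in> types n UNIV" by (rule complete_theory_types)
  have "invariant (e ` {..<n}) ?p"
    unfolding invariant_def
  proof (intro ballI allI)
    fix \<sigma> \<phi> assume \<sigma>: "\<sigma> \<in> automorphisms (e ` {..<n})"
    show "\<phi> \<in> ?p \<longleftrightarrow> map_fm \<sigma> \<phi> \<in> ?p"
    proof (cases "fvars \<phi> \<subseteq> {..<n}")
      case True
      have "sat (\<lambda>i. \<sigma> (e i)) (map_fm \<sigma> \<phi>) \<longleftrightarrow> sat e (map_fm \<sigma> \<phi>)"
        by (rule sat_cong) (use True automorphismsD(4)[OF \<sigma>] in auto)
      then show ?thesis
        using sat_automorphism[OF \<sigma>, of e \<phi>] by (simp add: complete_theory_def formulas_def)
    qed (simp add: complete_theory_def formulas_def)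
  qed
  then show "P \<in> inv_types \<kappa>" unfolding P using inv_typesI[OF t, of "e ` {..<n}"] by simp
  have r: "rlz n ?p UNIV e" by (auto simp: rlz_def complete_theory_def)
  have real: "e i \<in> cut ?p i" "anchor ?p i (e i)" if "i < n" for i
    using rlz_cut[OF r that] rlz_meet_le[OF r that] by (auto simp: anchor_def)
  have "news n ?p g = {}" for g
  proof -
    have False if i: "i \<in> news n ?p g" for i
      using rlz_news(1)[OF r _ i] rlz_news(2)[OF r _ i, of "e i"] by auto
    then show ?thesis by blast
  qed
  then have "card (new_cones n ?p g) = 0" for g unfolding card_new_cones_eq_0 .
  moreover have "pts n ?p = {}" using anchored_no_point[OF t _ real] by (auto simp: pts_def)
  ultimately show "FH P = ({}, 0)"
    unfolding P by (intro prod_eqI poly_mapping_eqI) (simp_all add: fst_FH lookup_FH[OF t])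
qed

text \<open>By \<open>invariant_variable_cases\<close> a variable that is at no point and in no new
  cone equals an element of the model; these equations determine the type.\<close>

lemma realised_if:
  assumes "P \<in> inv_types \<kappa>" "FH P = ({}, 0)"
  shows "P \<in> realised_types"
proof -
  obtain n p where P: "P = (n, p)" by (cases P)
  obtain A where A: "small A" "invariant A p" and p: "p \<in> types n (UNIV :: 'a set)"
    using assms(1) P inv_typesE by blast
  have pts: "pts n p = {}" using assms(2) fst_FH[of n p] P by simp
  have "card (new_cones n p g) = 0" for g using lookup_FH[OF p, of g] assms(2) P by simp
  then have news: "news n p g = {}" for g unfolding card_new_cones_eq_0 .
  have "\<exists>g. Eq (Var i) (Par g) \<in> p" if "i < n" for i
    using invariant_variable_cases[OF p that A] pts news that by (fastforce simp: pts_def news_def)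
  then obtain e where e: "\<And>i. i < n \<Longrightarrow> Eq (Var i) (Par (e i)) \<in> p" by metis
  have "\<phi> \<in> p \<longleftrightarrow> \<phi> \<in> formulas n UNIV \<and> sat e \<phi>" for \<phi>
  proof (cases "\<phi> \<in> formulas n UNIV")
    case True
    have "small (params \<phi> \<union> e ` {..<n})" using finite_params by simp
    then obtain a where a: "rlz n p (params \<phi> \<union> e ` {..<n}) a" using ex_rlz[OF p] by blast
    have "a i = e i" if "i < n" for i using rlz_eq[OF a that, of "e i"] e[OF that] that by simp
    then have "sat a \<phi> \<longleftrightarrow> sat e \<phi>" using True by (intro sat_cong) (auto simp: formulas_def)
    then show ?thesis using rlzD[OF a, of \<phi>] True by (simp add: formulas_def)
  next
    case False
    then show ?thesis using p by (auto simp: types_iff)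
  qed
  then show ?thesis unfolding P realised_types_def by blast
qed

lemma realised_types_eq: "realised_types = {P \<in> inv_types \<kappa>. FH P = ({} :: 'a point set, 0)}"
  using realised_inv realised_if by blast

lemma FH_point:
  assumes p: "p \<in> types 1 (UNIV :: 'a set)" and pt: "pt \<in> points \<kappa>" "at p 0 pt"
  shows "FH (1, p) = ({pt}, 0)"
proof -
  have "pt' = pt" if "pt' \<in> points \<kappa>" "at p 0 pt'" for pt'
    using at_unique[OF p _ that(1) pt(1) that(2) pt(2)] by simp
  moreover have "pts 1 p = {x \<in> points \<kappa>. at p 0 x}" by (simp add: pts_def)
  ultimately have "pts 1 p = {pt}" using pt by blast
  moreover have "news 1 p g = {}" for g
    using anchored_no_point[OF p _ _ _ pt(1), of 0] pt(2) by (auto simp: news_def)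
  then have "card (new_cones 1 p g) = 0" for g unfolding card_new_cones_eq_0 .
  ultimately show ?thesis
    by (intro prod_eqI poly_mapping_eqI) (simp_all add: fst_FH lookup_FH[OF p] del: One_nat_def)
qed

section \<open>Invariants and existence of the types of each kind\<close>

lemma kind_II_data:
  assumes "kind_II g p"
  shows "p \<in> types 1 (UNIV :: 'a set)" "(1, p) \<in> inv_types \<kappa>" "FH (1, p) = ({}, Poly_Mapping.single g 1)"
proof -
  have k: "Less (Par g) (Var 0) \<in> p" "\<And>b. g < b \<Longrightarrow> Eq (Meet (Var 0) (Par b)) (Par g) \<in> p"
    using assms by (auto simp: kind_II_def)
  show p: "p \<in> types 1 UNIV" using assms by (simp add: kind_II_def)
  \<comment> \<open>Kind (II) mentions only elements above \<open>g\<close>; a \<open>d\<close> that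
    met the variable beyond \<open>g\<close> would be one of them.\<close>
  have anch: "Le (Meet (Var 0) (Par d)) (Par g) \<in> p" for d
  proof -
    have "\<exists>a. rlz 1 p {g, d} a" by (rule ex_rlz[OF p]) simp
    then obtain a where a: "rlz 1 p {g, d} a" by blast
    have g: "g < a 0" using rlzD[OF a, of "Less (Par g) (Var 0)"] k(1) by (simp add: formulas_def)
    have "inf (a 0) d \<le> g"
    proof (rule ccontr)
      assume n: "\<not> inf (a 0) d \<le> g"
      then have "g < inf (a 0) d" using new_above[of g "a 0" d] g by auto
      then have "g < d" by (rule less_le_trans) simp
      then show False using rlzD[OF a, of "Eq (Meet (Var 0) (Par d)) (Par g)"] k(2)[of d] n by (simp add: formulas_def)
    qed
    then show ?thesis using rlz_meet_le[OF a, of 0 d g] by simp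
  qed
  then have an: "anchor p 0 g" by (simp add: anchor_def)
  have "\<exists>a. rlz 1 p {g} a" by (rule ex_rlz[OF p]) simp
  then obtain a where a: "rlz 1 p {g} a" by blast
  have g: "g < a 0" using rlzD[OF a, of "Less (Par g) (Var 0)"] k(1) by (simp add: formulas_def)
  have gc: "g \<in> cut p 0" and ne: "Eq (Var 0) (Par g) \<notin> p"
    using rlz_cut[OF a, of 0 g] rlz_eq[OF a, of 0 g] g by auto
  have news: "news 1 p g = {0}" using gc ne an by (auto simp: news_def)
  have cut: "cut p 0 = {..g}" using news_cut[OF p, of 0 g] news by simp
  have "news 1 p g' = {}" if "g' \<noteq> g" for g'
  proof -
    have False if "i \<in> news 1 p g'" for i
    proof -
      have "i = 0" using that by (simp add: news_def)
      then have "{..g'} = {..g}" using news_cut[OF p that] cut by simp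
      then show False using \<open>g' \<noteq> g\<close> by (metis atMost_eq_iff)
    qed
    then show ?thesis by blast
  qed
  then have c0: "card (new_cones 1 p g') = 0" if "g' \<noteq> g" for g'
    unfolding card_new_cones_eq_0 using that .
  have c1: "card (new_cones 1 p g) = 1" by (simp add: new_cones_def news del: One_nat_def)
  have pts: "pts 1 p = {}" using anchored_no_point[OF p _ gc an] by (auto simp: pts_def)
  show "FH (1, p) = ({}, Poly_Mapping.single g 1)"
    using c0 c1 pts
    by (intro prod_eqI poly_mapping_eqI) (auto simp: fst_FH lookup_FH[OF p] lookup_single when_def simp del: One_nat_def)
  have "invariant {g} p"
  proof (rule one_type_invariant[OF p])
    fix \<sigma> u assume \<sigma>: "\<sigma> \<in> automorphisms {g}"
    show "\<sigma> u \<in> cut p 0 \<longleftrightarrow> u \<in> cut p 0"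
      using automorphism_le[OF \<sigma>, of u g] automorphismsD(4)[OF \<sigma>, of g] cut by simp
  qed (use gc an in auto)
  then show "(1, p) \<in> inv_types \<kappa>" using inv_typesI[OF p, of "{g}"] by simp
qed

lemma ex_kind_II: "\<exists>p. kind_II (g :: 'a) p"
proof -
  let ?\<Gamma> = "insert (Less (Par g) (Var 0)) ((\<lambda>b. Eq (Meet (Var 0) (Par b)) (Par g)) ` {b. g < b})"
  have "fin_sat ?\<Gamma>"
    unfolding fin_sat_def
  proof (intro allI impI, elim conjE)
    fix F assume F: "finite F" "F \<subseteq> ?\<Gamma>"
    have "finite (\<Union>\<phi>\<in>F. params \<phi>)" using F(1) finite_params by blast
    from new_cone_finite[OF this, of g]
    obtain u where u: "g < u" "\<forall>x\<in>(\<Union>\<phi>\<in>F. params \<phi>). inf u x \<le> g" by blast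
    have "sat (\<lambda>_. u) \<phi>" if "\<phi> \<in> F" for \<phi>
    proof -
      have "\<phi> \<in> ?\<Gamma>" using F(2) that by blast
      then consider "\<phi> = Less (Par g) (Var 0)" | b where "g < b" "\<phi> = Eq (Meet (Var 0) (Par b)) (Par g)" by blast
      then show ?thesis
      proof cases
        case 1
        then show ?thesis using u(1) by simp
      next
        case 2
        then have "inf u b \<le> g" using u(2) that by force
        moreover have "g \<le> inf u b" using u(1) 2(1) by (simp add: less_imp_le)
        ultimately have "inf u b = g" by (rule order.antisym)
        then show ?thesis using 2(2) by simp
      qed
    qed
    then show "\<exists>e. \<forall>\<phi>\<in>F. sat e \<phi>" by blast
  qed
  moreover have "?\<Gamma> \<subseteq> formulas 1 UNIV" by (auto simp: formulas_def)
  ultimately have "\<exists>p\<in>types 1 UNIV. ?\<Gamma> \<subseteq> p" by (rule extend_to_type)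
  then obtain p where "p \<in> types 1 UNIV" "?\<Gamma> \<subseteq> p" by (elim bexE)
  then have "kind_II g p" by (auto simp: kind_II_def)
  then show ?thesis by blast
qed

lemma kind_Ia_cut:
  assumes "kind_Ia \<kappa> A p"
  shows "cut p 0 = lowers (A :: 'a set)"
proof
  have p: "p \<in> types 1 UNIV" and k: "\<And>a. a \<in> A \<Longrightarrow> Less (Var 0) (Par a) \<in> p"
    "\<And>b. b \<in> lowers A \<Longrightarrow> Less (Par b) (Var 0) \<in> p"
    using assms by (auto simp: kind_Ia_def lowers_def)
  show "lowers A \<subseteq> cut p 0"
  proof
    fix b assume b: "b \<in> lowers A"
    have "\<exists>a. rlz 1 p {b} a" by (rule ex_rlz[OF p]) simp
    then obtain a where a: "rlz 1 p {b} a" by blast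
    have "b < a 0" using rlzD[OF a, of "Less (Par b) (Var 0)"] k(2)[OF b] by (simp add: formulas_def)
    then show "b \<in> cut p 0" using rlz_cut[OF a, of 0 b] by simp
  qed
  show "cut p 0 \<subseteq> lowers A"
  proof
    fix u assume u: "u \<in> cut p 0"
    have "u < x" if x: "x \<in> A" for x
    proof -
      have "\<exists>a. rlz 1 p {u, x} a" by (rule ex_rlz[OF p]) simp
      then obtain a where a: "rlz 1 p {u, x} a" by blast
      have "a 0 < x" using rlzD[OF a, of "Less (Var 0) (Par x)"] k(1)[OF x] by (simp add: formulas_def)
      moreover have "u \<le> a 0" using rlz_cut[OF a, of 0 u] u by simp
      ultimately show ?thesis by simp
    qed
    then show "u \<in> lowers A" by (simp add: lowers_def)
  qed
qed

text \<open>The meet with \<open>c\<close> sees only the part of the cut below \<open>c\<close>. An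
  element \<open>u\<close> of the cut not below \<open>c\<close> would make \<open>inf u c\<close>
  the maximum of \<open>lowers A\<close>, which is not small cofinal.\<close>

lemma kind_IIIa_cut:
  assumes "kind_IIIa \<kappa> A p" "A \<in> small_coinitial_chains \<kappa>"
  shows "cut p 0 = lowers (A :: 'a set)"
proof -
  have p: "p \<in> types 1 UNIV" using assms(1) by (simp add: kind_IIIa_def)
  obtain c where c: "kind_Ia \<kappa> A (meet_type c p)" using assms(1) by (auto simp: kind_IIIa_def)
  have q: "cut (meet_type c p) 0 = lowers A" by (rule kind_Ia_cut[OF c])
  have mt: "u \<in> lowers A \<longleftrightarrow> u \<in> cut p 0 \<and> u \<le> c" for u
  proof -
    have "\<exists>a. rlz 1 p {u, c} a" by (rule ex_rlz[OF p]) simp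
    then obtain a where a: "rlz 1 p {u, c} a" by blast
    have "Le (Par u) (Var 0) \<in> meet_type c p \<longleftrightarrow> fsubst (\<lambda>_. Meet (Var 0) (Par c)) (Le (Par u) (Var 0)) \<in> p"
      by (simp add: meet_type_def formulas_def)
    also have "\<dots> \<longleftrightarrow> sat a (fsubst (\<lambda>_. Meet (Var 0) (Par c)) (Le (Par u) (Var 0)))"
      by (rule rlzD[OF a]) (simp add: formulas_def Le_def)
    also have "\<dots> \<longleftrightarrow> u \<in> cut p 0 \<and> u \<le> c" using rlz_cut[OF a, of 0 u] by (simp add: sat_fsubst)
    finally show ?thesis using q unfolding cut_def by blast
  qed
  have "u \<le> c" if u: "u \<in> cut p 0" for u
  proof (rule ccontr)
    assume uc: "\<not> u \<le> c"
    have "inf u c \<in> lowers A" using mt[of "inf u c"] cut_down[OF p _ u, of "inf u c"] by simp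
    moreover have "l \<le> inf u c" if "l \<in> lowers A" for l
    proof -
      have l: "l \<in> cut p 0" "l \<le> c" using mt that by auto
      have "l \<le> u \<or> u \<le> l" by (rule cut_chain[OF p _ l(1) u]) simp
      then have "l \<le> u" using uc order_trans[of u l c] l(2) by blast
      then show ?thesis using l(2) by simp
    qed
    ultimately have "has_max (lowers A)" unfolding has_max_def by blast
    then show False using has_max_small_cofinal lowers_not_small_cofinal[OF assms(2)] by blast
  qed
  then show ?thesis using mt by blast
qed

text \<open>Kind (Ia) requires a small chain, so a given chain is replaced by a small coinitial
  subset, which belongs to the same class.\<close>

lemma ex_kind_Ia:
  assumes "K \<in> chain_classes \<kappa>"
  shows "\<exists>A\<in>K. \<exists>p. kind_Ia \<kappa> A (p :: 'a fm set)"
proof -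
  obtain A where A: "A \<in> K" "A \<in> small_coinitial_chains \<kappa>" using chain_class_member[OF assms] by blast
  obtain B c where B: "c \<in> A" "B \<subseteq> A" "small B" "\<And>a. a \<in> A \<Longrightarrow> \<exists>b\<in>B. b \<le> a"
    "\<And>a b. a \<in> A \<Longrightarrow> b \<in> A \<Longrightarrow> a \<le> b \<or> b \<le> a"
    by (rule small_coinitial_chainsE[OF A(2)]) blast
  have Bs: "B \<in> small_coinitial_chains \<kappa>"
    using B unfolding small_coinitial_chains_def Complete_Partial_Order.chain_def by blast
  have AB: "(A, B) \<in> mutually_coinitial \<kappa>" using A(2) Bs B(2,4) by (auto simp: mutually_coinitial_def)
  have "K = mutually_coinitial \<kappa> `` {A}"
    using assms A(1) unfolding chain_classes_def
    by (metis (no_types, lifting) Image_singleton_iff equiv_class_eq equiv_mutually_coinitial quotientE)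
  then have BK: "B \<in> K" using AB by blast
  obtain p where p: "p \<in> types 1 (UNIV :: 'a set)" "gap p 0 c (lowers A)" "cut p 0 = lowers A"
    "Less (Var 0) (Par c) \<in> p"
    using ex_gap_type[OF lowers_one_sided[OF A(2) B(1)]] by blast
  have "Less (Var 0) (Par b) \<in> p" if b: "b \<in> B" for b
  proof -
    have "\<exists>a. rlz 1 p {b, c} a" by (rule ex_rlz[OF p(1)]) simp
    then obtain a where a: "rlz 1 p {b, c} a" by blast
    have ac: "a 0 < c" using rlzD[OF a, of "Less (Var 0) (Par c)"] p(4) by (simp add: formulas_def)
    have "b \<notin> lowers A" using b B(2) by (auto simp: lowers_def)
    then have nb: "\<not> b \<le> a 0" using rlz_cut[OF a, of 0 b] p(3) by simp
    have "b \<le> c \<or> c \<le> b" using B(1,2,5) b by blast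
    then have "a 0 < b" using tree_not_le[of b c "a 0"] ac nb by (auto simp: less_imp_le)
    then show ?thesis using rlzD[OF a, of "Less (Var 0) (Par b)"] by (simp add: formulas_def)
  qed
  moreover have "Less (Par b) (Var 0) \<in> p" if b: "\<forall>a\<in>B. b < a" for b
  proof -
    have bl: "b \<in> lowers A" using b lowers_eq[OF AB] by (simp add: lowers_def)
    have "\<exists>a. rlz 1 p {b, c} a" by (rule ex_rlz[OF p(1)]) simp
    then obtain a where a: "rlz 1 p {b, c} a" by blast
    have "b < inf (a 0) c" using rlz_gap(1)[OF a p(2)] bl by simp
    then have "b < a 0" by (rule less_le_trans) simp
    then show ?thesis using rlzD[OF a, of "Less (Par b) (Var 0)"] by (simp add: formulas_def)
  qed
  ultimately have "kind_Ia \<kappa> B p"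
    using p(1) B(3) Bs unfolding kind_Ia_def by (auto simp: small_coinitial_chains_def)
  then show ?thesis using BK by blast
qed

lemma ex_kind_Ib_cut:
  assumes "C \<in> small_cofinal_cuts \<kappa>"
  shows "\<exists>p. kind_Ib \<kappa> (p :: 'a fm set) \<and> type_cut p = C"
proof -
  have pt: "Cut_pt C \<in> points \<kappa>" using assms by (simp add: points_def)
  have C: "\<not> has_max C" "small_cofinal C" using assms small_cofinal_cuts_iff by auto
  obtain c L where cL: "one_sided c L"
    "\<forall>n p i. p \<in> types n UNIV \<longrightarrow> i < n \<longrightarrow> (at p i (Cut_pt C) \<longleftrightarrow> gap p i c L)"
    using point_one_sided[OF pt] by blast
  obtain p where p: "p \<in> types 1 (UNIV :: 'a set)" "gap p 0 c L" "cut p 0 = L" "Less (Var 0) (Par c) \<in> p"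
    using ex_gap_type[OF cL(1)] by blast
  have "at p 0 (Cut_pt C)" using cL(2) p(1,2) by simp
  then have L: "L = C" using p(3) by simp
  obtain B where B: "B \<subseteq> C" "small B" "\<forall>l\<in>C. \<exists>b\<in>B. l \<le> b" using C(2) by (auto simp: small_cofinal_def)
  have "Complete_Partial_Order.chain (\<le>) B"
    using cut_chain[OF p(1), of 0] p(3) L B(1) unfolding Complete_Partial_Order.chain_def by (metis subsetD zero_less_one)
  moreover have "\<not> has_max B"
  proof
    assume "has_max B"
    then obtain m where "m \<in> B" "\<forall>a\<in>B. a \<le> m" by (auto simp: has_max_def)
    then have "m \<in> C" "\<forall>a\<in>C. a \<le> m" using B(1,3) by (blast, meson order_trans)
    then show False using C(1) by (auto simp: has_max_def)
  qed
  moreover have "Less (Par b) (Var 0) \<in> p" if b: "b \<in> B" for b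
  proof -
    have "\<exists>a. rlz 1 p {b, c} a" by (rule ex_rlz[OF p(1)]) simp
    then obtain a where a: "rlz 1 p {b, c} a" by blast
    have "b < inf (a 0) c" using rlz_gap(1)[OF a p(2)] b B(1) L by auto
    then have "b < a 0" by (rule less_le_trans) simp
    then show ?thesis using rlzD[OF a, of "Less (Par b) (Var 0)"] by (simp add: formulas_def)
  qed
  moreover have "Less (Var 0) (Par b) \<in> p" if b: "\<forall>a\<in>B. a < b" for b
  proof -
    \<comment> \<open>An upper bound \<open>b\<close> of the small cofinal set need not be
      comparable with \<open>c\<close>; its meet with \<open>c\<close> bounds \<open>C\<close> as
      well and lies in the chain where the type is defined.\<close>
    let ?d = "inf b c"
    have "?d \<notin> C"
    proof
      assume d: "?d \<in> C"
      have "l \<le> ?d" if "l \<in> C" for l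
      proof -
        obtain s where "s \<in> B" "l \<le> s" using B(3) \<open>l \<in> C\<close> by blast
        then have "l \<le> b" using b by (meson less_imp_le order_trans)
        moreover have "l \<le> c" using cL(1) L that by (auto simp: one_sided_def less_imp_le)
        ultimately show ?thesis by simp
      qed
      then show False using d C(1) by (auto simp: has_max_def)
    qed
    have "\<exists>a. rlz 1 p {b, c, ?d} a" by (rule ex_rlz[OF p(1)]) simp
    then obtain a where a: "rlz 1 p {b, c, ?d} a" by blast
    have ac: "a 0 < c" using rlzD[OF a, of "Less (Var 0) (Par c)"] p(4) by (simp add: formulas_def)
    have "\<not> ?d \<le> a 0" using rlz_cut[OF a, of 0 ?d] p(3) L \<open>?d \<notin> C\<close> by simp
    then have "a 0 < ?d" using tree_not_le[of ?d c "a 0"] ac by (auto simp: less_imp_le)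
    then have "a 0 < b" by (rule less_le_trans) simp
    then show ?thesis using rlzD[OF a, of "Less (Var 0) (Par b)"] by (simp add: formulas_def)
  qed
  ultimately have "kind_Ib \<kappa> p"
    unfolding kind_Ib_def using p(1) B(2) by (intro conjI disjI1 exI[of _ B]) auto
  moreover have "type_cut p = C" using p(3) L by (simp add: type_cut_eq)
  ultimately show ?thesis by blast
qed

lemma ex_kind_Ib_cone:
  assumes "C \<in> open_cones g"
  shows "\<exists>p. kind_Ib \<kappa> (p :: 'a fm set) \<and> type_cut p = {..g} \<and> {Less (Par g) (Meet x\<^sub>0 (Par c)) | c. c \<in> C} \<subseteq> p"
proof -
  obtain c where c: "c \<in> C" "\<forall>x. x \<in> C \<longleftrightarrow> g < inf c x" using open_cones_member[OF assms] by blast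
  have gc: "g < c" using c by auto
  have "one_sided c {..g}"
    by (rule one_sidedI_cofinal) (use gc has_max_small_cofinal[of "{..g}"] in \<open>auto intro: le_less_trans\<close>)
  then obtain p where p: "p \<in> types 1 (UNIV :: 'a set)" "gap p 0 c {..g}" "cut p 0 = {..g}" "Less (Var 0) (Par c) \<in> p"
    using ex_gap_type by blast
  have ab: "above p 0 g c" using p(2) by (simp add: gap_def)
  have "above p 0 g c'" if "c' \<in> C" for c'
    using above_mono(2)[OF p(1) _ ab order_refl, of c'] c(2) that by simp
  then have 1: "{Less (Par g) (Meet x\<^sub>0 (Par c)) | c. c \<in> C} \<subseteq> p" by (auto simp: above_def)
  have 2: "Less (Var 0) (Par b) \<in> p" if b: "g < b" "b < c" for b
  proof -
    have "\<exists>a. rlz 1 p {b, c} a" by (rule ex_rlz[OF p(1)]) simp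
    then obtain a where a: "rlz 1 p {b, c} a" by blast
    have ac: "a 0 < c" using rlzD[OF a, of "Less (Var 0) (Par c)"] p(4) by (simp add: formulas_def)
    have "\<not> b \<le> a 0" using rlz_cut[OF a, of 0 b] p(3) b(1) by auto
    then have "a 0 < b" using tree_not_le[of b c "a 0"] ac b(2) by (auto simp: less_imp_le)
    then show ?thesis using rlzD[OF a, of "Less (Var 0) (Par b)"] by (simp add: formulas_def)
  qed
  have 3: "Less (Par g) (Var 0) \<in> p"
  proof -
    have "\<exists>a. rlz 1 p {g, c} a" by (rule ex_rlz[OF p(1)]) simp
    then obtain a where a: "rlz 1 p {g, c} a" by blast
    have "g < inf (a 0) c" using rlz_above[OF a, of 0 g c] ab by simp
    then have "g < a 0" by (rule less_le_trans) simp
    then show ?thesis using rlzD[OF a, of "Less (Par g) (Var 0)"] by (simp add: formulas_def)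
  qed
  have "kind_Ib \<kappa> p"
    unfolding kind_Ib_def using p(1,4) 2 3 by (intro conjI disjI2 exI[of _ g] exI[of _ c]) auto
  moreover have "type_cut p = {..g}" using p(3) by (simp add: type_cut_eq)
  ultimately show ?thesis using 1 by (intro exI[of _ p] conjI)
qed

lemma kind_Ib_types: "kind_Ib \<kappa> p \<or> kind_IIIb \<kappa> p \<Longrightarrow> p \<in> types 1 (UNIV :: 'a set)"
  by (auto simp: kind_Ib_def kind_IIIb_def)

lemma chain_data:
  assumes "K \<in> chain_classes \<kappa>" "A \<in> K" "kind_Ia \<kappa> A p \<or> kind_IIIa \<kappa> A (p :: 'a fm set)"
  shows "(1, p) \<in> inv_types \<kappa>" "FH (1, p) = ({Chain_pt K}, 0)"
proof -
  have p: "p \<in> types 1 UNIV" using assms(3) by (auto simp: kind_Ia_def kind_IIIa_def)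
  have pt: "Chain_pt K \<in> points \<kappa>" using assms(1) by (simp add: points_def)
  have "cut p 0 = lowers A"
    using assms(3) kind_Ia_cut kind_IIIa_cut chain_class_member(2)[OF assms(1,2)] by blast
  then have "at p 0 (Chain_pt K)" using at_chain_iff[OF assms(1,2)] by blast
  then show "(1, p) \<in> inv_types \<kappa>" "FH (1, p) = ({Chain_pt K}, 0)"
    using at_inv_type[OF p pt] FH_point[OF p pt] by blast+
qed

lemma cut_data:
  assumes "C \<in> small_cofinal_cuts \<kappa>" "p \<in> types 1 (UNIV :: 'a set)" "type_cut p = C"
  shows "(1, p) \<in> inv_types \<kappa>" "FH (1, p) = ({Cut_pt C}, 0)"
proof -
  have pt: "Cut_pt C \<in> points \<kappa>" using assms(1) by (simp add: points_def)
  have "at p 0 (Cut_pt C)" using assms(3) by (simp add: type_cut_eq)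
  then show "(1, p) \<in> inv_types \<kappa>" "FH (1, p) = ({Cut_pt C}, 0)"
    using at_inv_type[OF assms(2) pt] FH_point[OF assms(2) pt] by blast+
qed

lemma cone_data:
  assumes "C \<in> open_cones g" "p \<in> types 1 (UNIV :: 'a set)" "type_cut p = {..g}"
    "{Less (Par g) (Meet x\<^sub>0 (Par c)) | c. c \<in> C} \<subseteq> p"
  shows "(1, p) \<in> inv_types \<kappa>" "FH (1, p) = ({Cone_pt g C}, 0)"
proof -
  have pt: "Cone_pt g C \<in> points \<kappa>" using assms(1) unfolding points_def by blast
  obtain c where "c \<in> C" using open_cones_member[OF assms(1)] by blast
  then have "at p 0 (Cone_pt g C)" using assms(3,4) by (auto simp: type_cut_eq above_def)
  then show "(1, p) \<in> inv_types \<kappa>" "FH (1, p) = ({Cone_pt g C}, 0)"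
    using at_inv_type[OF assms(2) pt] FH_point[OF assms(2) pt] by blast+
qed

lemma ex_point_type:
  assumes "pt \<in> points \<kappa>"
  shows "\<exists>P\<in>inv_types \<kappa>. FH P = ({pt :: 'a point}, 0)"
  using assms
proof (cases rule: points_cases)
  case (1 K)
  then show ?thesis using ex_kind_Ia[OF 1(2)] chain_data[OF 1(2)] by blast
next
  case (2 C)
  then show ?thesis using ex_kind_Ib_cut[OF 2(2)] cut_data[OF 2(2)] kind_Ib_types by blast
next
  case (3 g C)
  then show ?thesis using ex_kind_Ib_cone[OF 3(2)] cone_data[OF 3(2)] kind_Ib_types by blast
qed

text \<open>The image contains the generators, given by types in one variable, and is closed under
  the operation by \<open>tensor_inv\<close>.\<close>

lemma FH_range: "FH ` inv_types \<kappa> = {F. finite F \<and> F \<subseteq> points \<kappa>} \<times> (UNIV :: ('a \<Rightarrow>\<^sub>0 nat) set)"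
proof
  show "FH ` inv_types \<kappa> \<subseteq> {F. finite F \<and> F \<subseteq> points \<kappa>} \<times> UNIV"
  proof
    fix x assume "x \<in> FH ` inv_types \<kappa>"
    then obtain n p where "x = FH (n, p)" "p \<in> types n (UNIV :: 'a set)" using inv_typesD by auto
    then show "x \<in> {F. finite F \<and> F \<subseteq> points \<kappa>} \<times> UNIV"
      using finite_pts[of p n] by (auto simp: FH_def pts_def)
  qed
  let ?R = "\<lambda>F h. \<exists>P\<in>inv_types \<kappa>. FH P = (F, h)"
  have add: "?R (F \<union> F') (h + h')" if "?R F h" "?R F' h'" for F F' h h'
    using that tensor_inv by (metis fst_conv snd_conv)
  \<comment> \<open>The type in no variables serves as the neutral element; its assignment is never
    consulted.\<close>
  have "(0, complete_theory 0 UNIV undefined) \<in> realised_types"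
    by (auto simp: realised_types_def complete_theory_def)
  then have zero: "?R {} 0" using realised_inv by blast
  have F: "?R F 0" if "finite F" "F \<subseteq> points \<kappa>" for F
    using that
  proof (induction rule: finite_induct)
    case (insert pt F)
    then show ?case using add[of "{pt}" 0 F 0] ex_point_type[of pt] by simp
  qed (rule zero)
  have single: "?R {} (Poly_Mapping.single g k)" for g k
  proof (induction k)
    case (Suc k)
    obtain p where "kind_II g p" using ex_kind_II by blast
    then have "?R {} (Poly_Mapping.single g 1)" using kind_II_data by blast
    then show ?case using add[of "{}" _ "{}"] Suc by (fastforce simp: single_add[symmetric])
  qed (use zero in simp)
  have sum: "?R {} (\<Sum>g\<in>S. Poly_Mapping.single g (k g))" if "finite S" for S k
    using that
  proof (induction rule: finite_induct)
    case (insert g S)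
    then show ?case using add[of "{}" _ "{}"] single[of g "k g"] by fastforce
  qed (use zero in simp)
  have h: "?R {} h" for h
  proof -
    have "h = (\<Sum>g\<in>Poly_Mapping.keys h. Poly_Mapping.single g (Poly_Mapping.lookup h g))"
      by (rule poly_mapping_eqI) (auto simp: lookup_sum lookup_single when_def in_keys_iff)
    then show ?thesis using sum[of "Poly_Mapping.keys h" "Poly_Mapping.lookup h"] by simp
  qed
  show "{F. finite F \<and> F \<subseteq> points \<kappa>} \<times> UNIV \<subseteq> FH ` inv_types \<kappa>"
  proof
    fix x :: "'a point set \<times> ('a \<Rightarrow>\<^sub>0 nat)"
    assume "x \<in> {F. finite F \<and> F \<subseteq> points \<kappa>} \<times> (UNIV :: ('a \<Rightarrow>\<^sub>0 nat) set)"
    then obtain F' h' where "x = (F', h')" "finite F'" "F' \<subseteq> points \<kappa>" by auto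
    then show "x \<in> FH ` inv_types \<kappa>" using add[OF F h, of F' h'] by force
  qed
qed

section \<open>Transport to the domination monoid\<close>

definition iso_map :: "'a gtype set \<Rightarrow> 'a point set \<times> ('a \<Rightarrow>\<^sub>0 nat)" where
  "iso_map X = FH (SOME P. P \<in> X)"

abbreviation target :: "('a point set \<times> ('a \<Rightarrow>\<^sub>0 nat)) monoid" where
  "target \<equiv> Pfin (points \<kappa>) \<times>\<times> sum_nat"

lemma iso_map_class: "P \<in> inv_types \<kappa> \<Longrightarrow> iso_map (dom_class \<kappa> P) = FH P"
proof -
  assume P: "P \<in> inv_types \<kappa>"
  then have "P \<in> dom_class \<kappa> P" by (simp add: dom_class_eq)
  then have "(SOME Q. Q \<in> dom_class \<kappa> P) \<in> dom_class \<kappa> P" by (rule someI)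
  then show ?thesis using P by (simp add: iso_map_def dom_class_eq)
qed

lemma dom_carrier: "carrier (dom_monoid \<kappa>) = dom_class \<kappa> ` (inv_types \<kappa> :: 'a gtype set)"
  by (auto simp: dom_monoid_def quotient_def dom_class_def)

lemma dom_class_eq_iff:
  "P \<in> inv_types \<kappa> \<Longrightarrow> Q \<in> inv_types \<kappa> \<Longrightarrow> dom_class \<kappa> P = dom_class \<kappa> Q \<longleftrightarrow> FH P = FH Q"
  by (auto simp: dom_class_eq)

text \<open>The union over representatives that defines the product is a single class, since the
  invariant of a tensor product depends only on the invariants of its factors.\<close>

lemma dom_mult:
  fixes P Q :: "'a gtype"
  assumes "P \<in> inv_types \<kappa>" "Q \<in> inv_types \<kappa>"
  shows "dom_class \<kappa> P \<otimes>\<^bsub>dom_monoid \<kappa>\<^esub> dom_class \<kappa> Q = dom_class \<kappa> (tensor \<kappa> P Q)"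
proof -
  have eq: "dom_class \<kappa> (tensor \<kappa> P' Q') = dom_class \<kappa> (tensor \<kappa> P Q)"
    if "P' \<in> dom_class \<kappa> P" "Q' \<in> dom_class \<kappa> Q" for P' Q' :: "'a gtype"
  proof -
    have "P' \<in> inv_types \<kappa>" "Q' \<in> inv_types \<kappa>" "FH P' = FH P" "FH Q' = FH Q"
      using that assms by (simp_all add: dom_class_eq)
    then show ?thesis using assms by (simp add: tensor_inv dom_class_eq)
  qed
  have "P \<in> dom_class \<kappa> P" "Q \<in> dom_class \<kappa> Q" using assms by (simp_all add: dom_class_eq)
  then have ne: "dom_class \<kappa> P \<noteq> {}" "dom_class \<kappa> Q \<noteq> {}" by blast+
  have "(\<Union>P'\<in>dom_class \<kappa> P. \<Union>Q'\<in>dom_class \<kappa> Q. dom_class \<kappa> (tensor \<kappa> P' Q'))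
      = (\<Union>P'\<in>dom_class \<kappa> P. \<Union>Q'\<in>dom_class \<kappa> Q. dom_class \<kappa> (tensor \<kappa> P Q))"
    by (intro SUP_cong refl eq)
  also have "\<dots> = dom_class \<kappa> (tensor \<kappa> P Q)" using ne by simp
  finally show ?thesis by (simp add: dom_monoid_def)
qed

lemma dom_one: "\<exists>P\<in>inv_types \<kappa>. \<one>\<^bsub>dom_monoid \<kappa>\<^esub> = dom_class \<kappa> (P :: 'a gtype) \<and> FH P = ({}, 0)"
proof -
  have "(0, complete_theory 0 UNIV undefined) \<in> realised_types"
    by (auto simp: realised_types_def complete_theory_def)
  then obtain P :: "'a gtype" where "P \<in> inv_types \<kappa>" "FH P = ({}, 0)" using realised_inv by blast
  then show ?thesis
    using realised_types_eq by (intro bexI[of _ P]) (simp_all add: dom_monoid_def dom_class_eq)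
qed

lemma iso_map_iso: "iso_map \<in> iso (dom_monoid \<kappa>) target"
  unfolding iso_def
proof (intro CollectI conjI)
  have c: "carrier target = FH ` inv_types \<kappa>"
    by (simp add: FH_range Pfin_def sum_nat_def DirProd_def)
  show "iso_map \<in> hom (dom_monoid \<kappa>) target"
    unfolding hom_def
  proof (intro CollectI conjI ballI)
    show "iso_map \<in> carrier (dom_monoid \<kappa>) \<rightarrow> carrier target"
      unfolding dom_carrier c using iso_map_class by auto
    fix X Y :: "'a gtype set" assume "X \<in> carrier (dom_monoid \<kappa>)" "Y \<in> carrier (dom_monoid \<kappa>)"
    then obtain P Q where PQ: "P \<in> inv_types \<kappa>" "Q \<in> inv_types \<kappa>" "X = dom_class \<kappa> P" "Y = dom_class \<kappa> Q"
      unfolding dom_carrier by blast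
    then show "iso_map (X \<otimes>\<^bsub>dom_monoid \<kappa>\<^esub> Y) = iso_map X \<otimes>\<^bsub>target\<^esub> iso_map Y"
      using tensor_inv[OF PQ(1,2)]
      by (simp add: dom_mult iso_map_class Pfin_def sum_nat_def DirProd_def case_prod_beta)
  qed
  show "bij_betw iso_map (carrier (dom_monoid \<kappa>)) (carrier target)"
    unfolding bij_betw_def
  proof
    show "inj_on iso_map (carrier (dom_monoid \<kappa>))"
    proof (rule inj_onI)
      fix X Y :: "'a gtype set"
      assume XY: "X \<in> carrier (dom_monoid \<kappa>)" "Y \<in> carrier (dom_monoid \<kappa>)" "iso_map X = iso_map Y"
      obtain P Q where "P \<in> inv_types \<kappa>" "Q \<in> inv_types \<kappa>" "X = dom_class \<kappa> P" "Y = dom_class \<kappa> Q"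
        using XY(1,2) unfolding dom_carrier by blast
      then show "X = Y" using XY(3) by (simp add: iso_map_class dom_class_eq_iff)
    qed
    show "iso_map ` carrier (dom_monoid \<kappa>) = carrier target"
      unfolding dom_carrier c image_image using iso_map_class by auto
  qed
qed

text \<open>The laws are checked on invariants, where they are those of union and addition.\<close>

lemma monoid_dom: "monoid (dom_monoid \<kappa> :: 'a gtype set monoid)"
proof -
  let ?M = "dom_monoid \<kappa> :: 'a gtype set monoid"
  obtain E where E: "E \<in> inv_types \<kappa>" "\<one>\<^bsub>?M\<^esub> = dom_class \<kappa> E" "FH E = ({}, 0)" using dom_one by blast
  show ?thesis
  proof
    fix X Y assume "X \<in> carrier ?M" "Y \<in> carrier ?M"
    then obtain P Q where "P \<in> inv_types \<kappa>" "Q \<in> inv_types \<kappa>" "X = dom_class \<kappa> P" "Y = dom_class \<kappa> Q"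
      unfolding dom_carrier by blast
    then show "X \<otimes>\<^bsub>?M\<^esub> Y \<in> carrier ?M" unfolding dom_carrier by (simp add: dom_mult tensor_inv(1))
  next
    fix X Y Z assume "X \<in> carrier ?M" "Y \<in> carrier ?M" "Z \<in> carrier ?M"
    then obtain P Q R where "P \<in> inv_types \<kappa>" "Q \<in> inv_types \<kappa>" "R \<in> inv_types \<kappa>"
      "X = dom_class \<kappa> P" "Y = dom_class \<kappa> Q" "Z = dom_class \<kappa> R" unfolding dom_carrier by blast
    then show "X \<otimes>\<^bsub>?M\<^esub> Y \<otimes>\<^bsub>?M\<^esub> Z = X \<otimes>\<^bsub>?M\<^esub> (Y \<otimes>\<^bsub>?M\<^esub> Z)"
      by (simp add: dom_mult tensor_inv dom_class_eq_iff Un_assoc add.assoc)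
  next
    show "\<one>\<^bsub>?M\<^esub> \<in> carrier ?M" using E unfolding dom_carrier by blast
  next
    fix X assume "X \<in> carrier ?M"
    then obtain P where P: "P \<in> inv_types \<kappa>" "X = dom_class \<kappa> P" unfolding dom_carrier by blast
    then show "\<one>\<^bsub>?M\<^esub> \<otimes>\<^bsub>?M\<^esub> X = X" "X \<otimes>\<^bsub>?M\<^esub> \<one>\<^bsub>?M\<^esub> = X"
      unfolding E(2) by (simp_all add: dom_mult E(1,3) tensor_inv dom_class_eq_iff)
  qed
qed

lemma dom_le_iff:
  assumes "X \<in> carrier (dom_monoid \<kappa>)" "Y \<in> carrier (dom_monoid \<kappa>)"
  shows "dom_le \<kappa> X Y \<longleftrightarrow> target_le (iso_map X) (iso_map (Y :: 'a gtype set))"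
proof -
  obtain P Q where PQ: "P \<in> inv_types \<kappa>" "Q \<in> inv_types \<kappa>" "X = dom_class \<kappa> P" "Y = dom_class \<kappa> Q"
    using assms unfolding dom_carrier by blast
  have "dom_le \<kappa> X Y \<longleftrightarrow> target_le (FH P) (FH Q)"
    unfolding dom_le_def PQ dom_class_eq[OF PQ(1)] dom_class_eq[OF PQ(2)]
    using PQ(1,2) dominates_FH by (metis (mono_tags, lifting) mem_Collect_eq)
  then show ?thesis using PQ by (simp add: iso_map_class)
qed

lemma image_classes:
  assumes "\<And>p. Q p \<Longrightarrow> (1, p) \<in> inv_types \<kappa> \<and> FH (1, p) = x" "\<exists>p. Q p"
  shows "iso_map ` {dom_class \<kappa> (1, p) | p. Q p} = {x}"
proof -
  have "iso_map (dom_class \<kappa> (1, p)) = x" if "Q p" for p using assms(1)[OF that] iso_map_class by simp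
  then show ?thesis using assms(2) by blast
qed

end

theorem theorem3p11:
  fixes \<kappa> :: "'k rel"
  assumes "monster_model \<kappa> TYPE('a::dense_meet_tree)"
  shows "monoid (dom_monoid \<kappa> :: 'a gtype set monoid) \<and>
    (\<exists>f \<in> iso (dom_monoid \<kappa>) (Pfin (points \<kappa> :: 'a point set) \<times>\<times> (sum_nat :: ('a \<Rightarrow>\<^sub>0 nat) monoid)).
       f \<one>\<^bsub>dom_monoid \<kappa>\<^esub> = ({}, 0)
     \<and> (\<forall>P \<in> carrier (dom_monoid \<kappa>). \<forall>Q \<in> carrier (dom_monoid \<kappa>).
          dom_le \<kappa> P Q \<longleftrightarrow> target_le (f P) (f Q))
     \<and> (\<forall>g. f ` {dom_class \<kappa> (1, p) | p. kind_II g p} = {({}, Poly_Mapping.single g 1)})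
     \<and> (\<forall>K \<in> chain_classes \<kappa>.
          f ` {dom_class \<kappa> (1, p) | p. \<exists>A\<in>K. kind_Ia \<kappa> A p \<or> kind_IIIa \<kappa> A p}
            = {({Chain_pt K}, 0)})
     \<and> (\<forall>C \<in> small_cofinal_cuts \<kappa>.
          f ` {dom_class \<kappa> (1, p) | p. (kind_Ib \<kappa> p \<or> kind_IIIb \<kappa> p) \<and> type_cut p = C}
            = {({Cut_pt C}, 0)})
     \<and> (\<forall>g. \<forall>C \<in> open_cones g.
          f ` {dom_class \<kappa> (1, p) | p. (kind_Ib \<kappa> p \<or> kind_IIIb \<kappa> p) \<and> type_cut p = {..g}
                 \<and> {Less (Par g) (Meet x\<^sub>0 (Par c)) | c. c \<in> C} \<subseteq> p}
            = {({Cone_pt g C}, 0)}))"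
proof -
  interpret monster \<kappa> "TYPE('a)" by unfold_locales (rule assms)
  show ?thesis
  proof (intro conjI bexI[OF _ iso_map_iso] ballI allI)
    show "monoid (dom_monoid \<kappa> :: 'a gtype set monoid)" by (rule monoid_dom)
    show "iso_map \<one>\<^bsub>dom_monoid \<kappa>\<^esub> = ({}, 0)" using dom_one iso_map_class by metis
    show "dom_le \<kappa> P Q \<longleftrightarrow> target_le (iso_map P) (iso_map Q)"
      if "P \<in> carrier (dom_monoid \<kappa>)" "Q \<in> carrier (dom_monoid \<kappa>)" for P Q
      by (rule dom_le_iff[OF that])
    show "iso_map ` {dom_class \<kappa> (1, p) | p. kind_II g p} = {({}, Poly_Mapping.single g 1)}" for g
      by (rule image_classes) (use kind_II_data ex_kind_II in blast)+
    show "iso_map ` {dom_class \<kappa> (1, p) | p. \<exists>A\<in>K. kind_Ia \<kappa> A p \<or> kind_IIIa \<kappa> A p} = {({Chain_pt K}, 0)}"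
      if "K \<in> chain_classes \<kappa>" for K
      by (rule image_classes) (use chain_data[OF that] ex_kind_Ia[OF that] in blast)+
    show "iso_map ` {dom_class \<kappa> (1, p) | p. (kind_Ib \<kappa> p \<or> kind_IIIb \<kappa> p) \<and> type_cut p = C} = {({Cut_pt C}, 0)}"
      if "C \<in> small_cofinal_cuts \<kappa>" for C
      by (rule image_classes) (use cut_data[OF that] ex_kind_Ib_cut[OF that] kind_Ib_types in blast)+
    show "iso_map ` {dom_class \<kappa> (1, p) | p. (kind_Ib \<kappa> p \<or> kind_IIIb \<kappa> p) \<and> type_cut p = {..g}
                 \<and> {Less (Par g) (Meet x\<^sub>0 (Par c)) | c. c \<in> C} \<subseteq> p} = {({Cone_pt g C}, 0)}"
      if "C \<in> open_cones g" for g C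
      by (rule image_classes) (use cone_data[OF that] ex_kind_Ib_cone[OF that] kind_Ib_types in blast)+
  qed
qed

end
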